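(* Fix $L\ge 0$ and a set $\tilde\Omega$ with $\Omega^L\subseteq\tilde\Omega\subseteq C([0,T],H)$. Let $u$ be a minimax $L$-subsolution and let $v$ be a minimax $L$-supersolution of (TVP) on $[0,T]\times\tilde\Omega$. Then $u\le v$ on $[0,T]\times\tilde\Omega$.
   Context: Spaces. Let $T>0$. $H$ is a real Hilbert space with inner product $(\cdot,\cdot)$ and norm $|\cdot|$; $V$ is a separable reflexive Banach space with norm $\|\cdot\|$, continuously, densely and compactly embedded into $H$; $V^\ast$ is its dual with norm $\|\cdot\|_\ast$ and duality pairing $\langle x^\ast,x\rangle=x^\ast(x)$. With the usual identifications, $V\subseteq H\subseteq V^\ast$ and $\langle x,y\rangle=(x,y)$ for $x\in H$, $y\in V$. Fix $p\ge 2$, $q>1$ with $1/p+1/q=1$. For $t_0\in[0,T)$, $W_{pq}(t_0,T)$ is the space of all $\mathbf{x}\in L^p(t_0,T;V)$ possessing a generalized derivative $\mathbf{x}'\in L^q(t_0,T;V^\ast)$. Operator. $A:[0,T]\times V\to V^\ast$ is fixed and satisfies: (i) $t\mapsto\langle A(t,x),v\rangle$ is measurable for all $x,v\in V$; (ii) for a.e. $t$ and all $x,y\in V$, $\langle A(t,x)-A(t,y),x-y\rangle\ge 0$; (iii) for a.e. $t$ and all $x,y,v\in V$, $s\mapsto\langle A(t,x+sy),v\rangle$ is continuous on $[0,1]$; (iv) there are $a_1\in L^q(0,T)$, $c_1\ge0$ with $\|A(t,x)\|_\ast\le a_1(t)+c_1\|x\|^{p-1}$ for all $x\in V$ and a.e.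 $t$; (v) there is $c_2>0$ with $\langle A(t,x),x\rangle\ge c_2\|x\|^p$ for all $x\in V$ and a.e. $t$. Paths and continuity. $C([0,T],H)$ carries the sup norm. On $[0,T]\times C([0,T],H)$ and its subsets use the pseudo-metric $\mathbf{d}_\infty((t,x),(s,y))=|t-s|+\sup_{r\in[0,T]}|x(r\wedge t)-y(r\wedge s)|$; (semi-)continuity in $(t,x)$ is meant with respect to $\mathbf{d}_\infty$ (so such functions are non-anticipating, i.e. their value at time $t$ depends only on the path up to time $t$). USC and LSC denote real-valued upper and lower semicontinuous functions. Trajectories. For $L\ge 0$ and $(t_0,x_0)\in[0,T)\times C([0,T],H)$, $\mathcal{X}^L(t_0,x_0)$ is the set of all $x\in C([0,T],H)$ with $x=x_0$ on $[0,t_0]$ for which there exist $\mathbf{x}\in W_{pq}(t_0,T)$ and $f^x\in L^2(t_0,T;H)$ with $x=\mathbf{x}$ a.e. on $(t_0,T)$, $\mathbf{x}'(t)+A(t,\mathbf{x}(t))=f^x(t)$ a.e. on $(t_0,T)$, and $|f^x(t)|\le L(1+\sup_{0\le s\le t}|x(s)|)$ a.e. on $(t_0,T)$ ($\mathbf{x}$, $f^x$ are uniquely determined by $x$). Fix $x_\ast\in H$, regarded as a constant path, and put $\Omega^L:=\mathcal{X}^L(0,x_\ast)$. Data. $h:C([0,T],H)\to\mathbb{R}$ is continuous. $F:[0,T]\times C([0,T],H)\times H\to\mathbb{R}$ satisfies: (i) $F$ is continuous; (ii) there is $L_0\ge0$ with $|F(t,x,z)-F(t,x,\tilde z)|\le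 L_0(1+\sup_{0\le s\le t}|x(s)|)|z-\tilde z|$ for all $t,x,z,\tilde z$; (iii) for every $L\ge0$ and $(t_0,x_0)\in[0,T)\times C([0,T],H)$ there is a modulus of continuity $m_{L,t_0,x_0}$ such that for all $\varepsilon>0$, $t\in[t_0,T]$, $x,y\in\mathcal{X}^L(t_0,x_0)$: $F(t,x,\varepsilon^{-1}[x(t)-y(t)])-F(t,y,\varepsilon^{-1}[x(t)-y(t)])\le m_{L,t_0,x_0}(\varepsilon^{-1}|x(t)-y(t)|^2+\sup_{s\le t}|x(s)-y(s)|)$. (TVP) denotes the terminal-value problem $\partial_tu-\langle A(t,x(t)),\partial_xu\rangle+F(t,x,\partial_xu)=0$ on $[0,T)\times C([0,T],H)$, $u(T,x)=h(x)$. Minimax semisolutions. $u:[0,T]\times\tilde\Omega\to\mathbb{R}$ is a minimax $L$-subsolution (resp. $L$-supersolution) of (TVP) on $[0,T]\times\tilde\Omega$ if $u\in\mathrm{USC}([0,T]\times\tilde\Omega)$ (resp. $\mathrm{LSC}$), $u(T,\cdot)\le h$ (resp. $\ge h$) on $\tilde\Omega$, and for every $(t_0,x_0,z)\in[0,T)\times\tilde\Omega\times H$ there is $x\in\mathcal{X}^L(t_0,x_0)\cap\tilde\Omega$ such that for every $t\in[t_0,T]$: $u(t_0,x_0)\le$ (resp. $\ge$) $\int_{t_0}^t[(-f^x(s),z)+F(s,x,z)]\,ds+u(t,x)$. *)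

theory Defs
  imports "HOL-Analysis.Analysis"
begin

text \<open>
  The embedding of \<open>V\<close> into \<open>H\<close> is an explicit bounded linear map \<open>j\<close>, the dual of \<open>V\<close> is the
  type \<open>'v \<Rightarrow>\<^sub>L real\<close>. Separability of \<open>V\<close> is the sort \<open>second_countable_topology\<close> (equivalent for
  metric spaces). The same sort on \<open>'h\<close> is no additional restriction: \<open>H\<close> is the closure of the
  image of \<open>V\<close>, hence separable.
\<close>

definition reflexive_space :: "'v::real_normed_vector itself \<Rightarrow> bool" where
  "reflexive_space _ \<longleftrightarrow>
     (\<forall>\<phi> :: ('v \<Rightarrow>\<^sub>L real) \<Rightarrow>\<^sub>L real. \<exists>x :: 'v. \<forall>\<xi>. blinfun_apply \<phi> \<xi> = blinfun_apply \<xi> x)"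

definition dense_compact_embedding ::
    "('v::real_normed_vector \<Rightarrow>\<^sub>L 'h::real_normed_vector) \<Rightarrow> bool" where
  "dense_compact_embedding j \<longleftrightarrow>
     inj (blinfun_apply j) \<and>
     closure (range (blinfun_apply j)) = UNIV \<and>
     (\<forall>S. bounded S \<longrightarrow> compact (closure (blinfun_apply j ` S)))"

text \<open>\<open>H \<subseteq> V\<^sup>*\<close>: the functional \<open>v \<mapsto> (z, j v)\<close>.\<close>

definition to_dual :: "('v::real_normed_vector \<Rightarrow>\<^sub>L 'h::real_inner) \<Rightarrow> 'h \<Rightarrow> ('v \<Rightarrow>\<^sub>L real)" where
  "to_dual j z = blinfun_inner_right z o\<^sub>L j"

text \<open>
  Representatives of the elements of \<open>L\<^sup>r(a,b;X)\<close>. Borel measurability agrees with strong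
  measurability here, since it is only used for separable \<open>X\<close>: \<open>V\<close>, \<open>H\<close>, the reals, and the dual of
  \<open>V\<close> (separable because \<open>V\<close> is separable and reflexive).
\<close>

definition Lp_on :: "real \<Rightarrow> real \<Rightarrow> real \<Rightarrow> (real \<Rightarrow> 'a::real_normed_vector) \<Rightarrow> bool" where
  "Lp_on r a b g \<longleftrightarrow>
     g \<in> borel_measurable (lebesgue_on {a<..<b}) \<and>
     integrable (lebesgue_on {a<..<b}) (\<lambda>t. norm (g t) powr r)"

definition test_function :: "real \<Rightarrow> real \<Rightarrow> (real \<Rightarrow> real) \<Rightarrow> bool" where
  "test_function a b \<phi> \<longleftrightarrow>
     (\<forall>n t. (deriv ^^ n) \<phi> field_differentiable at t) \<and>
     (\<exists>c d. a < c \<and> d < b \<and> (\<forall>t. t \<notin> {c..d} \<longrightarrow> \<phi> t = 0))"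

text \<open>
  \<open>\<integral> \<phi>' x = - \<integral> \<phi> x'\<close> as an equality of functionals on \<open>V\<close>, i.e. evaluated at every \<open>v\<close>
  (evaluation at \<open>v\<close> commutes with the Bochner integral).
\<close>

definition generalized_derivative ::
    "('v::real_normed_vector \<Rightarrow>\<^sub>L 'h::real_inner) \<Rightarrow> real \<Rightarrow> real \<Rightarrow>
     (real \<Rightarrow> 'v) \<Rightarrow> (real \<Rightarrow> ('v \<Rightarrow>\<^sub>L real)) \<Rightarrow> bool" where
  "generalized_derivative j a b x x' \<longleftrightarrow>
     (\<forall>\<phi>. test_function a b \<phi> \<longrightarrow>
       (\<forall>v. (LINT t|lebesgue_on {a<..<b}. deriv \<phi> t * blinfun_apply (to_dual j (blinfun_apply j (x t))) v)
            = - (LINT t|lebesgue_on {a<..<b}. \<phi> t * blinfun_apply (x' t) v)))"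

text \<open>\<open>W\<^sub>p\<^sub>q(a,b)\<close>, as the relation between a function and its generalized derivative.\<close>

definition W_pq ::
    "('v::real_normed_vector \<Rightarrow>\<^sub>L 'h::real_inner) \<Rightarrow> real \<Rightarrow> real \<Rightarrow> real \<Rightarrow> real \<Rightarrow>
     (real \<Rightarrow> 'v) \<Rightarrow> (real \<Rightarrow> ('v \<Rightarrow>\<^sub>L real)) \<Rightarrow> bool" where
  "W_pq j p q a b x x' \<longleftrightarrow> Lp_on p a b x \<and> Lp_on q a b x' \<and> generalized_derivative j a b x x'"

definition admissible_operator ::
    "real \<Rightarrow> real \<Rightarrow> real \<Rightarrow> (real \<Rightarrow> 'v::real_normed_vector \<Rightarrow> ('v \<Rightarrow>\<^sub>L real)) \<Rightarrow> bool" where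
  "admissible_operator T p q A \<longleftrightarrow>
     (\<forall>x v. (\<lambda>t. blinfun_apply (A t x) v) \<in> borel_measurable (lebesgue_on {0..T})) \<and>
     (AE t in lebesgue_on {0..T}. \<forall>x y. blinfun_apply (A t x - A t y) (x - y) \<ge> 0) \<and>
     (AE t in lebesgue_on {0..T}. \<forall>x y v.
        continuous_on {0..1} (\<lambda>s. blinfun_apply (A t (x + s *\<^sub>R y)) v)) \<and>
     (\<exists>a1 c1. Lp_on q 0 T (a1 :: real \<Rightarrow> real) \<and> c1 \<ge> 0 \<and>
        (AE t in lebesgue_on {0..T}. \<forall>x. norm (A t x) \<le> a1 t + c1 * norm x powr (p - 1))) \<and>
     (\<exists>c2>0. AE t in lebesgue_on {0..T}. \<forall>x. blinfun_apply (A t x) x \<ge> c2 * norm x powr p)"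

text \<open>
  \<open>C([0,T],H)\<close> with the sup metric. Its points are functions on all reals that are fixed to
  \<open>undefined\<close> outside \<open>[0,T]\<close>, so that equality is equality on \<open>[0,T]\<close>.
\<close>

definition path_metric :: "real \<Rightarrow> (real \<Rightarrow> 'h::real_normed_vector) metric" where
  "path_metric T = cfunspace (top_of_set {0..T}) euclidean_metric"

definition paths :: "real \<Rightarrow> (real \<Rightarrow> 'h::real_normed_vector) set" where
  "paths T = mspace (path_metric T)"

lemma paths_iff: "x \<in> paths T \<longleftrightarrow> continuous_on {0..T} x \<and> x \<in> extensional {0..T}"
proof -
  have "compactin (top_of_set {0..T}) (topspace (top_of_set {0..T}))"
    by (simp add: compactin_subtopology)
  then show ?thesis
    unfolding paths_def path_metric_def by (subst compactin_mspace_cfunspace) auto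
qed

lemma mdist_path_metric:
  assumes "0 \<le> T" "x \<in> paths T" "y \<in> paths T"
  shows "mdist (path_metric T) x y = (SUP r\<in>{0..T}. norm (x r - y r))"
proof -
  have "x \<in> mspace (funspace {0..T} euclidean_metric)"
       "y \<in> mspace (funspace {0..T} euclidean_metric)"
    using assms cfunspace_subset_funspace[of "top_of_set {0..T}" euclidean_metric]
    by (auto simp: paths_def path_metric_def simp del: mspace_cfunspace mspace_funspace)
  then show ?thesis
    using assms(1)
    by (simp add: path_metric_def mdist_cfunspace_eq_mdist_funspace Met_TC.fdist_def
        dist_norm cong: conj_cong)
qed

definition d_inf :: "real \<Rightarrow> real \<Rightarrow> (real \<Rightarrow> 'h::real_normed_vector) \<Rightarrow> real \<Rightarrow> (real \<Rightarrow> 'h) \<Rightarrow> real" where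
  "d_inf T t x s y = \<bar>t - s\<bar> + (SUP r\<in>{0..T}. norm (x (min r t) - y (min r s)))"

definition usc_on ::
    "real \<Rightarrow> (real \<Rightarrow> 'h::real_normed_vector) set \<Rightarrow> (real \<Rightarrow> (real \<Rightarrow> 'h) \<Rightarrow> real) \<Rightarrow> bool" where
  "usc_on T \<Omega> u \<longleftrightarrow>
     (\<forall>t\<in>{0..T}. \<forall>x\<in>\<Omega>. \<forall>e>0. \<exists>d>0. \<forall>s\<in>{0..T}. \<forall>y\<in>\<Omega>. d_inf T t x s y < d \<longrightarrow> u s y < u t x + e)"

definition lsc_on ::
    "real \<Rightarrow> (real \<Rightarrow> 'h::real_normed_vector) set \<Rightarrow> (real \<Rightarrow> (real \<Rightarrow> 'h) \<Rightarrow> real) \<Rightarrow> bool" where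
  "lsc_on T \<Omega> u \<longleftrightarrow>
     (\<forall>t\<in>{0..T}. \<forall>x\<in>\<Omega>. \<forall>e>0. \<exists>d>0. \<forall>s\<in>{0..T}. \<forall>y\<in>\<Omega>. d_inf T t x s y < d \<longrightarrow> u s y > u t x - e)"

text \<open>
  \<open>trajectory \<dots> L t0 x0 x f\<close>: \<open>x\<close> belongs to the trajectory set of \<open>(t0,x0)\<close>, with right-hand side
  \<open>f\<close> (which \<open>x\<close> determines up to null sets); \<open>bx\<close> is the \<open>V\<close>-valued version of \<open>x\<close>.
\<close>

definition trajectory ::
    "real \<Rightarrow> real \<Rightarrow> real \<Rightarrow> ('v::real_normed_vector \<Rightarrow>\<^sub>L 'h::real_inner) \<Rightarrow>
     (real \<Rightarrow> 'v \<Rightarrow> ('v \<Rightarrow>\<^sub>L real)) \<Rightarrow> real \<Rightarrow> real \<Rightarrow> (real \<Rightarrow> 'h) \<Rightarrow>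
     (real \<Rightarrow> 'h) \<Rightarrow> (real \<Rightarrow> 'h) \<Rightarrow> bool" where
  "trajectory T p q j A L t0 x0 x f \<longleftrightarrow>
     x \<in> paths T \<and> (\<forall>t\<in>{0..t0}. x t = x0 t) \<and>
     Lp_on 2 t0 T f \<and>
     (\<exists>bx bx'. W_pq j p q t0 T bx bx' \<and>
        (AE t in lebesgue_on {t0<..<T}. x t = blinfun_apply j (bx t)) \<and>
        (AE t in lebesgue_on {t0<..<T}. bx' t + A t (bx t) = to_dual j (f t))) \<and>
     (AE t in lebesgue_on {t0<..<T}. norm (f t) \<le> L * (1 + (SUP s\<in>{0..t}. norm (x s))))"

definition trajectories ::
    "real \<Rightarrow> real \<Rightarrow> real \<Rightarrow> ('v::real_normed_vector \<Rightarrow>\<^sub>L 'h::real_inner) \<Rightarrow>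
     (real \<Rightarrow> 'v \<Rightarrow> ('v \<Rightarrow>\<^sub>L real)) \<Rightarrow> real \<Rightarrow> real \<Rightarrow> (real \<Rightarrow> 'h) \<Rightarrow> (real \<Rightarrow> 'h) set" where
  "trajectories T p q j A L t0 x0 = {x. \<exists>f. trajectory T p q j A L t0 x0 x f}"

definition Omega ::
    "real \<Rightarrow> real \<Rightarrow> real \<Rightarrow> ('v::real_normed_vector \<Rightarrow>\<^sub>L 'h::real_inner) \<Rightarrow>
     (real \<Rightarrow> 'v \<Rightarrow> ('v \<Rightarrow>\<^sub>L real)) \<Rightarrow> 'h \<Rightarrow> real \<Rightarrow> (real \<Rightarrow> 'h) set" where
  "Omega T p q j A xstar L = trajectories T p q j A L 0 (\<lambda>t\<in>{0..T}. xstar)"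

text \<open>Monotonicity of the modulus is deliberately not required.\<close>

definition modulus_of_continuity :: "(real \<Rightarrow> real) \<Rightarrow> bool" where
  "modulus_of_continuity m \<longleftrightarrow> (\<forall>r\<ge>0. m r \<ge> 0) \<and> m 0 = 0 \<and> (m \<longlongrightarrow> 0) (at_right 0)"

definition admissible_hamiltonian ::
    "real \<Rightarrow> real \<Rightarrow> real \<Rightarrow> ('v::real_normed_vector \<Rightarrow>\<^sub>L 'h::real_inner) \<Rightarrow>
     (real \<Rightarrow> 'v \<Rightarrow> ('v \<Rightarrow>\<^sub>L real)) \<Rightarrow> (real \<Rightarrow> (real \<Rightarrow> 'h) \<Rightarrow> 'h \<Rightarrow> real) \<Rightarrow> bool" where
  "admissible_hamiltonian T p q j A F \<longleftrightarrow>
     (\<forall>t\<in>{0..T}. \<forall>x\<in>paths T. \<forall>z. \<forall>e>0. \<exists>d>0. \<forall>s\<in>{0..T}. \<forall>y\<in>paths T. \<forall>w.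
        d_inf T t x s y < d \<and> norm (z - w) < d \<longrightarrow> \<bar>F t x z - F s y w\<bar> < e) \<and>
     (\<exists>L0\<ge>0. \<forall>t\<in>{0..T}. \<forall>x\<in>paths T. \<forall>z w.
        \<bar>F t x z - F t x w\<bar> \<le> L0 * (1 + (SUP s\<in>{0..t}. norm (x s))) * norm (z - w)) \<and>
     (\<forall>L\<ge>0. \<forall>t0\<in>{0..<T}. \<forall>x0\<in>paths T. \<exists>m. modulus_of_continuity m \<and>
        (\<forall>e>0. \<forall>t\<in>{t0..T}. \<forall>x\<in>trajectories T p q j A L t0 x0. \<forall>y\<in>trajectories T p q j A L t0 x0.
           F t x ((1 / e) *\<^sub>R (x t - y t)) - F t y ((1 / e) *\<^sub>R (x t - y t))
           \<le> m ((1 / e) * (norm (x t - y t))\<^sup>2 + (SUP s\<in>{0..t}. norm (x s - y s)))))"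

definition minimax_subsolution ::
    "real \<Rightarrow> real \<Rightarrow> real \<Rightarrow> ('v::real_normed_vector \<Rightarrow>\<^sub>L 'h::real_inner) \<Rightarrow>
     (real \<Rightarrow> 'v \<Rightarrow> ('v \<Rightarrow>\<^sub>L real)) \<Rightarrow> (real \<Rightarrow> (real \<Rightarrow> 'h) \<Rightarrow> 'h \<Rightarrow> real) \<Rightarrow>
     ((real \<Rightarrow> 'h) \<Rightarrow> real) \<Rightarrow> real \<Rightarrow> (real \<Rightarrow> 'h) set \<Rightarrow>
     (real \<Rightarrow> (real \<Rightarrow> 'h) \<Rightarrow> real) \<Rightarrow> bool" where
  "minimax_subsolution T p q j A F h L \<Omega> u \<longleftrightarrow>
     usc_on T \<Omega> u \<and> (\<forall>x\<in>\<Omega>. u T x \<le> h x) \<and>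
     (\<forall>t0\<in>{0..<T}. \<forall>x0\<in>\<Omega>. \<forall>z. \<exists>x\<in>\<Omega>. \<exists>f. trajectory T p q j A L t0 x0 x f \<and>
        (\<forall>t\<in>{t0..T}. u t0 x0 \<le> (LINT s|lebesgue_on {t0..t}. - f s \<bullet> z + F s x z) + u t x))"

definition minimax_supersolution ::
    "real \<Rightarrow> real \<Rightarrow> real \<Rightarrow> ('v::real_normed_vector \<Rightarrow>\<^sub>L 'h::real_inner) \<Rightarrow>
     (real \<Rightarrow> 'v \<Rightarrow> ('v \<Rightarrow>\<^sub>L real)) \<Rightarrow> (real \<Rightarrow> (real \<Rightarrow> 'h) \<Rightarrow> 'h \<Rightarrow> real) \<Rightarrow>
     ((real \<Rightarrow> 'h) \<Rightarrow> real) \<Rightarrow> real \<Rightarrow> (real \<Rightarrow> 'h) set \<Rightarrow>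
     (real \<Rightarrow> (real \<Rightarrow> 'h) \<Rightarrow> real) \<Rightarrow> bool" where
  "minimax_supersolution T p q j A F h L \<Omega> u \<longleftrightarrow>
     lsc_on T \<Omega> u \<and> (\<forall>x\<in>\<Omega>. u T x \<ge> h x) \<and>
     (\<forall>t0\<in>{0..<T}. \<forall>x0\<in>\<Omega>. \<forall>z. \<exists>x\<in>\<Omega>. \<exists>f. trajectory T p q j A L t0 x0 x f \<and>
        (\<forall>t\<in>{t0..T}. u t0 x0 \<ge> (LINT s|lebesgue_on {t0..t}. - f s \<bullet> z + F s x z) + u t x))"

end

theory Submission
  imports Defs "HOL-Library.Diagonal_Subsequence"
begin

text \<open>
  The theorem is a comparison principle, and it is proved by doubling variables along trajectories.
  Suppose that \<open>u\<close> exceeds \<open>v\<close> at some \<open>(t0,x0)\<close>. Over times \<open>t\<close> in \<open>[t0,T]\<close> and pairs \<open>x\<close>, \<open>y\<close> of trajectories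
  from \<open>(t0,x0)\<close> that lie in \<open>\<Omega>\<close>, consider
  \<open>\<Phi> = u t x - v t y - \<kappa> (T - t) - (\<alpha> / 2) (D t + P t)\<close>, where \<open>D t\<close> is the squared distance of \<open>x t\<close> and
  \<open>y t\<close> and \<open>P\<close> is its integral from \<open>t0\<close>. From any such point with \<open>t < T\<close>, the two semisolution properties for the
  same vector \<open>z = \<alpha> (x t - y t)\<close> provide continuations of \<open>x\<close> and \<open>y\<close>. By monotonicity of \<open>A\<close>, the distance of
  the continuations grows at most as the right-hand sides \<open>f\<close> and \<open>g\<close> force it to, and these terms
  cancel, up to small errors, those with \<open>z\<close> in the semisolution properties (\<open>doubling_step\<close>). What
  remains is essentially the difference of \<open>F\<close> at the two paths, which the structure condition on
  \<open>F\<close> makes small when \<open>\<alpha> D\<close> and the uniform distance of the histories are small. Then \<open>\<Phi>\<close> increases at rate at least \<open>\<kappa> / 2\<close>, which is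
  impossible at a near-maximizer, except when the terminal time is reached; there \<open>\<Phi>\<close> is small because
  of the terminal conditions.

  The set \<open>\<Omega>\<close> need not be closed, so suprema of \<open>\<Phi>\<close> need not be attained. Near-maximizers suffice
  (\<open>penalized_near_maximizer\<close>) if the length of the step from them can be chosen uniformly. This, the
  boundedness of \<open>\<Phi>\<close> from above and the uniform continuity of \<open>h\<close> all come from the relative compactness of the set of
  trajectories in \<open>C([0,T],H)\<close> (\<open>trajectories_seq_compact\<close>). That the integral penalty \<open>P\<close> controls
  the uniform distance of histories follows from a one-sided Lipschitz bound for \<open>D\<close> (\<open>X_bounds\<close>).

  Compactness needs no equicontinuity in the dual space. By coercivity, the \<open>V\<close>-valued versions of
  the trajectories are bounded in \<open>L\<^sup>p\<close>, and by Fatou's lemma every time interval contains a time at which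
  infinitely many members of a given sequence are bounded in \<open>V\<close>, so that a subsequence clusters in
  \<open>H\<close>. Since the squared distance of two trajectories grows at a bounded rate, closeness at the times
  of a fine grid is uniform closeness.

  These estimates rest on the energy identity for functions with a generalized derivative
  (\<open>energy_identity\<close>), whose proof starts from the integrated form of the weak derivative
  (\<open>weak_derivative_imp_integral\<close>) and averages increments. The concatenation of trajectories
  (\<open>trajectory_concat\<close>) needs the converse passage (\<open>integral_imp_weak_derivative\<close>).
\<close>

section \<open>Smooth cut-off functions\<close>

text \<open>The functions \<open>p (1 / x) exp (- 1 / x)\<close>, extended by \<open>0\<close> to \<open>x \<le> 0\<close>. They are closed under
  differentiation, also at \<open>0\<close>.\<close>

definition exp_poly :: "real poly \<Rightarrow> real \<Rightarrow> real" where
  "exp_poly p x = (if 0 < x then poly p (1 / x) * exp (- (1 / x)) else 0)"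

text \<open>A class of real functions that contains cut-off functions and is closed under differentiation;
  its members are therefore infinitely differentiable.\<close>

inductive_set smooth_fns :: "(real \<Rightarrow> real) set" where
  exp_poly: "exp_poly p \<in> smooth_fns"
| add: "f \<in> smooth_fns \<Longrightarrow> g \<in> smooth_fns \<Longrightarrow> (\<lambda>x. f x + g x) \<in> smooth_fns"
| mult: "f \<in> smooth_fns \<Longrightarrow> g \<in> smooth_fns \<Longrightarrow> (\<lambda>x. f x * g x) \<in> smooth_fns"
| affine: "f \<in> smooth_fns \<Longrightarrow> (\<lambda>x. c * f (a * x + b)) \<in> smooth_fns"
| antideriv: "f \<in> smooth_fns \<Longrightarrow> (\<And>x. (P has_real_derivative f x) (at x)) \<Longrightarrow> P \<in> smooth_fns"

lemma poly_times_exp_minus_tendsto_0: "((\<lambda>y::real. poly p y * exp (- y)) \<longlongrightarrow> 0) at_top"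
proof -
  have "((\<lambda>y::real. (\<Sum>i\<le>degree p. coeff p i * (y ^ i / exp y))) \<longlongrightarrow> (\<Sum>i\<le>degree p. coeff p i * 0)) at_top"
    by (intro tendsto_sum tendsto_mult tendsto_const tendsto_power_div_exp_0)
  then show ?thesis
    by (simp add: poly_altdef sum_distrib_right exp_minus divide_inverse mult.assoc)
qed

lemma exp_poly_tendsto_0: "(exp_poly p \<longlongrightarrow> 0) (at 0)"
proof -
  have "((\<lambda>x::real. poly p (1 / x) * exp (- (1 / x))) \<longlongrightarrow> 0) (at_right 0)"
    using filterlim_compose[OF poly_times_exp_minus_tendsto_0 filterlim_inverse_at_top_right, of p]
    by (simp add: inverse_eq_divide)
  then have r: "(exp_poly p \<longlongrightarrow> 0) (at_right 0)"
    by (rule Lim_transform_eventually) (auto simp: eventually_at_filter exp_poly_def)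
  have l: "(exp_poly p \<longlongrightarrow> 0) (at_left 0)"
    by (rule Lim_transform_eventually[OF tendsto_const]) (auto simp: eventually_at_filter exp_poly_def)
  show ?thesis using l r by (simp add: filterlim_at_split)
qed

lemma exp_poly_deriv:
  "(exp_poly p has_real_derivative exp_poly ((p - pderiv p) * [:0, 0, 1:]) x) (at x)"
proof -
  consider "x < 0" | "x = 0" | "x > 0" by linarith
  then show ?thesis
  proof cases
    case 1
    have "((\<lambda>_::real. 0::real) has_real_derivative 0) (at x)" by simp
    moreover have "\<forall>\<^sub>F y in nhds x. y < 0" using 1 by (intro eventually_nhds_in_open[of "{..<0}", simplified]) auto
    ultimately have "(exp_poly p has_real_derivative 0) (at x)"
      by (subst DERIV_cong_ev[where g="\<lambda>_. 0"]) (auto elim!: eventually_mono simp: exp_poly_def)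
    then show ?thesis using 1 by (simp add: exp_poly_def)
  next
    case 2
    have "(exp_poly (p * [:0, 1:]) \<longlongrightarrow> 0) (at 0)" by (rule exp_poly_tendsto_0)
    then have "((\<lambda>h. exp_poly p h / h) \<longlongrightarrow> 0) (at 0)"
      by (rule Lim_transform_eventually) (auto simp: eventually_at_filter exp_poly_def)
    then show ?thesis using 2 by (simp add: DERIV_def exp_poly_def)
  next
    case 3
    have ev: "\<forall>\<^sub>F y in nhds x. 0 < y" using 3 by (intro eventually_nhds_in_open[of "{0<..}", simplified]) auto
    have "((\<lambda>x. poly p (1 / x) * exp (- (1 / x))) has_real_derivative
        poly (pderiv p) (1/x) * (- (1 / x^2)) * exp (- (1 / x)) + poly p (1/x) * (exp (- (1 / x)) * (1 / x^2))) (at x)"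
      using 3 by (auto intro!: derivative_eq_intros simp: power2_eq_square)
    moreover have "poly (pderiv p) (1/x) * (- (1 / x^2)) * exp (- (1 / x)) + poly p (1/x) * (exp (- (1 / x)) * (1 / x^2))
       = exp_poly ((p - pderiv p) * [:0, 0, 1:]) x"
      using 3 by (simp add: exp_poly_def field_simps power2_eq_square)
    ultimately have "((\<lambda>x. poly p (1 / x) * exp (- (1 / x))) has_real_derivative
        exp_poly ((p - pderiv p) * [:0, 0, 1:]) x) (at x)" by simp
    then show ?thesis
      by (subst DERIV_cong_ev[where g="\<lambda>x. poly p (1 / x) * exp (- (1 / x))"])
        (use ev in \<open>auto elim!: eventually_mono simp: exp_poly_def\<close>)
  qed
qed

lemma smooth_fns_deriv:
  "f \<in> smooth_fns \<Longrightarrow> \<exists>f'\<in>smooth_fns. \<forall>x. (f has_real_derivative f' x) (at x)"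
proof (induction rule: smooth_fns.induct)
  case (exp_poly p)
  then show ?case using exp_poly_deriv smooth_fns.exp_poly by blast
next
  case (add f g)
  then obtain f' g' where "f' \<in> smooth_fns" "g' \<in> smooth_fns"
    "\<And>x. (f has_real_derivative f' x) (at x)" "\<And>x. (g has_real_derivative g' x) (at x)" by blast
  then show ?case
    by (intro bexI[of _ "\<lambda>x. f' x + g' x"]) (auto intro!: derivative_intros smooth_fns.add)
next
  case (mult f g)
  then obtain f' g' where "f' \<in> smooth_fns" "g' \<in> smooth_fns"
    "\<And>x. (f has_real_derivative f' x) (at x)" "\<And>x. (g has_real_derivative g' x) (at x)" by blast
  then show ?case
    by (intro bexI[of _ "\<lambda>x. f' x * g x + g' x * f x"])
      (use mult in \<open>auto intro!: DERIV_mult smooth_fns.add smooth_fns.mult\<close>)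
next
  case (affine f c a b)
  then obtain f' where f': "f' \<in> smooth_fns" "\<And>x. (f has_real_derivative f' x) (at x)" by blast
  have "((\<lambda>x. c * f (a * x + b)) has_real_derivative c * a * f' (a * x + b)) (at x)" for x
  proof -
    have "((\<lambda>x. f (a * x + b)) has_real_derivative f' (a * x + b) * a) (at x)"
      by (rule DERIV_chain2[OF f'(2)]) (auto intro!: derivative_eq_intros)
    from DERIV_cmult[OF this, of c] show ?thesis by (simp add: mult_ac)
  qed
  moreover have "(\<lambda>x. c * a * f' (a * x + b)) \<in> smooth_fns"
    by (rule smooth_fns.affine[OF f'(1)])
  ultimately show ?case by (intro bexI[of _ "\<lambda>x. c * a * f' (a * x + b)"]) auto
qed blast

text \<open>The form in which smoothness enters \<open>test_function\<close>.\<close>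

lemma smooth_fns_differentiable:
  assumes "f \<in> smooth_fns" shows "(deriv ^^ n) f field_differentiable at t"
proof -
  have d: "deriv g \<in> smooth_fns" if g: "g \<in> smooth_fns" for g
  proof -
    obtain g' where g': "g' \<in> smooth_fns" "\<And>x. (g has_real_derivative g' x) (at x)"
      using smooth_fns_deriv[OF g] by blast
    have "deriv g = g'" using g'(2) DERIV_imp_deriv by blast
    then show ?thesis using g'(1) by simp
  qed
  have "(deriv ^^ n) f \<in> smooth_fns" by (induction n) (auto simp: assms d)
  then show ?thesis using smooth_fns_deriv field_differentiable_def by blast
qed

text \<open>A smooth transition from \<open>0\<close> to \<open>1\<close> inside \<open>[0,1]\<close>.\<close>

lemma smooth_step_exists:
  obtains P \<rho> :: "real \<Rightarrow> real" where "P \<in> smooth_fns" "\<And>x. (P has_real_derivative \<rho> x) (at x)"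
    "continuous_on UNIV \<rho>"
    "\<And>x. \<rho> x \<ge> 0" "\<And>x. x \<notin> {0<..<1} \<Longrightarrow> \<rho> x = 0" "\<And>x. x \<le> 0 \<Longrightarrow> P x = 0" "\<And>x. x \<ge> 1 \<Longrightarrow> P x = 1"
    "\<And>x. 0 \<le> P x" "\<And>x. P x \<le> 1"
proof -
  define \<sigma> where "\<sigma> = (\<lambda>x. exp_poly 1 x * (1 * exp_poly 1 ((-1) * x + 1)))"
  have \<sigma>S: "\<sigma> \<in> smooth_fns" unfolding \<sigma>_def by (intro smooth_fns.mult smooth_fns.affine smooth_fns.exp_poly)
  have \<sigma>0: "\<sigma> x \<ge> 0" for x by (simp add: \<sigma>_def exp_poly_def)
  have \<sigma>z: "\<sigma> x = 0" if "x \<notin> {0<..<1}" for x using that by (auto simp add: \<sigma>_def exp_poly_def)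
  have \<sigma>c: "continuous_on S \<sigma>" for S
    using smooth_fns_deriv[OF \<sigma>S] by (meson DERIV_continuous continuous_at_imp_continuous_on)
  \<comment> \<open>\<open>\<sigma>\<close> vanishes on the negative axis; starting the integral at \<open>-1\<close> makes the fundamental theorem
      applicable at \<open>0\<close> from both sides.\<close>
  define c where "c = integral {-1..1} \<sigma>"
  define Q where "Q x = integral {-1..x} \<sigma>" for x
  have Q0: "Q x = 0" if "x \<le> 0" for x
  proof -
    have "Q x = integral {-1..x} (\<lambda>_. 0)" unfolding Q_def
      by (rule integral_cong) (use that \<sigma>z in auto)
    then show ?thesis by simp
  qed
  have Qd: "(Q has_real_derivative \<sigma> x) (at x)" for x
  proof (cases "x < 0")
    case True
    have "\<forall>\<^sub>F y in nhds x. y < 0" using True by (intro eventually_nhds_in_open[of "{..<0}", simplified]) auto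
    then have "(Q has_real_derivative 0) (at x)"
      by (subst DERIV_cong_ev[where g="\<lambda>_. 0"]) (auto elim!: eventually_mono simp: Q0)
    then show ?thesis using True \<sigma>z by auto
  next
    case False
    have "(Q has_real_derivative \<sigma> x) (at x within {-1..x+1})" unfolding Q_def
      by (rule integral_has_real_derivative) (use False \<sigma>c in auto)
    moreover have "at x within {-1..x+1} = at x"
      by (rule at_within_interior) (use False in auto)
    ultimately show ?thesis by simp
  qed
  have mono: "Q x \<le> Q y" if "x \<le> y" for x y
    by (rule DERIV_nonneg_imp_nondecreasing[OF that]) (use Qd \<sigma>0 in blast)
  have Q1: "Q x = c" if "x \<ge> 1" for x
  proof -
    have "integral {-1..x} \<sigma> = integral {-1..1} \<sigma> + integral {1..x} \<sigma>"
      by (rule Henstock_Kurzweil_Integration.integral_combine[symmetric]) (use that \<sigma>c in \<open>auto intro: integrable_continuous_real\<close>)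
    moreover have "integral {1..x} \<sigma> = integral {1..x} (\<lambda>_. 0)"
      by (rule integral_cong) (use \<sigma>z in auto)
    ultimately show ?thesis by (simp add: Q_def c_def)
  qed
  have "\<exists>z. 0 < z \<and> z < 1/2 \<and> Q (1/2) - Q 0 = (1/2 - 0) * \<sigma> z"
    by (rule MVT2) (use Qd in auto)
  then obtain z where z: "0 < z" "z < 1/2" "Q (1/2) = \<sigma> z / 2" using Q0[of 0] by auto
  have "0 < \<sigma> z" using z by (simp add: \<sigma>_def exp_poly_def)
  then have "0 < Q (1/2)" using z by simp
  also have "\<dots> \<le> Q 1" by (rule mono) simp
  finally have cpos: "0 < c" using Q1[of 1] by simp
  have QS: "Q \<in> smooth_fns" by (rule smooth_fns.antideriv[OF \<sigma>S Qd])
  show thesis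
  proof
    show "(\<lambda>x. (1 / c) * Q (1 * x + 0)) \<in> smooth_fns" by (rule smooth_fns.affine[OF QS])
    show "((\<lambda>x. (1 / c) * Q (1 * x + 0)) has_real_derivative (1 / c) * \<sigma> x) (at x)" for x
      using DERIV_cmult[OF Qd, of "1/c" x] by simp
    show "continuous_on UNIV (\<lambda>x. (1 / c) * \<sigma> x)" by (intro continuous_intros \<sigma>c)
    show "(1 / c) * \<sigma> x \<ge> 0" for x using cpos \<sigma>0 by simp
    show "(1 / c) * \<sigma> x = 0" if "x \<notin> {0<..<1}" for x using \<sigma>z[OF that] by simp
    show "(1 / c) * Q (1 * x + 0) = 0" if "x \<le> 0" for x using Q0[OF that] by simp
    show "(1 / c) * Q (1 * x + 0) = 1" if "x \<ge> 1" for x using Q1[OF that] cpos by simp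
    show "0 \<le> (1 / c) * Q (1 * x + 0)" for x
      using mono[of "min x 0" x] Q0[of "min x 0"] cpos by simp
    show "(1 / c) * Q (1 * x + 0) \<le> 1" for x
      using mono[of x "max x 1"] Q1[of "max x 1"] cpos by simp
  qed
qed

section \<open>Weak derivatives of continuous functions\<close>

text \<open>A smooth approximation of the indicator function of \<open>[s,t]\<close>.\<close>

lemma test_function_step:
  assumes "P \<in> smooth_fns" "\<And>x. x \<le> 0 \<Longrightarrow> P x = 0" "\<And>x. x \<ge> 1 \<Longrightarrow> P x = 1"
    and "a < s" "s \<le> t" "t + 1 / n < b" "n > 0"
  shows "test_function a b (\<lambda>r. P (n * (r - s)) - P (n * (r - t)))"
proof -
  have eq: "(\<lambda>r. P (n * (r - s)) - P (n * (r - t))) =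
    (\<lambda>r. 1 * P (n * r + (- n * s)) + (-1) * P (n * r + (- n * t)))"
    by (auto simp: algebra_simps)
  have "(\<lambda>r. P (n * (r - s)) - P (n * (r - t))) \<in> smooth_fns"
    unfolding eq by (intro smooth_fns.add smooth_fns.affine assms)
  moreover have "P (n * (r - s)) - P (n * (r - t)) = 0" if "r \<notin> {s..t + 1 / n}" for r
  proof (cases "r < s")
    case True
    then have "n * (r - s) \<le> 0" "n * (r - t) \<le> 0" using assms by (auto simp: mult_le_0_iff)
    then show ?thesis using assms by simp
  next
    case False
    then have "r > t + 1/n" using that by auto
    then have "1 \<le> n * (r - t)" using assms by (simp add: field_simps)
    moreover have "n * (r - t) \<le> n * (r - s)" using assms by (intro mult_left_mono) auto
    ultimately have "1 \<le> n * (r - s)" "1 \<le> n * (r - t)" by auto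
    then show ?thesis using assms by simp
  qed
  ultimately show ?thesis
    unfolding test_function_def using smooth_fns_differentiable assms(4,6) by blast
qed


text \<open>The derivatives of the rescaled steps \<open>P (n (r - s))\<close> converge to the point evaluation at \<open>s\<close>.\<close>

lemma approximate_identity:
  fixes g :: "real \<Rightarrow> real"
  assumes P: "\<And>x. (P has_real_derivative \<rho> x) (at x)" and \<rho>c: "continuous_on UNIV \<rho>"
    and \<rho>0: "\<And>x. \<rho> x \<ge> 0" and \<rho>z: "\<And>x. x \<notin> {0<..<1} \<Longrightarrow> \<rho> x = 0"
    and P0: "\<And>x. x \<le> 0 \<Longrightarrow> P x = 0" and P1: "\<And>x. x \<ge> 1 \<Longrightarrow> P x = 1"
    and g: "continuous_on {a..b} g" and s: "a \<le> s" "s < b"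
  shows "(\<lambda>n. integral {a..b} (\<lambda>r. real n * \<rho> (real n * (r - s)) * g r)) \<longlonglongrightarrow> g s"
proof (rule LIMSEQ_I)
  fix e :: real assume e: "0 < e"
  obtain d where d: "d > 0" "\<And>r. r \<in> {a..b} \<Longrightarrow> dist r s < d \<Longrightarrow> dist (g r) (g s) < e / 2"
    using g s e unfolding continuous_on_iff by (metis atLeastAtMost_iff half_gt_zero less_imp_le)
  obtain N :: nat where N: "real N > max (1 / d) (1 / (b - s))" using reals_Archimedean2 by blast
  show "\<exists>N. \<forall>n\<ge>N. norm (integral {a..b} (\<lambda>r. real n * \<rho> (real n * (r - s)) * g r) - g s) < e"
  proof (intro exI allI impI)
    fix n assume "N \<le> n"
    then have n1: "real n > 1 / d" "real n > 1 / (b - s)" using N by auto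
    have n0: "real n > 0" using n1(1) d(1) by (meson less_trans zero_less_divide_1_iff)
    have nd: "1 / real n < d" "1 / real n < b - s" using n1 n0 d s by (auto simp: field_simps)
    let ?k = "\<lambda>r. real n * \<rho> (real n * (r - s))"
    have kc: "continuous_on {a..b} ?k"
      by (intro continuous_intros continuous_on_compose2[OF \<rho>c]) auto
    have k: "(?k has_integral P (real n * (b - s)) - P (real n * (a - s))) {a..b}"
    proof (rule fundamental_theorem_of_calculus)
      show "((\<lambda>r. P (real n * (r - s))) has_vector_derivative ?k x) (at x within {a..b})" for x
      proof -
        have "((\<lambda>r. P (real n * (r - s))) has_real_derivative \<rho> (real n * (x - s)) * real n) (at x)"
          by (rule DERIV_chain2[OF P]) (auto intro!: derivative_eq_intros)
        then show ?thesis
          by (simp add: has_real_derivative_iff_has_vector_derivative mult.commute has_vector_derivative_at_within)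
      qed
    qed (use s in auto)
    have "1 \<le> real n * (b - s)" using nd n0 by (simp add: field_simps)
    moreover have "real n * (a - s) \<le> 0" using s by (simp add: mult_le_0_iff)
    ultimately have k1: "(?k has_integral 1) {a..b}" using k P0 P1 by simp
    have i1: "((\<lambda>r. ?k r * g s) has_integral 1 * g s) {a..b}"
      by (rule has_integral_mult_left[OF k1])
    have i2: "((\<lambda>r. ?k r * g r) has_integral integral {a..b} (\<lambda>r. ?k r * g r)) {a..b}"
      by (intro integrable_integral integrable_continuous_real continuous_intros kc g)
    have diff: "((\<lambda>r. ?k r * g r - ?k r * g s) has_integral
        integral {a..b} (\<lambda>r. ?k r * g r) - g s) {a..b}" using has_integral_diff[OF i2 i1] by simp
    have "norm (integral {a..b} (\<lambda>r. ?k r * g r - ?k r * g s)) \<le> integral {a..b} (\<lambda>r. ?k r * (e / 2))"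
    proof (rule integral_norm_bound_integral)
      show "(\<lambda>r. ?k r * g r - ?k r * g s) integrable_on {a..b}" using diff by blast
      show "(\<lambda>r. ?k r * (e / 2)) integrable_on {a..b}"
        by (intro integrable_continuous_real continuous_intros kc)
      fix r assume r: "r \<in> {a..b}"
      show "norm (?k r * g r - ?k r * g s) \<le> ?k r * (e / 2)"
      proof (cases "real n * (r - s) \<in> {0<..<1}")
        case True
        then have "0 < r - s" "r - s < 1 / real n" using n0 by (auto simp: zero_less_mult_iff field_simps)
        then have "\<bar>g r - g s\<bar> < e / 2" using d(2)[OF r] nd by (auto simp: dist_real_def)
        then have "?k r * \<bar>g r - g s\<bar> \<le> ?k r * (e / 2)"
          by (intro mult_left_mono) (use \<rho>0 n0 in auto)
        moreover have "\<bar>?k r * g r - ?k r * g s\<bar> = ?k r * \<bar>g r - g s\<bar>"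
          using \<rho>0[of "real n * (r - s)"] n0 by (simp add: right_diff_distrib[symmetric] abs_mult)
        ultimately show ?thesis by simp
      qed (use \<rho>z in simp)
    qed
    moreover have "integral {a..b} (\<lambda>r. ?k r * (e / 2)) = 1 * (e / 2)"
      by (intro integral_unique has_integral_mult_left[OF k1])
    ultimately show "norm (integral {a..b} (\<lambda>r. ?k r * g r) - g s) < e"
      using diff e by (simp add: integral_unique)
  qed
qed

lemma absolutely_integrable_mult_bounded:
  fixes \<gamma> \<phi> :: "real \<Rightarrow> real"
  assumes "\<gamma> absolutely_integrable_on {a..b}" "continuous_on {a..b} \<phi>"
  shows "(\<lambda>t. \<phi> t * \<gamma> t) absolutely_integrable_on {a..b}"
proof (rule absolutely_integrable_bounded_measurable_product_real)
  show "\<phi> \<in> borel_measurable (lebesgue_on {a..b})"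
    by (rule continuous_imp_measurable_on_sets_lebesgue[OF assms(2)]) simp
  show "bounded (\<phi> ` {a..b})"
    using compact_continuous_image[OF assms(2)] by (simp add: compact_imp_bounded)
qed (use assms in auto)

text \<open>A weakly differentiable continuous function is the indefinite integral of its weak derivative:
  test with the approximate indicator functions of \<open>[s,t]\<close>.\<close>

lemma weak_derivative_imp_integral:
  fixes g \<gamma> :: "real \<Rightarrow> real"
  assumes g: "continuous_on {a..b} g" and \<gamma>: "\<gamma> absolutely_integrable_on {a..b}"
    and weak: "\<And>\<phi>. test_function a b \<phi> \<Longrightarrow>
      integral {a..b} (\<lambda>t. deriv \<phi> t * g t) = - integral {a..b} (\<lambda>t. \<phi> t * \<gamma> t)"
    and st: "a \<le> s" "s \<le> t" "t \<le> b"
  shows "(\<gamma> has_integral (g t - g s)) {s..t}"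
proof -
  obtain P \<rho> :: "real \<Rightarrow> real" where P: "P \<in> smooth_fns" "\<And>x. (P has_real_derivative \<rho> x) (at x)"
    "continuous_on UNIV \<rho>"
    "\<And>x. \<rho> x \<ge> 0" "\<And>x. x \<notin> {0<..<1} \<Longrightarrow> \<rho> x = 0" "\<And>x. x \<le> 0 \<Longrightarrow> P x = 0" "\<And>x. x \<ge> 1 \<Longrightarrow> P x = 1"
    "\<And>x. 0 \<le> P x" "\<And>x. P x \<le> 1" by (rule smooth_step_exists) blast
  have Pc: "continuous_on S P" for S
    using P(2) by (meson DERIV_continuous continuous_at_imp_continuous_on)
  have int_sub: "\<gamma> integrable_on {s..t}" if "a \<le> s" "t \<le> b" for s t
    using \<gamma> that by (meson absolutely_integrable_on_def atLeastatMost_subset_iff integrable_on_subinterval)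
  have inner: "integral {s..t} \<gamma> = g t - g s" if st: "a < s" "s \<le> t" "t < b" for s t
  proof -
    define \<phi> where "\<phi> n r = P (real n * (r - s)) - P (real n * (r - t))" for n r
    have \<phi>b: "\<bar>\<phi> n r\<bar> \<le> 1" for n r
      using P(8,9)[of "real n * (r - s)"] P(8,9)[of "real n * (r - t)"] by (auto simp: \<phi>_def)
    have \<phi>c: "continuous_on S (\<phi> n)" for S n unfolding \<phi>_def
      by (intro continuous_intros continuous_on_compose2[OF Pc[of UNIV]]) auto
    have deriv_\<phi>: "deriv (\<phi> n) r = real n * \<rho> (real n * (r - s)) - real n * \<rho> (real n * (r - t))" for n r
    proof -
      have "((\<lambda>r. P (real n * (r - c))) has_real_derivative \<rho> (real n * (r - c)) * real n) (at r)" for c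
        by (rule DERIV_chain2[OF P(2)]) (auto intro!: derivative_eq_intros)
      from DERIV_imp_deriv[OF DERIV_diff[OF this[of s] this[of t]]] show ?thesis
        unfolding \<phi>_def by (simp add: mult.commute)
    qed
    have lim1: "(\<lambda>n. integral {a..b} (\<lambda>r. deriv (\<phi> n) r * g r)) \<longlonglongrightarrow> g s - g t"
    proof -
      have kc: "(\<lambda>r. real n * \<rho> (real n * (r - c)) * g r) integrable_on {a..b}" for c n
        by (intro integrable_continuous_real continuous_intros continuous_on_compose2[OF P(3)] g) auto
      have "integral {a..b} (\<lambda>r. deriv (\<phi> n) r * g r) =
        integral {a..b} (\<lambda>r. real n * \<rho> (real n * (r - s)) * g r) -
        integral {a..b} (\<lambda>r. real n * \<rho> (real n * (r - t)) * g r)" for n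
        by (subst integral_diff[symmetric]) (auto simp: kc deriv_\<phi> left_diff_distrib)
      moreover have "(\<lambda>n. integral {a..b} (\<lambda>r. real n * \<rho> (real n * (r - s)) * g r) -
        integral {a..b} (\<lambda>r. real n * \<rho> (real n * (r - t)) * g r)) \<longlonglongrightarrow> g s - g t"
        by (intro tendsto_diff approximate_identity[OF P(2-7) g]) (use st in auto)
      ultimately show ?thesis by simp
    qed
    have lim2: "(\<lambda>n. integral {a..b} (\<lambda>r. \<phi> n r * \<gamma> r)) \<longlonglongrightarrow> integral {a..b} (\<lambda>r. indicat_real {s<..t} r * \<gamma> r)"
    proof (rule dominated_convergence(2))
      show "(\<lambda>r. \<phi> n r * \<gamma> r) integrable_on {a..b}" for n
        using absolutely_integrable_mult_bounded[OF \<gamma> \<phi>c] by (simp add: absolutely_integrable_on_def)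
      show "(\<lambda>r. norm (\<gamma> r)) integrable_on {a..b}" using \<gamma> by (simp add: absolutely_integrable_on_def)
      show "norm (\<phi> n r * \<gamma> r) \<le> norm (\<gamma> r)" for n r
        using mult_right_mono[OF \<phi>b[of n r], of "\<bar>\<gamma> r\<bar>"] by (simp add: abs_mult)
      fix r
      have lP: "(\<lambda>n. P (real n * (r - c))) \<longlonglongrightarrow> indicat_real {c<..} r" for c
      proof (cases "r > c")
        case True
        obtain N :: nat where N: "real N > 1 / (r - c)" using reals_Archimedean2 by blast
        have "P (real n * (r - c)) = 1" if "n \<ge> N" for n
        proof -
          have "real n > 1 / (r - c)" using N that by linarith
          then have "1 \<le> real n * (r - c)" using True by (simp add: field_simps)
          then show ?thesis by (rule P(7))
        qed
        then have "\<forall>\<^sub>F n in sequentially. P (real n * (r - c)) = 1"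
          unfolding eventually_sequentially by blast
        then show ?thesis using True by (simp add: tendsto_eventually)
      next
        case False
        then have "P (real n * (r - c)) = 0" for n by (intro P(6)) (simp add: mult_le_0_iff)
        then show ?thesis using False by simp
      qed
      have "indicat_real {s<..} r - indicat_real {t<..} r = indicat_real {s<..t} r"
        using st by (auto simp: indicator_def)
      then have "(\<lambda>n. \<phi> n r) \<longlonglongrightarrow> indicat_real {s<..t} r"
        using tendsto_diff[OF lP[of s] lP[of t]] by (simp add: \<phi>_def)
      then show "(\<lambda>n. \<phi> n r * \<gamma> r) \<longlonglongrightarrow> indicat_real {s<..t} r * \<gamma> r" by (intro tendsto_intros)
    qed
    obtain N :: nat where N: "real N > 1 / (b - t)" using reals_Archimedean2 by blast
    have "integral {a..b} (\<lambda>r. deriv (\<phi> n) r * g r) = - integral {a..b} (\<lambda>r. \<phi> n r * \<gamma> r)" if "n \<ge> N" for n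
    proof (rule weak)
      have "real n > 1 / (b - t)" using N that by linarith
      moreover have n0: "real n > 0" using calculation st by (meson diff_gt_0_iff_gt less_trans zero_less_divide_1_iff)
      ultimately have "t + 1 / real n < b" using st by (simp add: field_simps)
      then show "test_function a b (\<phi> n)" unfolding \<phi>_def
        by (intro test_function_step P st n0)
    qed
    then have "\<forall>\<^sub>F n in sequentially. integral {a..b} (\<lambda>r. deriv (\<phi> n) r * g r) = - integral {a..b} (\<lambda>r. \<phi> n r * \<gamma> r)"
      unfolding eventually_sequentially by blast
    then have "(\<lambda>n. - integral {a..b} (\<lambda>r. \<phi> n r * \<gamma> r)) \<longlonglongrightarrow> g s - g t"
      by (rule Lim_transform_eventually[OF lim1])
    with tendsto_minus[OF lim2] have e1: "- integral {a..b} (\<lambda>r. indicat_real {s<..t} r * \<gamma> r) = g s - g t"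
      by (rule LIMSEQ_unique)
    have Int_eq: "{s..t} \<inter> {a..b} = {s..t}" using st by auto
    have "integral {a..b} (\<lambda>r. indicat_real {s<..t} r * \<gamma> r) = integral {a..b} (\<lambda>r. if r \<in> {s..t} then \<gamma> r else 0)"
      by (rule integral_spike[of "{s}"]) (auto simp: indicator_def)
    also have "\<dots> = integral {s..t} \<gamma>"
      by (simp only: integral_restrict_Int Int_eq)
    finally show ?thesis using e1 by simp
  qed
  show ?thesis
  proof (cases "a < b")
    case False
    then have "s = t" using st by auto
    then show ?thesis by (simp add: has_integral_refl(2))
  next
    case True
    define \<Psi> where "\<Psi> t = integral {a..t} \<gamma> - g t" for t
    have \<Psi>c: "continuous_on {a..b} \<Psi>"
      unfolding \<Psi>_def by (intro continuous_intros indefinite_integral_continuous_1 int_sub g) auto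
    define m where "m = (a + b) / 2"
    have m: "a < m" "m < b" using True by (auto simp: m_def)
    have *: "\<Psi> t = \<Psi> m" if "t \<in> {a<..<b}" for t
    proof -
      have eq: "\<Psi> t = \<Psi> s" if "a < s" "s \<le> t" "t < b" for s t
        using inner[OF that] Henstock_Kurzweil_Integration.integral_combine[of a s t \<gamma>] that int_sub[of a t]
        by (simp add: \<Psi>_def)
      show ?thesis
      proof (cases "t \<le> m")
        case True
        show ?thesis by (rule eq[symmetric]) (use True m that in auto)
      next
        case False
        show ?thesis by (rule eq) (use False m that in auto)
      qed
    qed
    have cl: "closure {a<..<b} = {a..b}" using True by simp
    have "\<Psi> t = \<Psi> m" if "t \<in> {a..b}" for t
      by (rule continuous_constant_on_closure[of "{a<..<b}"]) (use that \<Psi>c * cl in auto)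
    then have "\<Psi> s = \<Psi> t" using st by auto
    then have "integral {s..t} \<gamma> = g t - g s"
      using Henstock_Kurzweil_Integration.integral_combine[of a s t \<gamma>] st int_sub[of a t] by (simp add: \<Psi>_def)
    then show ?thesis using int_sub[of s t] st by (metis has_integral_integral)
  qed
qed


text \<open>A function \<open>\<Theta>\<close> whose increments are of second order in this sense does not vary: telescope over \<open>n\<close>
  equal pieces.\<close>

lemma constant_if_second_order_increments:
  fixes \<Theta> G :: "real \<Rightarrow> real"
  assumes ab: "a \<le> b" and inc: "\<And>s t. a \<le> s \<Longrightarrow> s \<le> t \<Longrightarrow> t \<le> b \<Longrightarrow> \<bar>\<Theta> t - \<Theta> s\<bar> \<le> K * (t - s) * (G t - G s)"
  shows "\<Theta> b = \<Theta> a"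
proof -
  have bound: "\<bar>\<Theta> b - \<Theta> a\<bar> \<le> K * (b - a) * (G b - G a) / real (Suc n)" for n
  proof -
    define N where "N = real (Suc n)"
    have N: "N > 0" by (simp add: N_def)
    define \<tau> where "\<tau> i = a + real i * ((b - a) / N)" for i
    have \<tau>0: "\<tau> 0 = a" and \<tau>N: "\<tau> (Suc n) = b" using N by (auto simp: \<tau>_def N_def field_simps)
    have step: "\<tau> (Suc i) - \<tau> i = (b - a) / N" for i by (simp add: \<tau>_def distrib_right add_divide_distrib)
    have mono: "\<tau> i \<le> \<tau> k" if "i \<le> k" for i k
      using that ab N unfolding \<tau>_def by (intro add_left_mono mult_right_mono) auto
    have "\<bar>\<Theta> b - \<Theta> a\<bar> = \<bar>\<Sum>i<Suc n. \<Theta> (\<tau> (Suc i)) - \<Theta> (\<tau> i)\<bar>"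
      using sum_lessThan_telescope[of "\<lambda>i. \<Theta> (\<tau> i)" "Suc n"] by (simp add: \<tau>0 \<tau>N del: sum.lessThan_Suc)
    also have "\<dots> \<le> (\<Sum>i<Suc n. \<bar>\<Theta> (\<tau> (Suc i)) - \<Theta> (\<tau> i)\<bar>)" by (rule sum_abs)
    also have "\<dots> \<le> (\<Sum>i<Suc n. K * ((b - a) / N) * (G (\<tau> (Suc i)) - G (\<tau> i)))"
    proof (rule sum_mono)
      fix i assume "i \<in> {..<Suc n}"
      then have "a \<le> \<tau> i" "\<tau> i \<le> \<tau> (Suc i)" "\<tau> (Suc i) \<le> b"
        using mono[of 0 i] mono[of i "Suc i"] mono[of "Suc i" "Suc n"] \<tau>0 \<tau>N by auto
      from inc[OF this] show "\<bar>\<Theta> (\<tau> (Suc i)) - \<Theta> (\<tau> i)\<bar> \<le> K * ((b - a) / N) * (G (\<tau> (Suc i)) - G (\<tau> i))"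
        by (simp add: step)
    qed
    also have "\<dots> = K * ((b - a) / N) * (\<Sum>i<Suc n. G (\<tau> (Suc i)) - G (\<tau> i))"
      by (simp only: sum_distrib_left)
    also have "(\<Sum>i<Suc n. G (\<tau> (Suc i)) - G (\<tau> i)) = G b - G a"
      using sum_lessThan_telescope[of "\<lambda>i. G (\<tau> i)" "Suc n"] by (simp add: \<tau>0 \<tau>N del: sum.lessThan_Suc)
    finally show ?thesis by (simp add: N_def)
  qed
  have "(\<lambda>n. K * (b - a) * (G b - G a) / real (Suc n)) \<longlonglongrightarrow> 0"
    by (rule lim_const_over_n[THEN LIMSEQ_Suc])
  then have "\<bar>\<Theta> b - \<Theta> a\<bar> \<le> 0" by (rule LIMSEQ_le_const) (use bound in blast)
  then show ?thesis by simp
qed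

text \<open>The converse, an integration by parts: since \<open>g\<close> need not be differentiable at any given point, the
  difference \<open>\<Theta>\<close> of \<open>\<phi> g\<close> and the integral of \<open>\<phi>' g + \<phi> \<gamma>\<close> is shown to have increments of second order.\<close>

lemma integral_imp_weak_derivative:
  fixes g \<gamma> \<phi> \<phi>' :: "real \<Rightarrow> real"
  assumes ab: "a \<le> b" and \<gamma>: "\<gamma> absolutely_integrable_on {a..b}"
    and g: "\<And>s t. a \<le> s \<Longrightarrow> s \<le> t \<Longrightarrow> t \<le> b \<Longrightarrow> (\<gamma> has_integral (g t - g s)) {s..t}"
    and \<phi>: "\<And>t. (\<phi> has_real_derivative \<phi>' t) (at t)" and \<phi>'c: "continuous_on {a..b} \<phi>'"
    and bdry: "\<phi> a = 0" "\<phi> b = 0"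
  shows "integral {a..b} (\<lambda>t. \<phi>' t * g t) = - integral {a..b} (\<lambda>t. \<phi> t * \<gamma> t)"
proof -
  have \<phi>c: "continuous_on {a..b} \<phi>"
    using \<phi> by (meson DERIV_continuous continuous_at_imp_continuous_on)
  have gc: "continuous_on {a..b} g"
  proof -
    have "continuous_on {a..b} (\<lambda>t. integral {a..t} \<gamma> + g a)"
      using \<gamma> by (intro continuous_intros indefinite_integral_continuous_1) (auto simp: absolutely_integrable_on_def)
    moreover have "integral {a..t} \<gamma> + g a = g t" if "t \<in> {a..b}" for t
      using integral_unique[OF g[of a t]] that by auto
    ultimately show ?thesis by (rule continuous_on_eq)
  qed
  obtain C where "\<forall>y\<in>\<phi>' ` {a..b}. norm y \<le> C"
    using compact_imp_bounded[OF compact_continuous_image[OF \<phi>'c compact_Icc]] unfolding bounded_iff ..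
  then have C: "\<bar>\<phi>' t\<bar> \<le> C" if "t \<in> {a..b}" for t using that by auto
  have C0: "0 \<le> C" using C[of a] ab by auto
  have ni: "(\<lambda>r. \<bar>\<gamma> r\<bar>) integrable_on {a..b}" using \<gamma> by (simp add: absolutely_integrable_on_def)
  have i1: "(\<lambda>r. \<phi>' r * g r) integrable_on {a..b}"
    by (intro integrable_continuous_real continuous_intros \<phi>'c gc)
  have i2: "(\<lambda>r. \<phi> r * \<gamma> r) integrable_on {a..b}"
    using absolutely_integrable_mult_bounded[OF \<gamma> \<phi>c] by (simp add: absolutely_integrable_on_def)
  define F where "F t = integral {a..t} (\<lambda>r. \<phi>' r * g r + \<phi> r * \<gamma> r)" for t
  define \<Theta> where "\<Theta> t = \<phi> t * g t - F t" for t
  define G where "G t = integral {a..t} (\<lambda>r. \<bar>\<gamma> r\<bar>)" for t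
  have inc: "\<bar>\<Theta> t - \<Theta> s\<bar> \<le> (2 * C) * (t - s) * (G t - G s)" if st: "a \<le> s" "s \<le> t" "t \<le> b" for s t
  proof -
    have sub: "{s..t} \<subseteq> {a..b}" "{a..t} \<subseteq> {a..b}" using st by auto
    have i3: "(\<lambda>r. \<phi>' r * g r + \<phi> r * \<gamma> r) integrable_on {a..b}" by (intro integrable_add i1 i2)
    have Fd: "((\<lambda>r. \<phi>' r * g r + \<phi> r * \<gamma> r) has_integral (F t - F s)) {s..t}"
      using Henstock_Kurzweil_Integration.integral_combine[of a s t, OF _ _ integrable_on_subinterval[OF i3 sub(2)]]
        integrable_on_subinterval[OF i3 sub(1)] st by (simp add: F_def has_integral_iff)
    have Gd: "((\<lambda>r. \<bar>\<gamma> r\<bar>) has_integral (G t - G s)) {s..t}"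
      using Henstock_Kurzweil_Integration.integral_combine[of a s t, OF _ _ integrable_on_subinterval[OF ni sub(2)]]
        integrable_on_subinterval[OF ni sub(1)] st by (simp add: G_def has_integral_iff)
    have \<phi>d: "(\<phi>' has_integral (\<phi> t - \<phi> s)) {s..t}"
      by (rule fundamental_theorem_of_calculus[OF st(2)])
        (use \<phi> in \<open>simp add: has_real_derivative_iff_has_vector_derivative has_vector_derivative_at_within\<close>)
    have "((\<lambda>r. \<phi>' r * g t + \<phi> s * \<gamma> r - (\<phi>' r * g r + \<phi> r * \<gamma> r)) has_integral
        ((\<phi> t - \<phi> s) * g t + \<phi> s * (g t - g s) - (F t - F s))) {s..t}"
      by (intro has_integral_diff has_integral_add has_integral_mult_left has_integral_mult_right \<phi>d g st Fd)
    moreover have "(\<phi> t - \<phi> s) * g t + \<phi> s * (g t - g s) - (F t - F s) = \<Theta> t - \<Theta> s"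
      by (simp add: \<Theta>_def algebra_simps)
    ultimately have \<Theta>d: "((\<lambda>r. \<phi>' r * g t + \<phi> s * \<gamma> r - (\<phi>' r * g r + \<phi> r * \<gamma> r)) has_integral
        (\<Theta> t - \<Theta> s)) {s..t}" by simp
    have Bd: "((\<lambda>r. C * (G t - G s) + C * (t - s) * \<bar>\<gamma> r\<bar>) has_integral
       ((t - s) * (C * (G t - G s)) + C * (t - s) * (G t - G s))) {s..t}"
      using has_integral_add[OF has_integral_const_real[of "C * (G t - G s)" s t] has_integral_mult_right[OF Gd, of "C * (t - s)"]] st
      by simp
    have pt: "norm (\<phi>' r * g t + \<phi> s * \<gamma> r - (\<phi>' r * g r + \<phi> r * \<gamma> r)) \<le> C * (G t - G s) + C * (t - s) * \<bar>\<gamma> r\<bar>"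
      if r: "r \<in> {s..t}" for r
    proof -
      have "\<bar>g t - g r\<bar> \<le> integral {r..t} (\<lambda>r. \<bar>\<gamma> r\<bar>)"
        using integral_norm_bound_integral[of \<gamma> "{r..t}" "\<lambda>r. \<bar>\<gamma> r\<bar>"] g[of r t] r st
          integrable_on_subinterval[OF ni, of r t] by (auto simp: has_integral_iff)
      also have "\<dots> \<le> integral {s..t} (\<lambda>r. \<bar>\<gamma> r\<bar>)"
        by (rule integral_subset_le) (use r st integrable_on_subinterval[OF ni] in auto)
      also have "\<dots> = G t - G s" using Gd by (simp add: has_integral_iff)
      finally have "\<bar>\<phi>' r\<bar> * \<bar>g t - g r\<bar> \<le> C * (G t - G s)"
        by (intro mult_mono C C0) (use r st in auto)
      moreover have "\<bar>\<phi> s - \<phi> r\<bar> \<le> C * (t - s)"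
      proof -
        have "norm (\<phi> r - \<phi> s) \<le> C * norm (r - s)"
        proof (rule field_differentiable_bound[of "{a..b}"])
          show "(\<phi> has_field_derivative \<phi>' z) (at z within {a..b})" for z
            using \<phi> by (rule has_field_derivative_at_within)
        qed (use C r st in auto)
        also have "\<dots> \<le> C * (t - s)" using C0 r by (intro mult_left_mono) auto
        finally show ?thesis by (simp add: abs_minus_commute)
      qed
      then have "\<bar>\<phi> s - \<phi> r\<bar> * \<bar>\<gamma> r\<bar> \<le> C * (t - s) * \<bar>\<gamma> r\<bar>" by (rule mult_right_mono) simp
      moreover have "\<phi>' r * g t + \<phi> s * \<gamma> r - (\<phi>' r * g r + \<phi> r * \<gamma> r) = \<phi>' r * (g t - g r) + (\<phi> s - \<phi> r) * \<gamma> r"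
        by (simp add: algebra_simps)
      moreover have "\<bar>\<phi>' r * (g t - g r) + (\<phi> s - \<phi> r) * \<gamma> r\<bar> \<le> \<bar>\<phi>' r\<bar> * \<bar>g t - g r\<bar> + \<bar>\<phi> s - \<phi> r\<bar> * \<bar>\<gamma> r\<bar>"
        by (simp add: abs_mult[symmetric])
      ultimately show ?thesis by simp
    qed
    have "norm (\<Theta> t - \<Theta> s) \<le> (t - s) * (C * (G t - G s)) + C * (t - s) * (G t - G s)"
      using integral_norm_bound_integral[OF has_integral_integrable[OF \<Theta>d] has_integral_integrable[OF Bd] pt]
      by (simp add: integral_unique[OF \<Theta>d] integral_unique[OF Bd])
    then show ?thesis by (simp add: algebra_simps)
  qed
  have "\<Theta> b = \<Theta> a" by (rule constant_if_second_order_increments[OF ab inc])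
  then have "F b = 0" by (simp add: \<Theta>_def bdry F_def)
  then show ?thesis using integral_add[OF i1 i2] by (simp add: F_def)
qed

section \<open>Density of continuous functions in \<open>L\<^sup>p\<close>\<close>

lemma borel_measurable_Ioo_imp_Icc:
  fixes g :: "real \<Rightarrow> 'a::topological_space"
  assumes "g \<in> borel_measurable (lebesgue_on {a<..<b})"
  shows "g \<in> borel_measurable (lebesgue_on {a..b})"
proof (rule borel_measurableI)
  fix S :: "'a set" assume "open S"
  have "g -` S \<inter> {a<..<b} \<in> sets (lebesgue_on {a<..<b})"
    using measurable_sets[OF assms borel_open[OF \<open>open S\<close>]] by simp
  then have "g -` S \<inter> {a<..<b} \<in> sets lebesgue" by (simp add: sets_restrict_space_iff)
  moreover have "g -` S \<inter> ({a, b} \<inter> {a..b}) \<in> sets lebesgue"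
    by (rule negligible_imp_sets) (auto intro: negligible_subset[of "{a, b}"])
  ultimately have "g -` S \<inter> {a<..<b} \<union> g -` S \<inter> ({a, b} \<inter> {a..b}) \<in> sets lebesgue" by (rule sets.Un)
  also have "g -` S \<inter> {a<..<b} \<union> g -` S \<inter> ({a, b} \<inter> {a..b}) = g -` S \<inter> {a..b}" by auto
  finally show "g -` S \<inter> space (lebesgue_on {a..b}) \<in> sets (lebesgue_on {a..b})"
    by (simp add: sets_restrict_space_iff)
qed

lemma borel_measurable_lebesgue_on_mono:
  assumes "g \<in> borel_measurable (lebesgue_on S)" "T \<subseteq> S"
  shows "g \<in> borel_measurable (lebesgue_on T)"
  using measurable_restrict_mono[OF assms] .

lemma Lp_on_Icc:
  assumes "Lp_on r a b g"
  shows "g \<in> borel_measurable (lebesgue_on {a..b})" "(\<lambda>t. norm (g t) powr r) integrable_on {a..b}"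
proof -
  show "g \<in> borel_measurable (lebesgue_on {a..b})"
    using assms borel_measurable_Ioo_imp_Icc by (auto simp: Lp_on_def)
  have "integrable (lebesgue_on {a<..<b}) (\<lambda>t. norm (g t) powr r)"
    using assms by (simp add: Lp_on_def)
  from integrable_on_lebesgue_on[OF this] have "(\<lambda>t. norm (g t) powr r) integrable_on {a<..<b}" by simp
  then show "(\<lambda>t. norm (g t) powr r) integrable_on {a..b}" by (simp add: integrable_on_Icc_iff_Ioo)
qed

lemma AE_lebesgue_on_imp_negligible:
  assumes "AE t in lebesgue_on {a<..<b::real}. P t"
  obtains N where "negligible N" "\<And>t. t \<in> {a..b} - N \<Longrightarrow> P t"
proof -
  have "AE t in lebesgue. t \<in> {a<..<b} \<longrightarrow> P t"
    using assms by (simp add: AE_restrict_space_iff)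
  then obtain N where N: "N \<in> null_sets lebesgue" "\<And>t. t \<notin> N \<Longrightarrow> t \<in> {a<..<b} \<longrightarrow> P t"
    by (auto simp: eventually_ae_filter)
  show thesis
  proof
    show "negligible (N \<union> {a, b})" using N(1) by (simp add: negligible_iff_null_sets[symmetric])
    show "P t" if "t \<in> {a..b} - (N \<union> {a, b})" for t using N(2)[of t] that by auto
  qed
qed

lemma negligible_imp_AE_lebesgue_on:
  assumes "negligible N" "\<And>t. t \<in> S - N \<Longrightarrow> P t" "S \<in> sets lebesgue"
  shows "AE t in lebesgue_on S. P t"
proof -
  have "AE t in lebesgue. t \<notin> N"
    using assms(1) AE_not_in by (simp add: negligible_iff_null_sets)
  then show ?thesis using assms(2,3) by (auto simp: AE_restrict_space_iff elim!: eventually_mono)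
qed

lemma powr_add_le:
  fixes u v p :: real
  assumes "0 \<le> u" "0 \<le> v" "0 \<le> p"
  shows "(u + v) powr p \<le> 2 powr p * (u powr p + v powr p)"
proof -
  have "(u + v) powr p \<le> (2 * max u v) powr p"
    by (rule powr_mono2) (use assms in auto)
  also have "\<dots> = 2 powr p * max u v powr p" using assms by (simp add: powr_mult)
  also have "max u v powr p \<le> u powr p + v powr p" by (auto simp: max_def)
  finally show ?thesis by (simp add: mult_left_mono)
qed

text \<open>Young's inequality with a free parameter \<open>c\<close>, without the optimal constants.\<close>

lemma mult_le_Young:
  fixes k g p q c :: real
  assumes "p > 1" "q > 1" "1 / p + 1 / q = 1" "c > 0" "k \<ge> 0" "g \<ge> 0"
  shows "k * g \<le> c * k powr q + c powr (1 - p) * g powr p"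
proof -
  define d where "d = c powr (1 / q)"
  have d: "d > 0" using assms by (simp add: d_def)
  have "k * g = (d * k) * (g / d)" using d by simp
  also have "\<dots> \<le> (d * k) powr q / q + (g / d) powr p / p"
    using Youngs_inequality[of q p "d * k" "g / d"] assms d by (simp add: add.commute)
  also have "\<dots> \<le> (d * k) powr q + (g / d) powr p"
  proof (intro add_mono)
    have div_le: "X / r \<le> X" if "X \<ge> 0" "r > 1" for X r :: real
      using mult_left_mono[of 1 r X] that by (simp add: divide_le_eq)
    show "(d * k) powr q / q \<le> (d * k) powr q" "(g / d) powr p / p \<le> (g / d) powr p"
      using assms by (intro div_le; simp)+
  qed
  also have "(d * k) powr q = c * k powr q"
    using assms d by (simp add: powr_mult d_def powr_powr)
  also have "(g / d) powr p = c powr (1 - p) * g powr p"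
  proof -
    have "1 / q = 1 - 1 / p" using assms(3) by linarith
    then have "p * (1 / q) = p - 1" using assms(1) by (simp only:) (simp add: right_diff_distrib)
    then have "p / q = p - 1" by simp
    then have "d powr p = c powr (p - 1)" by (simp add: d_def powr_powr)
    then have "(g / d) powr p = g powr p / c powr (p - 1)" using assms d by (simp add: powr_divide)
    also have "\<dots> = c powr (1 - p) * g powr p"
      using powr_minus_divide[of c "p - 1"] by simp
    finally show ?thesis .
  qed
  finally show ?thesis .
qed

lemma le_one_plus_powr:
  fixes k q :: real assumes "k \<ge> 0" "q \<ge> 1" shows "k \<le> 1 + k powr q"
proof (cases "k \<le> 1")
  case True then show ?thesis by (simp add: add_increasing2)
next
  case False
  then have "k powr 1 \<le> k powr q" using assms by (intro powr_mono) auto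
  then show ?thesis using False by simp
qed

text \<open>Almost-everywhere limits of uniformly bounded sequences of continuous functions. Measurable simple
  functions are of this kind.\<close>

definition boundedly_approximable :: "(real \<Rightarrow> 'v::real_normed_vector) \<Rightarrow> bool" where
  "boundedly_approximable g \<longleftrightarrow>
     (\<exists>c B N. (\<forall>n::nat. continuous_on UNIV (c n)) \<and> (\<forall>n t. norm (c n t) \<le> B) \<and> negligible N \<and>
        (\<forall>t. t \<notin> N \<longrightarrow> (\<lambda>n. c n t) \<longlonglongrightarrow> g t))"

lemma boundedly_approximable_indicator:
  assumes "E \<in> sets lebesgue"
  shows "boundedly_approximable (\<lambda>t. indicat_real E t *\<^sub>R y)"
proof -
  have "indicat_real E measurable_on UNIV"
    by (rule lebesgue_measurable_imp_measurable_on_real) (use assms in auto)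
  then obtain N g where N: "negligible N" and g: "\<And>n::nat. continuous_on UNIV (g n)"
    and lim: "\<And>t. t \<notin> N \<Longrightarrow> (\<lambda>n. g n t) \<longlonglongrightarrow> indicat_real E t"
    unfolding measurable_on_def by auto
  define c where "c n t = max 0 (min 1 (g n t)) *\<^sub>R y" for n t
  have "continuous_on UNIV (c n)" for n unfolding c_def by (intro continuous_intros g)
  moreover have "norm (c n t) \<le> norm y" for n t
    by (simp add: c_def mult_left_le_one_le)
  moreover have "(\<lambda>n. c n t) \<longlonglongrightarrow> indicat_real E t *\<^sub>R y" if "t \<notin> N" for t
  proof -
    have "(\<lambda>n. c n t) \<longlonglongrightarrow> max 0 (min 1 (indicat_real E t)) *\<^sub>R y"
      unfolding c_def by (intro tendsto_intros lim that)
    then show ?thesis by (simp add: indicator_def split: if_splits)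
  qed
  ultimately show ?thesis unfolding boundedly_approximable_def using N by blast
qed

lemma boundedly_approximable_add:
  assumes "boundedly_approximable f" "boundedly_approximable g"
  shows "boundedly_approximable (\<lambda>t. f t + g t)"
proof -
  obtain c B N where
    "\<forall>n::nat. continuous_on UNIV (c n)" "\<forall>n t. norm (c n t) \<le> B" "negligible N" "\<forall>t. t \<notin> N \<longrightarrow> (\<lambda>n. c n t) \<longlonglongrightarrow> f t"
    using assms(1) unfolding boundedly_approximable_def by blast
  moreover obtain c' B' N' where
    "\<forall>n::nat. continuous_on UNIV (c' n)" "\<forall>n t. norm (c' n t) \<le> B'" "negligible N'" "\<forall>t. t \<notin> N' \<longrightarrow> (\<lambda>n. c' n t) \<longlonglongrightarrow> g t"
    using assms(2) unfolding boundedly_approximable_def by blast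
  ultimately have "(\<forall>n. continuous_on UNIV (\<lambda>t. c n t + c' n t)) \<and> (\<forall>n t. norm (c n t + c' n t) \<le> B + B') \<and>
      negligible (N \<union> N') \<and> (\<forall>t. t \<notin> N \<union> N' \<longrightarrow> (\<lambda>n. c n t + c' n t) \<longlonglongrightarrow> f t + g t)"
    by (intro conjI allI impI continuous_on_add tendsto_add norm_triangle_mono negligible_Un) simp_all
  then show ?thesis unfolding boundedly_approximable_def
    by (intro exI[of _ "\<lambda>n t. c n t + c' n t"] exI[of _ "B + B'"] exI[of _ "N \<union> N'"])
qed

lemma boundedly_approximable_sum:
  assumes "finite I" "\<And>i. i \<in> I \<Longrightarrow> boundedly_approximable (f i)"
  shows "boundedly_approximable (\<lambda>t. \<Sum>i\<in>I. f i t)"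
  using assms
proof (induction I rule: finite_induct)
  case empty
  have "boundedly_approximable (\<lambda>t. indicat_real {} t *\<^sub>R 0 :: 'b)"
    by (rule boundedly_approximable_indicator) simp
  then show ?case by simp
next
  case (insert i I)
  have "boundedly_approximable (\<lambda>t. f i t + (\<Sum>i\<in>I. f i t))"
    using insert by (intro boundedly_approximable_add) auto
  then show ?case using insert(1,2) by simp
qed

lemma boundedly_approximable_simple:
  fixes s :: "real \<Rightarrow> 'v::{banach, second_countable_topology}"
  assumes "simple_function (lebesgue_on {a..b}) s"
  obtains s' where "boundedly_approximable s'" "\<And>t. t \<in> {a..b} \<Longrightarrow> s' t = s t"
proof -
  let ?M = "lebesgue_on {a..b}"
  define s' where "s' t = (\<Sum>y \<in> s ` space ?M. indicat_real (s -` {y} \<inter> space ?M) t *\<^sub>R y)" for t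
  have "boundedly_approximable s'" unfolding s'_def
  proof (intro boundedly_approximable_sum boundedly_approximable_indicator)
    show "finite (s ` space ?M)" using assms by (rule simple_functionD)
    show "s -` {y} \<inter> space ?M \<in> sets lebesgue" for y
      using simple_functionD(2)[OF assms, of "{y}"] by (simp add: sets_restrict_space_iff)
  qed
  moreover have "s' t = s t" if "t \<in> {a..b}" for t
    unfolding s'_def using simple_function_indicator_representation_banach[OF assms, of t, symmetric] that by simp
  ultimately show thesis using that by blast
qed

text \<open>Two applications of dominated convergence: simple functions approximate \<open>x\<close>, and continuous
  functions approximate a simple function.\<close>

lemma Lp_dense_continuous:
  fixes x :: "real \<Rightarrow> 'v::{banach, second_countable_topology}"
  assumes x: "x \<in> borel_measurable (lebesgue_on {a..b})" and xp: "(\<lambda>t. norm (x t) powr p) integrable_on {a..b}"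
    and p: "p \<ge> 1" and e: "\<epsilon> > 0"
  obtains c where "continuous_on UNIV c" "(\<lambda>t. norm (x t - c t) powr p) integrable_on {a..b}"
    "integral {a..b} (\<lambda>t. norm (x t - c t) powr p) < \<epsilon>"
proof -
  let ?M = "lebesgue_on {a..b}"
  have xpM: "integrable ?M (\<lambda>t. norm (x t) powr p)"
  proof -
    have "(\<lambda>t. norm (x t) powr p) absolutely_integrable_on {a..b}"
      using xp by (simp add: absolutely_integrable_on_def)
    then show ?thesis by (simp add: absolutely_integrable_imp_integrable)
  qed
  obtain s where s: "\<And>n::nat. simple_function ?M (s n)" "\<And>t. t \<in> space ?M \<Longrightarrow> (\<lambda>n. s n t) \<longlonglongrightarrow> x t"
    "\<And>n t. t \<in> space ?M \<Longrightarrow> norm (s n t) \<le> 2 * norm (x t)"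
    using borel_measurable_implies_sequence_metric[OF x, of 0] unfolding dist_norm diff_zero by metis
  define \<delta> where "\<delta> = \<epsilon> / (2 powr p * 4)"
  have \<delta>: "\<delta> > 0" using e by (simp add: \<delta>_def)
  have [measurable]: "s n \<in> borel_measurable ?M" for n using s(1) by (rule borel_measurable_simple_function)
  note x[measurable]
  have lim0: "((\<lambda>n. norm (f n) powr p) \<longlonglongrightarrow> 0)" if "f \<longlonglongrightarrow> 0" for f :: "nat \<Rightarrow> 'v"
    using tendsto_powr'[OF tendsto_norm_zero[OF that] tendsto_const[of p]] p by simp
  have bnd: "integrable ?M (\<lambda>t. 3 powr p * norm (x t) powr p)" using xpM by simp
  have b3: "norm (x t - s n t) powr p \<le> 3 powr p * norm (x t) powr p" if "t \<in> space ?M" for t n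
  proof -
    have "norm (x t - s n t) \<le> 3 * norm (x t)"
      using norm_triangle_ineq4[of "x t" "s n t"] s(3)[OF that, of n] by simp
    then have "norm (x t - s n t) powr p \<le> (3 * norm (x t)) powr p" using p by (intro powr_mono2) auto
    then show ?thesis by (simp add: powr_mult)
  qed
  have pt1: "AE t in ?M. (\<lambda>n. norm (x t - s n t) powr p) \<longlonglongrightarrow> 0"
  proof (intro AE_I2 lim0)
    fix t assume "t \<in> space ?M"
    from tendsto_diff[OF tendsto_const s(2)[OF this], of "x t"] show "(\<lambda>n. x t - s n t) \<longlonglongrightarrow> 0" by simp
  qed
  have "(\<lambda>n. LINT t|?M. norm (x t - s n t) powr p) \<longlonglongrightarrow> (LINT t|?M. 0)"
    by (rule integral_dominated_convergence[OF _ _ bnd pt1]) (use b3 in auto)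
  then have "\<forall>\<^sub>F n in sequentially. (LINT t|?M. norm (x t - s n t) powr p) < \<delta>"
    using \<delta> by (intro order_tendstoD(2)) auto
  then obtain n where n: "(LINT t|?M. norm (x t - s n t) powr p) < \<delta>"
    by (auto simp: eventually_sequentially)
  have i1: "integrable ?M (\<lambda>t. norm (x t - s n t) powr p)"
    by (rule Bochner_Integration.integrable_bound[OF bnd]) (use b3 in auto)
  obtain s' where s': "boundedly_approximable s'" "\<And>t. t \<in> {a..b} \<Longrightarrow> s' t = s n t"
    by (rule boundedly_approximable_simple[OF s(1)]) blast
  from s'(1) obtain c B N where c': "\<forall>m::nat. continuous_on UNIV (c m)" "\<forall>m t. norm (c m t) \<le> B" "negligible N"
    "\<forall>t. t \<notin> N \<longrightarrow> (\<lambda>m. c m t) \<longlonglongrightarrow> s' t" unfolding boundedly_approximable_def by blast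
  note c = c'(1)[rule_format] c'(2)[rule_format] c'(3) c'(4)[rule_format]
  have c_meas[measurable]: "c m \<in> borel_measurable ?M" for m
    by (rule continuous_imp_measurable_on_sets_lebesgue[OF continuous_on_subset[OF c(1)]]) auto
  define D where "D t = 2 powr p * (2 powr p * norm (x t) powr p + B powr p)" for t
  have Di: "integrable ?M D" unfolding D_def using xpM
    by (intro integrable_mult_right Bochner_Integration.integrable_add) (auto simp: finite_measure.integrable_const finite_measure_lebesgue_on)
  have b4: "norm (s n t - c m t) powr p \<le> D t" if "t \<in> space ?M" for t m
  proof -
    have "norm (s n t - c m t) powr p \<le> (2 * norm (x t) + B) powr p"
      using norm_triangle_ineq4[of "s n t" "c m t"] s(3)[OF that, of n] c(2)[of m t] p by (intro powr_mono2) auto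
    also have "\<dots> \<le> 2 powr p * ((2 * norm (x t)) powr p + B powr p)"
      by (rule powr_add_le) (use p c(2)[of 0 0] in \<open>auto intro: order_trans[OF norm_ge_zero]\<close>)
    finally show ?thesis by (simp add: powr_mult D_def)
  qed
  have pt2: "AE t in ?M. (\<lambda>m. norm (s n t - c m t) powr p) \<longlonglongrightarrow> 0"
  proof (rule negligible_imp_AE_lebesgue_on[OF c(3)])
    fix t assume t: "t \<in> {a..b} - N"
    then have "(\<lambda>m. c m t) \<longlonglongrightarrow> s n t" using c(4)[of t] s'(2)[of t] by auto
    from tendsto_diff[OF tendsto_const this, of "s n t"] show "(\<lambda>m. norm (s n t - c m t) powr p) \<longlonglongrightarrow> 0"
      by (intro lim0) simp
  qed simp
  have "(\<lambda>m. LINT t|?M. norm (s n t - c m t) powr p) \<longlonglongrightarrow> (LINT t|?M. 0)"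
    by (rule integral_dominated_convergence[OF _ _ Di pt2]) (use b4 in auto)
  then have "\<forall>\<^sub>F m in sequentially. (LINT t|?M. norm (s n t - c m t) powr p) < \<delta>"
    using \<delta> by (intro order_tendstoD(2)) auto
  then obtain m where m: "(LINT t|?M. norm (s n t - c m t) powr p) < \<delta>"
    by (auto simp: eventually_sequentially)
  have i2: "integrable ?M (\<lambda>t. norm (s n t - c m t) powr p)"
    by (rule Bochner_Integration.integrable_bound[OF Di]) (use b4 in \<open>auto intro!: AE_I2 order_trans[OF _ abs_ge_self]\<close>)
  let ?E = "\<lambda>t. 2 powr p * (norm (x t - s n t) powr p + norm (s n t - c m t) powr p)"
  have i3: "integrable ?M ?E" using i1 i2 by simp
  have le: "norm (x t - c m t) powr p \<le> ?E t" for t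
  proof -
    have "norm (x t - c m t) powr p \<le> (norm (x t - s n t) + norm (s n t - c m t)) powr p"
      using norm_triangle_ineq[of "x t - s n t" "s n t - c m t"] p by (intro powr_mono2) auto
    also have "\<dots> \<le> ?E t" by (rule powr_add_le) (use p in auto)
    finally show ?thesis .
  qed
  have i4: "integrable ?M (\<lambda>t. norm (x t - c m t) powr p)"
    by (rule Bochner_Integration.integrable_bound[OF i3]) (use le in \<open>auto intro: order_trans[OF _ abs_ge_self]\<close>)
  have "(LINT t|?M. norm (x t - c m t) powr p) \<le> (LINT t|?M. ?E t)"
    by (rule integral_mono[OF i4 i3]) (rule le)
  also have "\<dots> = 2 powr p * ((LINT t|?M. norm (x t - s n t) powr p) + (LINT t|?M. norm (s n t - c m t) powr p))"
    using i1 i2 by simp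
  also have "\<dots> \<le> 2 powr p * (\<delta> + \<delta>)" using n m by (intro mult_left_mono) auto
  also have "\<dots> < \<epsilon>" using e by (simp add: \<delta>_def field_simps)
  finally have "(LINT t|?M. norm (x t - c m t) powr p) < \<epsilon>" .
  then show thesis
    using that[OF c(1)[of m]] i4 lebesgue_integral_eq_integral[OF i4] integrable_on_lebesgue_on[OF i4] by simp
qed

section \<open>The energy identity\<close>

lemma integral_increment:
  fixes f :: "real \<Rightarrow> real"
  assumes f: "f integrable_on {a..b}" and h: "0 < h" "h \<le> b - a"
  shows "integral {a..b - h} (\<lambda>t. f (t + h) - f t) = integral {b - h..b} f - integral {a..a + h} f"
    "(\<lambda>t. f (t + h)) integrable_on {a..b - h}" "f integrable_on {a..b - h}"
    "integral {a..b - h} (\<lambda>t. f (t + h)) = integral {a + h..b} f"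
proof -
  have sub: "f integrable_on {s..t}" if "a \<le> s" "t \<le> b" for s t
    using f that by (intro integrable_on_subinterval[OF f]) auto
  have "((f \<circ> (+) h) has_integral integral {a + h..b} f) {a..b - h}"
    using has_integral_shift_Icc_real[of f h "integral {a + h..b} f" a "b - h"] sub[of "a + h" b] h
    by (simp add: integrable_integral)
  then have shift: "((\<lambda>t. f (t + h)) has_integral integral {a + h..b} f) {a..b - h}"
    by (simp add: o_def add.commute)
  then show "(\<lambda>t. f (t + h)) integrable_on {a..b - h}" by blast
  show i: "f integrable_on {a..b - h}" using h by (intro sub) auto
  show e: "integral {a..b - h} (\<lambda>t. f (t + h)) = integral {a + h..b} f"
    using shift by (rule integral_unique)
  have "integral {a..b - h} (\<lambda>t. f (t + h) - f t) = integral {a + h..b} f - integral {a..b - h} f"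
    using has_integral_diff[OF shift integrable_integral[OF i]] by (simp add: integral_unique)
  moreover have "integral {a..a + h} f + integral {a + h..b} f = integral {a..b} f"
    by (rule Henstock_Kurzweil_Integration.integral_combine) (use h f in auto)
  moreover have "integral {a..b - h} f + integral {b - h..b} f = integral {a..b} f"
    by (rule Henstock_Kurzweil_Integration.integral_combine) (use h f in auto)
  ultimately show "integral {a..b - h} (\<lambda>t. f (t + h) - f t) = integral {b - h..b} f - integral {a..a + h} f"
    by simp
qed

text \<open>Averages of small increments recover the total increment of a continuous function.\<close>

lemma averaged_increment_tendsto:
  fixes f :: "real \<Rightarrow> real"
  assumes f: "continuous_on {a..b} f" and ab: "a < b" and e: "e > 0"
  obtains d where "d > 0"
    "\<And>h. 0 < h \<Longrightarrow> h < d \<Longrightarrow> h \<le> b - a \<Longrightarrow>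
       \<bar>integral {a..b - h} (\<lambda>t. f (t + h) - f t) - h * (f b - f a)\<bar> \<le> h * e"
proof -
  have near: "\<exists>d>0. \<forall>t\<in>{a..b}. \<bar>t - c\<bar> < d \<longrightarrow> \<bar>f t - f c\<bar> < e / 2" if "c \<in> {a..b}" for c
    using f that e unfolding continuous_on_iff dist_real_def by (metis half_gt_zero)
  obtain d1 where d1: "d1 > 0" "\<And>t. t \<in> {a..b} \<Longrightarrow> \<bar>t - a\<bar> < d1 \<Longrightarrow> \<bar>f t - f a\<bar> < e / 2" using near[of a] ab by auto
  obtain d2 where d2: "d2 > 0" "\<And>t. t \<in> {a..b} \<Longrightarrow> \<bar>t - b\<bar> < d2 \<Longrightarrow> \<bar>f t - f b\<bar> < e / 2" using near[of b] ab by auto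
  have fi: "f integrable_on {a..b}" using f by (rule integrable_continuous_real)
  have cl: "\<bar>integral {s..s + h} f - h * f c\<bar> \<le> h * (e / 2)"
    if "a \<le> s" "s + h \<le> b" "0 < h" "\<And>t. t \<in> {s..s + h} \<Longrightarrow> \<bar>f t - f c\<bar> \<le> e / 2" for s c h
  proof -
    have i: "f integrable_on {s..s + h}" using that by (intro integrable_on_subinterval[OF fi]) auto
    have "((\<lambda>t. f t - f c) has_integral integral {s..s + h} f - h * f c) {s..s + h}"
      using has_integral_diff[OF integrable_integral[OF i] has_integral_const_real[of "f c" s "s + h"]] that by simp
    moreover have "((\<lambda>_. e / 2) has_integral h * (e / 2)) {s..s + h}"
      using has_integral_const_real[of "e / 2" s "s + h"] that by simp
    ultimately show ?thesis
      using integral_norm_bound_integral[of "\<lambda>t. f t - f c" "{s..s + h}" "\<lambda>_. e / 2"] that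
      by (simp add: has_integral_iff)
  qed
  show thesis
  proof
    show "min d1 d2 > 0" using d1 d2 by simp
    fix h assume h: "0 < h" "h < min d1 d2" "h \<le> b - a"
    have aux: "\<bar>X - Y - (P - Q)\<bar> \<le> E" if "\<bar>Y - Q\<bar> \<le> E / 2" "\<bar>X - P\<bar> \<le> E / 2" for X Y P Q E :: real
      using that by linarith
    have "\<bar>integral {a..a + h} f - h * f a\<bar> \<le> h * (e / 2)"
      by (rule cl) (use h d1(2) in \<open>auto intro!: less_imp_le\<close>)
    moreover have "\<bar>integral {b - h..b - h + h} f - h * f b\<bar> \<le> h * (e / 2)"
      by (rule cl) (use h d2(2) in \<open>auto intro!: less_imp_le\<close>)
    ultimately show "\<bar>integral {a..b - h} (\<lambda>t. f (t + h) - f t) - h * (f b - f a)\<bar> \<le> h * e"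
      unfolding integral_increment(1)[OF fi h(1,3)] right_diff_distrib by (intro aux) simp_all
  qed
qed

lemma averaged_increment_mono_le:
  fixes f :: "real \<Rightarrow> real"
  assumes f: "f integrable_on {a..b}" and h: "0 < h" "h \<le> b - a"
    and mono: "\<And>s t. a \<le> s \<Longrightarrow> s \<le> t \<Longrightarrow> t \<le> b \<Longrightarrow> f s \<le> f t"
  shows "integral {a..b - h} (\<lambda>t. f (t + h) - f t) \<le> h * (f b - f a)"
proof -
  have "integral {b - h..b} f \<le> integral {b - h..b} (\<lambda>_. f b)"
    by (rule integral_le) (use h mono in \<open>auto intro!: integrable_on_subinterval[OF f]\<close>)
  moreover have "integral {a..a + h} (\<lambda>_. f a) \<le> integral {a..a + h} f"
    by (rule integral_le) (use h mono in \<open>auto intro!: integrable_on_subinterval[OF f]\<close>)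
  ultimately show ?thesis
    using h by (simp add: integral_increment(1)[OF f h] algebra_simps)
qed

text \<open>Only the scalar functions \<open>x' r v\<close> are required to be measurable, so that nothing is asked of the
  Borel sets of the dual space.\<close>

lemma borel_measurable_pairing:
  fixes x :: "real \<Rightarrow> 'v::{banach, second_countable_topology}" and x' :: "real \<Rightarrow> ('v \<Rightarrow>\<^sub>L real)"
  assumes x: "x \<in> borel_measurable M" and x': "\<And>v. (\<lambda>r. x' r v) \<in> borel_measurable M"
  shows "(\<lambda>r. x' r (x r)) \<in> borel_measurable M"
proof -
  obtain s where s: "\<And>n::nat. simple_function M (s n)" "\<And>t. t \<in> space M \<Longrightarrow> (\<lambda>n. s n t) \<longlonglongrightarrow> x t"
    using borel_measurable_implies_sequence_metric[OF x, of 0] by metis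
  show ?thesis
  proof (rule borel_measurable_LIMSEQ_real)
    show "(\<lambda>n. x' r (s n r)) \<longlonglongrightarrow> x' r (x r)" if "r \<in> space M" for r
      by (intro tendsto_intros s that)
    show "(\<lambda>r. x' r (s n r)) \<in> borel_measurable M" for n
    proof (rule measurable_compose_countable'[where f="\<lambda>v r. x' r v" and g="s n" and I="s n ` space M"])
      show "s n \<in> M \<rightarrow>\<^sub>M count_space (s n ` space M)" 
        using s(1)[of n] by (simp add: measurable_simple_function measurable_count_space_eq2 simple_functionD image_subset_iff_funcset)
      show "countable (s n ` space M)" using s(1)[of n] by (simp add: simple_functionD countable_finite)
      show "(\<lambda>r. x' r v) \<in> borel_measurable M" for v by (rule x')
    qed
  qed
qed

lemma pairing_integrable:
  fixes x :: "real \<Rightarrow> 'v::{banach, second_countable_topology}" and x' :: "real \<Rightarrow> ('v \<Rightarrow>\<^sub>L real)"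
  assumes pq: "p > 1" "q > 1" "1 / p + 1 / q = 1"
    and x: "x \<in> borel_measurable (lebesgue_on {a..b})" "(\<lambda>t. norm (x t) powr p) integrable_on {a..b}"
    and x': "\<And>v. (\<lambda>r. x' r v) \<in> borel_measurable (lebesgue_on {a..b})" "\<And>r. norm (x' r) \<le> k r"
      "(\<lambda>r. k r powr q) integrable_on {a..b}"
  shows "(\<lambda>r. x' r (x r)) absolutely_integrable_on {a..b}"
proof (rule measurable_bounded_by_integrable_imp_absolutely_integrable)
  show "(\<lambda>r. x' r (x r)) \<in> borel_measurable (lebesgue_on {a..b})"
    by (rule borel_measurable_pairing[OF x(1) x'(1)])
  show "(\<lambda>t. k t powr q + norm (x t) powr p) integrable_on {a..b}"
    by (intro integrable_add x x')
  show "norm (x' r (x r)) \<le> k r powr q + norm (x r) powr p" for r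
  proof -
    have k0: "0 \<le> k r" for r using norm_ge_zero[of "x' r"] x'(2)[of r] by linarith
    have "norm (x' r (x r)) \<le> k r * norm (x r)"
      using norm_blinfun[of "x' r" "x r"] mult_right_mono[OF x'(2)[of r], of "norm (x r)"] by simp
    also have "\<dots> \<le> k r powr q + norm (x r) powr p"
      using mult_le_Young[OF pq zero_less_one k0 norm_ge_zero, of r "x r"] by simp
    finally show ?thesis .
  qed
qed simp

text \<open>The quantitative step of the energy identity. The function \<open>\<Xi>\<close> is to be shown constant. If \<open>w\<close> agrees
  with \<open>j x\<close> at \<open>t\<close> and at \<open>t + h\<close>, then \<open>\<Xi> (t + h) - \<Xi> t\<close> is the integral over \<open>[t,t+h]\<close> of \<open>x' r\<close> applied to
  \<open>x (t + h) + x t - 2 x r\<close>. Replacing \<open>x\<close> by a continuous function \<open>c\<close> and using Young's inequality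
  bounds this by increments of a monotone function \<open>\<Psi>\<close> and by values of the approximation error.
  Averaging over \<open>t\<close> then involves only integrals over single intervals, and no double integral.\<close>

lemma energy_increment_bound:
  fixes w :: "real \<Rightarrow> 'h::real_inner" and j :: "'v::{banach, second_countable_topology} \<Rightarrow>\<^sub>L 'h"
    and x :: "real \<Rightarrow> 'v" and x' :: "real \<Rightarrow> ('v \<Rightarrow>\<^sub>L real)"
  assumes ab: "a < b" and pq: "p > 1" "q > 1" "1 / p + 1 / q = 1"
    and w: "continuous_on {a..b} w"
    and x: "x \<in> borel_measurable (lebesgue_on {a..b})" "(\<lambda>t. norm (x t) powr p) integrable_on {a..b}"
    and x': "\<And>v. (\<lambda>r. x' r v) \<in> borel_measurable (lebesgue_on {a..b})" "\<And>r. norm (x' r) \<le> k r"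
      "(\<lambda>r. k r powr q) integrable_on {a..b}"
    and N: "negligible N" "\<And>t. t \<in> {a..b} - N \<Longrightarrow> w t = j (x t)"
    and deriv: "\<And>v s t. a \<le> s \<Longrightarrow> s \<le> t \<Longrightarrow> t \<le> b \<Longrightarrow> ((\<lambda>r. x' r v) has_integral ((w t - w s) \<bullet> j v)) {s..t}"
    and c: "continuous_on UNIV c" "(\<lambda>t. norm (x t - c t) powr p) integrable_on {a..b}"
    and pos: "\<mu> > 0" "\<omega> > 0" and ki: "k integrable_on {a..b}" and \<Xi>: "\<Xi> = (\<lambda>t. (norm (w t))\<^sup>2 - 2 * integral {a..t} (\<lambda>r. x' r (x r)))"
  shows "\<bar>\<Xi> b - \<Xi> a\<bar> \<le> 4 * \<mu> * integral {a..b} (\<lambda>t. k t powr q)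
     + 4 * \<mu> powr (1 - p) * integral {a..b} (\<lambda>t. norm (x t - c t) powr p)
     + \<omega> * (2 * integral {a..b} k + 1)"
proof -
  define \<psi> where "\<psi> r = x' r (x r)" for r
  define kq where "kq r = k r powr q" for r
  define e where "e r = norm (x r - c r)" for r
  define ep where "ep r = norm (x r - c r) powr p" for r
  define \<nu> where "\<nu> = \<mu> powr (1 - p)"
  have \<nu>: "\<nu> > 0" using pos by (simp add: \<nu>_def)
  have \<psi>i: "\<psi> integrable_on {a..b}"
    using pairing_integrable[OF pq x x'] unfolding \<psi>_def by (rule set_lebesgue_integral_eq_integral)
  have kqi: "kq integrable_on {a..b}" and epi: "ep integrable_on {a..b}"
    using x'(3) c(2) by (simp_all add: kq_def[abs_def] ep_def[abs_def])
  have k0: "0 \<le> k r" for r using norm_ge_zero[of "x' r"] x'(2)[of r] by linarith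
  have nonneg: "0 \<le> kq r" "0 \<le> ep r" "0 \<le> k r" "0 \<le> e r" for r
    by (simp_all add: kq_def ep_def e_def k0)
  define I where "I f t = integral {a..t} f" for f :: "real \<Rightarrow> real" and t
  have Ihas: "(f has_integral (I f t - I f s)) {s..t}" if "f integrable_on {a..b}" "a \<le> s" "s \<le> t" "t \<le> b" for f s t
  proof -
    have "f integrable_on {a..t}" "f integrable_on {s..t}" using that by (auto intro: integrable_on_subinterval[OF that(1)])
    then show ?thesis
      using Henstock_Kurzweil_Integration.integral_combine[of a s t f] that by (simp add: I_def has_integral_iff)
  qed
  have Icont: "continuous_on {a..b} (I f)" if "f integrable_on {a..b}" for f
    unfolding I_def by (rule indefinite_integral_continuous_1[OF that])
  have Imono: "I f s \<le> I f t" if "f integrable_on {a..b}" "\<And>r. 0 \<le> f r" "a \<le> s" "s \<le> t" "t \<le> b" for f s t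
    using has_integral_nonneg[OF Ihas[OF that(1,3-5)]] that(2) by simp
  define \<Psi> where "\<Psi> t = 4 * \<mu> * I kq t + 2 * \<nu> * I ep t + 2 * \<omega> * I k t" for t
  have \<Xi>_eq: "\<Xi> t = (norm (w t))\<^sup>2 - 2 * I \<psi> t" for t by (simp add: \<Xi> I_def \<psi>_def[abs_def])
  have \<Xi>c: "continuous_on {a..b} \<Xi>" unfolding \<Xi>_eq by (intro continuous_intros w Icont \<psi>i)
  have \<Psi>c: "continuous_on {a..b} \<Psi>" unfolding \<Psi>_def by (intro continuous_intros Icont kqi epi ki)
  have \<Psi>m: "\<Psi> s \<le> \<Psi> t" if "a \<le> s" "s \<le> t" "t \<le> b" for s t
    unfolding \<Psi>_def using pos \<nu> that by (intro add_mono mult_left_mono Imono kqi epi ki nonneg) auto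
  have "uniformly_continuous_on {a..b} c"
    by (intro compact_uniformly_continuous continuous_on_subset[OF c(1)]) auto
  then obtain d1 where d1: "d1 > 0" "\<And>s t. s \<in> {a..b} \<Longrightarrow> t \<in> {a..b} \<Longrightarrow> dist s t < d1 \<Longrightarrow> dist (c s) (c t) < \<omega>"
    unfolding uniformly_continuous_on_def using pos by metis
  obtain d2 where d2: "d2 > 0" "\<And>h. 0 < h \<Longrightarrow> h < d2 \<Longrightarrow> h \<le> b - a \<Longrightarrow>
       \<bar>integral {a..b - h} (\<lambda>t. \<Xi> (t + h) - \<Xi> t) - h * (\<Xi> b - \<Xi> a)\<bar> \<le> h * \<omega>"
    using averaged_increment_tendsto[OF \<Xi>c ab pos(2)] by metis
  define h where "h = min (min d1 d2 / 2) (b - a)"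
  have h: "0 < h" "h < d1" "h < d2" "h \<le> b - a" using d1(1) d2(1) ab by (auto simp: h_def min_def)
  have pt: "\<bar>\<Xi> (t + h) - \<Xi> t\<bar> \<le> (\<Psi> (t + h) - \<Psi> t) + \<nu> * h * (ep t + ep (t + h))"
    if t: "t \<in> {a..b - h}" "t \<notin> N" "t + h \<notin> N" for t
  proof -
    define u where "u = t + h"
    have tu: "a \<le> t" "t \<le> u" "u \<le> b" "t \<in> {a..b}" "u \<in> {a..b}" "u - t = h" using t h by (auto simp: u_def)
    have wt: "w t = j (x t)" "w u = j (x u)" using N(2) tu t by (auto simp: u_def)
    have "((\<lambda>r. x' r (x u + x t) - 2 * \<psi> r) has_integral ((w u - w t) \<bullet> j (x u + x t) - 2 * (I \<psi> u - I \<psi> t))) {t..u}"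
      by (intro has_integral_diff has_integral_mult_right deriv Ihas \<psi>i tu)
    moreover have w2: "(w u - w t) \<bullet> j (x u + x t) = (norm (w u))\<^sup>2 - (norm (w t))\<^sup>2"
      unfolding wt blinfun.add_right by (simp add: power2_norm_eq_inner inner_diff_left inner_diff_right inner_add_left inner_add_right inner_commute)
    moreover have "(w u - w t) \<bullet> j (x u + x t) - 2 * (I \<psi> u - I \<psi> t) = \<Xi> u - \<Xi> t"
      unfolding \<Xi>_eq w2 by simp
    ultimately have hi: "((\<lambda>r. x' r (x u + x t) - 2 * \<psi> r) has_integral (\<Xi> u - \<Xi> t)) {t..u}"
      by simp
    let ?B = "\<lambda>r. 4 * \<mu> * kq r + (\<nu> * (ep t + ep u) + 2 * \<nu> * ep r) + 2 * \<omega> * k r"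
    have hB: "(?B has_integral (4 * \<mu> * (I kq u - I kq t) + (h * (\<nu> * (ep t + ep u)) + 2 * \<nu> * (I ep u - I ep t)) + 2 * \<omega> * (I k u - I k t))) {t..u}"
      using tu has_integral_const_real[of "\<nu> * (ep t + ep u)" t u]
      by (intro has_integral_add has_integral_mult_right Ihas kqi epi ki) auto
    have bd: "norm (x' r (x u + x t) - 2 * \<psi> r) \<le> ?B r" if r: "r \<in> {t..u}" for r
    proof -
      have rab: "r \<in> {a..b}" using r tu by auto
      have "norm (c s - c r) \<le> \<omega>" if "s = t \<or> s = u" for s
        using d1(2)[of s r] that rab tu r h by (auto simp: dist_norm dist_real_def intro!: less_imp_le)
      then have diff: "norm (x s - x r) \<le> e s + e r + \<omega>" if "s = t \<or> s = u" for s
      proof -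
        have tri: "norm (A + B - C) \<le> norm A + norm B + norm C" for A B C :: 'v
          using norm_triangle_ineq4[of "A + B" C] norm_triangle_ineq[of A B] by linarith
        have "norm (x s - x r) \<le> norm (x s - c s) + norm (c s - c r) + norm (x r - c r)"
          using tri[of "x s - c s" "c s - c r" "x r - c r"] by simp
        then show ?thesis using \<open>\<And>s. s = t \<or> s = u \<Longrightarrow> norm (c s - c r) \<le> \<omega>\<close>[OF that] by (simp add: e_def)
      qed
      have Y: "k r * e s \<le> \<mu> * kq r + \<nu> * ep s" for s
        unfolding kq_def e_def ep_def \<nu>_def by (rule mult_le_Young[OF pq pos(1) nonneg(3)]) auto
      have nb: "norm (x' r z) \<le> k r * norm z" for z
        by (rule order_trans[OF norm_blinfun mult_right_mono[OF x'(2) norm_ge_zero]])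
      have "x' r (x u + x t) - 2 * \<psi> r = x' r ((x u - x r) + (x t - x r))"
        by (simp add: \<psi>_def blinfun.add_right blinfun.diff_right)
      then have "norm (x' r (x u + x t) - 2 * \<psi> r) \<le> k r * norm ((x u - x r) + (x t - x r))"
        using nb[of "(x u - x r) + (x t - x r)"] by simp
      also have "\<dots> \<le> k r * ((e u + e r + \<omega>) + (e t + e r + \<omega>))"
        by (intro mult_left_mono norm_triangle_mono diff) (auto simp: nonneg)
      also have "\<dots> = k r * e u + k r * e r + k r * e t + k r * e r + 2 * \<omega> * k r" by (simp add: algebra_simps)
      also have "\<dots> \<le> ?B r" using Y[of u] Y[of r] Y[of t] by (simp add: algebra_simps)
      finally show ?thesis .
    qed
    have "norm (\<Xi> u - \<Xi> t) \<le> 4 * \<mu> * (I kq u - I kq t) + (h * (\<nu> * (ep t + ep u)) + 2 * \<nu> * (I ep u - I ep t)) + 2 * \<omega> * (I k u - I k t)"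
      using integral_norm_bound_integral[OF has_integral_integrable[OF hi] has_integral_integrable[OF hB] bd]
      unfolding integral_unique[OF hi] integral_unique[OF hB] .
    then show ?thesis by (simp add: \<Psi>_def u_def algebra_simps)
  qed
  let ?R = "\<lambda>t. (\<Psi> (t + h) - \<Psi> t) + \<nu> * h * (ep t + ep (t + h))"
  note \<Xi>i = integral_increment[OF integrable_continuous_real[OF \<Xi>c] h(1,4)]
  note \<Psi>i = integral_increment[OF integrable_continuous_real[OF \<Psi>c] h(1,4)]
  note epi' = integral_increment[OF epi h(1,4)]
  have Ri: "?R integrable_on {a..b - h}"
    by (intro integrable_add integrable_diff integrable_on_mult_right \<Psi>i epi')
  define N' where "N' = N \<union> (\<lambda>t. t - h) ` N"
  have N': "negligible N'" unfolding N'_def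
    using N(1) negligible_translation[OF N(1), of "- h"] by (simp add: negligible_Un)
  have "\<bar>integral {a..b - h} (\<lambda>t. \<Xi> (t + h) - \<Xi> t)\<bar> \<le> integral {a..b - h} ?R"
  proof -
    define \<Delta> where "\<Delta> t = (if t \<in> N' then 0 else \<Xi> (t + h) - \<Xi> t)" for t
    define R where "R t = (if t \<in> N' then 0 else ?R t)" for t
    have eq1: "integral {a..b - h} (\<lambda>t. \<Xi> (t + h) - \<Xi> t) = integral {a..b - h} \<Delta>"
      by (rule integral_spike[OF N']) (simp add: \<Delta>_def)
    have eq2: "integral {a..b - h} ?R = integral {a..b - h} R"
      by (rule integral_spike[OF N']) (simp add: R_def)
    have "\<Delta> integrable_on {a..b - h}"
      by (rule integrable_spike[OF integrable_diff[OF \<Xi>i(2,3)] N']) (simp add: \<Delta>_def)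
    moreover have "R integrable_on {a..b - h}"
      by (rule integrable_spike[OF Ri N']) (simp add: R_def)
    moreover have "norm (\<Delta> t) \<le> R t" if "t \<in> {a..b - h}" for t
      using pt[of t] that by (force simp: \<Delta>_def R_def N'_def image_iff)
    ultimately show ?thesis
      unfolding eq1 eq2 using integral_norm_bound_integral[of \<Delta> "{a..b - h}" R] by simp
  qed
  also have "integral {a..b - h} ?R = integral {a..b - h} (\<lambda>t. \<Psi> (t + h) - \<Psi> t) +
      \<nu> * h * (integral {a..b - h} ep + integral {a..b - h} (\<lambda>t. ep (t + h)))"
    by (intro integral_unique has_integral_add has_integral_mult_right integrable_integral integrable_diff \<Psi>i epi')
  also have "\<dots> \<le> h * (\<Psi> b - \<Psi> a) + \<nu> * h * (I ep b + I ep b)"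
  proof (intro add_mono mult_left_mono)
    show "integral {a..b - h} (\<lambda>t. \<Psi> (t + h) - \<Psi> t) \<le> h * (\<Psi> b - \<Psi> a)"
      by (rule averaged_increment_mono_le[OF integrable_continuous_real[OF \<Psi>c] h(1,4) \<Psi>m])
    show "integral {a..b - h} ep \<le> I ep b" unfolding I_def
      by (rule integral_subset_le) (use h epi' epi nonneg in auto)
    show "integral {a..b - h} (\<lambda>t. ep (t + h)) \<le> I ep b" unfolding I_def epi'(4)
      by (rule integral_subset_le) (use h epi nonneg in \<open>auto intro!: integrable_on_subinterval[OF epi]\<close>)
  qed (use h \<nu> in auto)
  finally have "\<bar>h * (\<Xi> b - \<Xi> a)\<bar> \<le> h * (\<Psi> b - \<Psi> a) + \<nu> * h * (I ep b + I ep b) + h * \<omega>"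
    using d2(2)[OF h(1,3,4)] by linarith
  moreover have "\<bar>h * (\<Xi> b - \<Xi> a)\<bar> = h * \<bar>\<Xi> b - \<Xi> a\<bar>" using h(1) by (simp add: abs_mult)
  ultimately have "h * \<bar>\<Xi> b - \<Xi> a\<bar> \<le> h * ((\<Psi> b - \<Psi> a) + 2 * \<nu> * I ep b + \<omega>)"
    by (simp add: algebra_simps)
  then have "\<bar>\<Xi> b - \<Xi> a\<bar> \<le> (\<Psi> b - \<Psi> a) + 2 * \<nu> * I ep b + \<omega>" using h(1) by simp
  moreover have "\<Psi> a = 0" by (simp add: \<Psi>_def I_def)
  ultimately show ?thesis
    by (simp add: \<Psi>_def I_def kq_def[abs_def] ep_def[abs_def] \<nu>_def algebra_simps)
qed

text \<open>The integration by parts formula of the Gelfand triple. The three terms of the preceding bound are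
  made small by choosing \<open>\<mu>\<close> and \<open>\<omega>\<close> first and then the approximation \<open>c\<close>.\<close>

lemma energy_identity:
  fixes w :: "real \<Rightarrow> 'h::real_inner" and j :: "'v::{banach, second_countable_topology} \<Rightarrow>\<^sub>L 'h"
    and x :: "real \<Rightarrow> 'v" and x' :: "real \<Rightarrow> ('v \<Rightarrow>\<^sub>L real)"
  assumes ab: "a \<le> b" and pq: "p > 1" "q > 1" "1 / p + 1 / q = 1"
    and w: "continuous_on {a..b} w"
    and x: "x \<in> borel_measurable (lebesgue_on {a..b})" "(\<lambda>t. norm (x t) powr p) integrable_on {a..b}"
    and x': "\<And>v. (\<lambda>r. x' r v) \<in> borel_measurable (lebesgue_on {a..b})" "\<And>r. norm (x' r) \<le> k r"
      "(\<lambda>r. k r powr q) integrable_on {a..b}"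
    and N: "negligible N" "\<And>t. t \<in> {a..b} - N \<Longrightarrow> w t = j (x t)"
    and deriv: "\<And>v s t. a \<le> s \<Longrightarrow> s \<le> t \<Longrightarrow> t \<le> b \<Longrightarrow> ((\<lambda>r. x' r v) has_integral ((w t - w s) \<bullet> j v)) {s..t}"
    and ki: "k integrable_on {a..b}"
  shows "(norm (w b))\<^sup>2 - (norm (w a))\<^sup>2 = 2 * integral {a..b} (\<lambda>r. x' r (x r))"
proof (cases "a = b")
  case False
  then have ab: "a < b" using ab by simp
  define \<Xi> where "\<Xi> = (\<lambda>t. (norm (w t))\<^sup>2 - 2 * integral {a..t} (\<lambda>r. x' r (x r)))"
  define K where "K = integral {a..b} (\<lambda>t. k t powr q)"
  define K1 where "K1 = 2 * integral {a..b} k + 1"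
  have K: "K \<ge> 0" unfolding K_def by (rule integral_nonneg[OF x'(3)]) auto
  have K1: "K1 > 0"
  proof -
    have k0: "0 \<le> k r" for r using norm_ge_zero[of "x' r"] x'(2)[of r] by linarith
    then have "0 \<le> integral {a..b} k" by (intro integral_nonneg[OF ki])
    then show ?thesis by (simp add: K1_def)
  qed
  have "\<bar>\<Xi> b - \<Xi> a\<bar> \<le> 0 + \<eta>" if \<eta>: "\<eta> > 0" for \<eta>
  proof -
    define \<mu> where "\<mu> = \<eta> / (12 * (K + 1))"
    define \<omega> where "\<omega> = \<eta> / (3 * K1)"
    define \<epsilon> where "\<epsilon> = \<eta> / (12 * \<mu> powr (1 - p))"
    have pos: "\<mu> > 0" "\<omega> > 0" "\<epsilon> > 0" using \<eta> K K1 by (auto simp: \<mu>_def \<omega>_def \<epsilon>_def)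
    obtain c where c: "continuous_on UNIV c" "(\<lambda>t. norm (x t - c t) powr p) integrable_on {a..b}"
      "integral {a..b} (\<lambda>t. norm (x t - c t) powr p) < \<epsilon>"
      by (rule Lp_dense_continuous[OF x _ pos(3)]) (use pq in auto)
    have "\<bar>\<Xi> b - \<Xi> a\<bar> \<le> 4 * \<mu> * K + 4 * \<mu> powr (1 - p) * integral {a..b} (\<lambda>t. norm (x t - c t) powr p) + \<omega> * K1"
      using energy_increment_bound[OF ab pq w x x' N deriv c(1,2) pos(1,2) ki \<Xi>_def] by (simp add: K_def K1_def)
    also have "\<dots> \<le> \<eta> / 3 + \<eta> / 3 + \<eta> / 3"
    proof (intro add_mono)
      show "4 * \<mu> * K \<le> \<eta> / 3" using K \<eta> by (simp add: \<mu>_def field_simps)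
      have "4 * \<mu> powr (1 - p) * integral {a..b} (\<lambda>t. norm (x t - c t) powr p) \<le> 4 * \<mu> powr (1 - p) * \<epsilon>"
        using c(3) by (intro mult_left_mono) auto
      also have "\<dots> = \<eta> / 3" using pos by (simp add: \<epsilon>_def)
      finally show "4 * \<mu> powr (1 - p) * integral {a..b} (\<lambda>t. norm (x t - c t) powr p) \<le> \<eta> / 3" .
      show "\<omega> * K1 \<le> \<eta> / 3" using K1 by (simp add: \<omega>_def)
    qed
    finally show ?thesis by simp
  qed
  then have "\<bar>\<Xi> b - \<Xi> a\<bar> \<le> 0" by (rule field_le_epsilon)
  then show ?thesis by (simp add: \<Xi>_def)
qed simp

section \<open>Integrability and generalized derivatives\<close>

lemma integral_le_off_negligible:
  fixes f g :: "real \<Rightarrow> real"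
  assumes "f integrable_on S" "g integrable_on S" "negligible N" "\<And>t. t \<in> S - N \<Longrightarrow> f t \<le> g t"
  shows "integral S f \<le> integral S g"
proof -
  let ?f = "\<lambda>t. if t \<in> N then 0 else f t" and ?g = "\<lambda>t. if t \<in> N then 0 else g t"
  have "integral S f = integral S ?f" "integral S g = integral S ?g"
    by (rule integral_spike[OF assms(3)]; simp)+
  moreover have "?f integrable_on S" "?g integrable_on S"
    by (rule integrable_spike[OF assms(1) assms(3)]; simp) (rule integrable_spike[OF assms(2) assms(3)]; simp)
  ultimately show ?thesis using integral_le[of ?f S ?g] assms(4) by auto
qed

lemma LINT_Ioo_eq_integral:
  fixes f :: "real \<Rightarrow> real"
  assumes "f absolutely_integrable_on {a..b}"
  shows "(LINT t|lebesgue_on {a<..<b}. f t) = integral {a..b} f"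
proof -
  have "f absolutely_integrable_on {a<..<b}" using assms absolutely_integrable_on_Icc_iff_Ioo by blast
  then have "integrable (lebesgue_on {a<..<b}) f" by (simp add: absolutely_integrable_imp_integrable)
  from lebesgue_integral_eq_integral[OF this] show ?thesis by (simp add: integral_open_interval_real)
qed

lemma LINT_Icc_eq_integral:
  fixes f :: "real \<Rightarrow> real"
  assumes "f absolutely_integrable_on {a..b}"
  shows "(LINT t|lebesgue_on {a..b}. f t) = integral {a..b} f"
  using assms by (intro lebesgue_integral_eq_integral absolutely_integrable_imp_integrable) auto

lemma powr_integrable_imp_integrable:
  fixes k :: "real \<Rightarrow> real"
  assumes "k \<in> borel_measurable (lebesgue_on {a..b})" "\<And>r. 0 \<le> k r" "(\<lambda>r. k r powr q) integrable_on {a..b}" "q \<ge> 1"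
  shows "k integrable_on {a..b}"
proof (rule measurable_bounded_by_integrable_imp_integrable[OF assms(1)])
  show "(\<lambda>r. 1 + k r powr q) integrable_on {a..b}" by (intro integrable_add assms) auto
  show "norm (k r) \<le> 1 + k r powr q" for r using le_one_plus_powr[OF assms(2,4)] assms(2) by simp
qed simp

lemma powr_integrable_add:
  fixes k l :: "real \<Rightarrow> real"
  assumes "k \<in> borel_measurable (lebesgue_on {a..b})" "\<And>r. 0 \<le> k r" "(\<lambda>r. k r powr q) integrable_on {a..b}"
    and "l \<in> borel_measurable (lebesgue_on {a..b})" "\<And>r. 0 \<le> l r" "(\<lambda>r. l r powr q) integrable_on {a..b}" "q \<ge> 0"
  shows "(\<lambda>r. (k r + l r) powr q) integrable_on {a..b}"
proof (rule measurable_bounded_by_integrable_imp_integrable)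
  show "(\<lambda>r. (k r + l r) powr q) \<in> borel_measurable (lebesgue_on {a..b})"
    using assms(1,4) by measurable
  show "(\<lambda>r. 2 powr q * (k r powr q + l r powr q)) integrable_on {a..b}"
    by (intro integrable_on_mult_right integrable_add assms)
  show "norm ((k r + l r) powr q) \<le> 2 powr q * (k r powr q + l r powr q)" for r
    using powr_add_le[OF assms(2,5,7)] by simp
qed simp

lemma inner_absolutely_integrable:
  fixes f z :: "real \<Rightarrow> 'h::{real_inner, second_countable_topology}"
  assumes f: "f \<in> borel_measurable (lebesgue_on {a..b})" "(\<lambda>t. norm (f t)) integrable_on {a..b}"
    and z: "continuous_on {a..b} z"
  shows "(\<lambda>t. f t \<bullet> z t) absolutely_integrable_on {a..b}"
proof -
  have zm: "z \<in> borel_measurable (lebesgue_on {a..b})"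
    by (rule continuous_imp_measurable_on_sets_lebesgue[OF z]) simp
  obtain C where C: "\<forall>y\<in>z ` {a..b}. norm y \<le> C"
    using compact_imp_bounded[OF compact_continuous_image[OF z compact_Icc]] unfolding bounded_iff ..
  show ?thesis
  proof (rule measurable_bounded_by_integrable_imp_absolutely_integrable)
    show "(\<lambda>t. f t \<bullet> z t) \<in> borel_measurable (lebesgue_on {a..b})" using f(1) zm by measurable
    show "(\<lambda>t. norm (f t) * C) integrable_on {a..b}" by (intro integrable_on_mult_left f)
    show "norm (f t \<bullet> z t) \<le> norm (f t) * C" if "t \<in> {a..b}" for t
      using Cauchy_Schwarz_ineq2[of "f t" "z t"] mult_left_mono[of "norm (z t)" C "norm (f t)"] C that by fastforce
  qed simp
qed

lemma to_dual_apply [simp]: "to_dual j z v = z \<bullet> j v"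
  by (simp add: to_dual_def)

lemma bdd_above_path:
  assumes "x \<in> paths T" "t \<le> T" shows "bdd_above ((\<lambda>s. norm (x s)) ` {0..t})"
proof -
  have "continuous_on {0..t} (\<lambda>s. norm (x s))"
    using assms by (intro continuous_intros) (auto simp: paths_iff intro: continuous_on_subset)
  then show ?thesis by (intro bounded_imp_bdd_above compact_imp_bounded compact_continuous_image) auto
qed

lemma norm_le_path_sup:
  assumes "x \<in> paths T" "s \<in> {0..t}" "t \<le> T" shows "norm (x s) \<le> (SUP s\<in>{0..t}. norm (x s))"
  by (rule cSUP_upper[OF assms(2) bdd_above_path[OF assms(1,3)]])

lemma paths_continuous: "x \<in> paths T \<Longrightarrow> 0 \<le> a \<Longrightarrow> b \<le> T \<Longrightarrow> continuous_on {a..b} x"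
  by (auto simp: paths_iff intro: continuous_on_subset)

lemma pairing_absolutely_integrable:
  fixes y :: "real \<Rightarrow> ('v::real_normed_vector \<Rightarrow>\<^sub>L real)"
  assumes y: "Lp_on q a b y" and q: "q \<ge> 1"
  shows "(\<lambda>r. y r v) absolutely_integrable_on {a..b}"
proof -
  have meas: "(\<lambda>r. y r v) \<in> borel_measurable (lebesgue_on {a..b})"
    by (rule measurable_compose[OF Lp_on_Icc(1)[OF y] borel_measurable_continuous_onI])
      (intro continuous_intros)
  have ni: "(\<lambda>r. norm (y r)) integrable_on {a..b}"
    by (rule powr_integrable_imp_integrable[OF _ _ Lp_on_Icc(2)[OF y] q])
      (use Lp_on_Icc(1)[OF y] in \<open>auto intro: borel_measurable_norm\<close>)
  show "(\<lambda>r. y r v) absolutely_integrable_on {a..b}"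
  proof (rule measurable_bounded_by_integrable_imp_absolutely_integrable[OF meas])
    show "(\<lambda>r. norm (y r) * norm v) integrable_on {a..b}" by (intro integrable_on_mult_left ni)
    show "norm (y r v) \<le> norm (y r) * norm v" for r by (rule norm_blinfun)
  qed simp
qed

lemma test_function_C1:
  assumes "test_function a b \<phi>"
  shows "continuous_on S \<phi>" "continuous_on S (deriv \<phi>)" "(\<phi> has_real_derivative deriv \<phi> t) (at t)"
proof -
  have d: "(deriv ^^ n) \<phi> field_differentiable at t" for n t using assms by (simp add: test_function_def)
  show "continuous_on S \<phi>"
    using d[of 0] by (auto intro!: continuous_at_imp_continuous_on field_differentiable_imp_continuous_at)
  show "continuous_on S (deriv \<phi>)"
    using d[of 1] by (auto intro!: continuous_at_imp_continuous_on field_differentiable_imp_continuous_at)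
  show "(\<phi> has_real_derivative deriv \<phi> t) (at t)"
    using d[of 0 t] by (simp add: field_differentiable_derivI)
qed

lemma generalized_derivative_imp_integral:
  fixes j :: "'v::{banach, second_countable_topology} \<Rightarrow>\<^sub>L 'h::{real_inner, second_countable_topology}"
    and bx' :: "real \<Rightarrow> ('v \<Rightarrow>\<^sub>L real)"
  assumes gd: "generalized_derivative j a b bx bx'" and q: "q \<ge> 1"
    and bx': "Lp_on q a b bx'" and x: "continuous_on {a..b} x"
    and N: "negligible N" "\<And>t. t \<in> {a..b} - N \<Longrightarrow> x t = j (bx t)"
    and st: "a \<le> s" "s \<le> t" "t \<le> b"
  shows "((\<lambda>r. bx' r v) has_integral ((x t - x s) \<bullet> j v)) {s..t}"
proof -
  define g where "g t = x t \<bullet> j v" for t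
  have gc: "continuous_on {a..b} g" unfolding g_def by (intro continuous_intros x)
  note \<gamma> = pairing_absolutely_integrable[OF bx' q, of v]
  have "((\<lambda>r. bx' r v) has_integral (g t - g s)) {s..t}"
  proof (rule weak_derivative_imp_integral[OF gc \<gamma> _ st])
    fix \<phi> assume \<phi>: "test_function a b \<phi>"
    note \<phi>c = test_function_C1(1)[OF \<phi>] and \<phi>'c = test_function_C1(2)[OF \<phi>]
    have i1: "(\<lambda>t. deriv \<phi> t * g t) absolutely_integrable_on {a..b}"
      using absolutely_integrable_continuous_real[OF continuous_on_mult[OF \<phi>'c gc]] by simp
    have e1: "deriv \<phi> t * blinfun_apply (to_dual j (j (bx t))) v = deriv \<phi> t * g t" if "t \<in> {a..b} - N" for t
      using N(2)[OF that] by (simp add: g_def)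
    have i2: "(\<lambda>t. deriv \<phi> t * blinfun_apply (to_dual j (j (bx t))) v) absolutely_integrable_on {a..b}"
      by (rule absolutely_integrable_spike[OF i1 N(1) e1])
    have i3: "(\<lambda>t. \<phi> t * blinfun_apply (bx' t) v) absolutely_integrable_on {a..b}"
      by (rule absolutely_integrable_mult_bounded[OF \<gamma> \<phi>c])
    have "integral {a..b} (\<lambda>t. deriv \<phi> t * g t) = integral {a..b} (\<lambda>t. deriv \<phi> t * blinfun_apply (to_dual j (j (bx t))) v)"
      by (rule integral_spike[OF N(1) e1])
    also have "\<dots> = - integral {a..b} (\<lambda>t. \<phi> t * blinfun_apply (bx' t) v)"
      using gd \<phi> unfolding generalized_derivative_def
      by (simp only: LINT_Ioo_eq_integral[OF i2, symmetric] LINT_Ioo_eq_integral[OF i3, symmetric])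
    finally show "integral {a..b} (\<lambda>t. deriv \<phi> t * g t) = - integral {a..b} (\<lambda>t. \<phi> t * blinfun_apply (bx' t) v)" .
  qed
  then show ?thesis by (simp add: g_def inner_diff_left)
qed

text \<open>Together with the preceding lemma, this characterizes the generalized derivative of a function with
  a continuous \<open>H\<close>-valued version \<open>x\<close> by increments of \<open>x\<close>.\<close>

lemma integral_imp_generalized_derivative:
  fixes j :: "'v::{banach, second_countable_topology} \<Rightarrow>\<^sub>L 'h::{real_inner, second_countable_topology}"
    and bx' :: "real \<Rightarrow> ('v \<Rightarrow>\<^sub>L real)"
  assumes ab: "a < b" and q: "q \<ge> 1" and bx': "Lp_on q a b bx'" and x: "continuous_on {a..b} x"
    and N: "negligible N" "\<And>t. t \<in> {a..b} - N \<Longrightarrow> x t = j (bx t)"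
    and deriv: "\<And>v s t. a \<le> s \<Longrightarrow> s \<le> t \<Longrightarrow> t \<le> b \<Longrightarrow> ((\<lambda>r. bx' r v) has_integral ((x t - x s) \<bullet> j v)) {s..t}"
  shows "generalized_derivative j a b bx bx'"
  unfolding generalized_derivative_def
proof (intro allI impI)
  fix \<phi> v assume \<phi>: "test_function a b \<phi>"
  define g where "g t = x t \<bullet> j v" for t
  have gc: "continuous_on {a..b} g" unfolding g_def by (intro continuous_intros x)
  note \<gamma> = pairing_absolutely_integrable[OF bx' q, of v]
  note \<phi>c = test_function_C1(1)[OF \<phi>] and \<phi>'c = test_function_C1(2)[OF \<phi>] and \<phi>d = test_function_C1(3)[OF \<phi>]
  obtain c d where cd: "a < c" "d < b" "\<And>t. t \<notin> {c..d} \<Longrightarrow> \<phi> t = 0"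
    using \<phi> unfolding test_function_def by blast
  have i1: "(\<lambda>t. deriv \<phi> t * g t) absolutely_integrable_on {a..b}"
    using absolutely_integrable_continuous_real[OF continuous_on_mult[OF \<phi>'c gc]] by simp
  have e1: "deriv \<phi> t * blinfun_apply (to_dual j (j (bx t))) v = deriv \<phi> t * g t" if "t \<in> {a..b} - N" for t
    using N(2)[OF that] by (simp add: g_def)
  have i2: "(\<lambda>t. deriv \<phi> t * blinfun_apply (to_dual j (j (bx t))) v) absolutely_integrable_on {a..b}"
    by (rule absolutely_integrable_spike[OF i1 N(1) e1])
  have i3: "(\<lambda>t. \<phi> t * blinfun_apply (bx' t) v) absolutely_integrable_on {a..b}"
    by (rule absolutely_integrable_mult_bounded[OF \<gamma> \<phi>c])
  have "integral {a..b} (\<lambda>t. deriv \<phi> t * blinfun_apply (to_dual j (j (bx t))) v) = integral {a..b} (\<lambda>t. deriv \<phi> t * g t)"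
    by (rule integral_spike[OF N(1) e1[symmetric]])
  also have "\<dots> = - integral {a..b} (\<lambda>t. \<phi> t * blinfun_apply (bx' t) v)"
  proof (rule integral_imp_weak_derivative[OF _ \<gamma> _ \<phi>d \<phi>'c])
    show "((\<lambda>r. bx' r v) has_integral g t - g s) {s..t}" if "a \<le> s" "s \<le> t" "t \<le> b" for s t
      using deriv[OF that, of v] by (simp add: g_def inner_diff_left)
  qed (use ab cd in auto)
  finally show "(LINT t|lebesgue_on {a<..<b}. deriv \<phi> t * blinfun_apply (to_dual j (j (bx t))) v)
      = - (LINT t|lebesgue_on {a<..<b}. \<phi> t * blinfun_apply (bx' t) v)"
    unfolding LINT_Ioo_eq_integral[OF i2] LINT_Ioo_eq_integral[OF i3] .
qed

section \<open>Energy estimates for trajectories\<close>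

lemma AE_Icc_imp_negligible:
  assumes "AE t in lebesgue_on {a..b::real}. P t"
  obtains N where "negligible N" "\<And>t. t \<in> {a..b} - N \<Longrightarrow> P t"
proof -
  have "AE t in lebesgue. t \<in> {a..b} \<longrightarrow> P t"
    using assms by (simp add: AE_restrict_space_iff)
  then obtain N where N: "N \<in> null_sets lebesgue" "\<And>t. t \<notin> N \<Longrightarrow> t \<in> {a..b} \<longrightarrow> P t"
    by (auto simp: eventually_ae_filter)
  then show thesis using that[of N] by (auto simp: negligible_iff_null_sets)
qed

text \<open>The standing assumptions on the Gelfand triple and on the operator.\<close>

locale evolution =
  fixes T p q :: real
    and j :: "'v::{banach, second_countable_topology} \<Rightarrow>\<^sub>L
              'h::{real_inner, complete_space, second_countable_topology}"
    and A :: "real \<Rightarrow> 'v \<Rightarrow> ('v \<Rightarrow>\<^sub>L real)"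
  assumes T_pos: "T > 0"
    and p_ge: "p \<ge> 2" and q_gt: "q > 1" and pq: "1 / p + 1 / q = 1"
    and embedding: "dense_compact_embedding j"
    and operator: "admissible_operator T p q A"
begin

lemma operator_pointwise:
  obtains c N where "c > 0" "negligible N"
    "\<And>t x y. t \<in> {0..T} - N \<Longrightarrow> 0 \<le> blinfun_apply (A t x - A t y) (x - y)"
    "\<And>t x. t \<in> {0..T} - N \<Longrightarrow> c * norm x powr p \<le> blinfun_apply (A t x) x"
proof -
  obtain c where c: "c > 0" "AE t in lebesgue_on {0..T}. \<forall>x. blinfun_apply (A t x) x \<ge> c * norm x powr p"
    and m: "AE t in lebesgue_on {0..T}. \<forall>x y. blinfun_apply (A t x - A t y) (x - y) \<ge> 0"
    using operator unfolding admissible_operator_def by blast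
  obtain N1 where N1: "negligible N1" "\<And>t. t \<in> {0..T} - N1 \<Longrightarrow> \<forall>x. blinfun_apply (A t x) x \<ge> c * norm x powr p"
    by (rule AE_Icc_imp_negligible[OF c(2)]) blast
  obtain N2 where N2: "negligible N2" "\<And>t. t \<in> {0..T} - N2 \<Longrightarrow> \<forall>x y. blinfun_apply (A t x - A t y) (x - y) \<ge> 0"
    by (rule AE_Icc_imp_negligible[OF m]) blast
  show thesis
    by (rule that[of c "N1 \<union> N2"]) (use c N1 N2 in \<open>auto simp: negligible_Un\<close>)
qed

text \<open>The content of \<open>trajectory\<close> with one common exceptional set, and with the weak derivative in
  integrated form.\<close>

lemma trajectory_data:
  assumes tr: "trajectory T p q j A L t0 x0 x f" and t0: "0 \<le> t0"
  obtains bx bx' N where "negligible N" "Lp_on p t0 T bx" "Lp_on q t0 T bx'"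
    "\<And>t. t \<in> {t0..T} - N \<Longrightarrow> x t = j (bx t)"
    "\<And>t. t \<in> {t0..T} - N \<Longrightarrow> bx' t + A t (bx t) = to_dual j (f t)"
    "\<And>t. t \<in> {t0..T} - N \<Longrightarrow> norm (f t) \<le> L * (1 + (SUP s\<in>{0..t}. norm (x s)))"
    "\<And>v s t. t0 \<le> s \<Longrightarrow> s \<le> t \<Longrightarrow> t \<le> T \<Longrightarrow> ((\<lambda>r. blinfun_apply (bx' r) v) has_integral ((x t - x s) \<bullet> j v)) {s..t}"
proof -
  obtain bx bx' where W: "W_pq j p q t0 T bx bx'"
    and ae1: "AE t in lebesgue_on {t0<..<T}. x t = blinfun_apply j (bx t)"
    and ae2: "AE t in lebesgue_on {t0<..<T}. bx' t + A t (bx t) = to_dual j (f t)"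
    and ae3: "AE t in lebesgue_on {t0<..<T}. norm (f t) \<le> L * (1 + (SUP s\<in>{0..t}. norm (x s)))"
    and xp: "x \<in> paths T"
    using tr unfolding trajectory_def by blast
  obtain N1 where N1: "negligible N1" "\<And>t. t \<in> {t0..T} - N1 \<Longrightarrow> x t = j (bx t)"
    by (rule AE_lebesgue_on_imp_negligible[OF ae1]) blast
  obtain N2 where N2: "negligible N2" "\<And>t. t \<in> {t0..T} - N2 \<Longrightarrow> bx' t + A t (bx t) = to_dual j (f t)"
    by (rule AE_lebesgue_on_imp_negligible[OF ae2]) blast
  obtain N3 where N3: "negligible N3" "\<And>t. t \<in> {t0..T} - N3 \<Longrightarrow> norm (f t) \<le> L * (1 + (SUP s\<in>{0..t}. norm (x s)))"
    by (rule AE_lebesgue_on_imp_negligible[OF ae3]) blast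
  have d: "((\<lambda>r. blinfun_apply (bx' r) v) has_integral ((x t - x s) \<bullet> j v)) {s..t}" if "t0 \<le> s" "s \<le> t" "t \<le> T" for v s t
  proof (rule generalized_derivative_imp_integral[OF _ _ _ _ N1 that])
    show "generalized_derivative j t0 T bx bx'" "Lp_on q t0 T bx'" using W by (auto simp: W_pq_def)
    show "1 \<le> q" "continuous_on {t0..T} x" using q_gt paths_continuous[OF xp t0] by auto
  qed
  show thesis
    by (rule that[of "N1 \<union> N2 \<union> N3" bx bx'])
      (use N1 N2 N3 W d in \<open>auto simp: W_pq_def\<close>)
qed

lemma trajectory_rhs:
  assumes tr: "trajectory T p q j A L t0 x0 x f" and ab: "t0 \<le> a" "b \<le> T"
  shows "f \<in> borel_measurable (lebesgue_on {a..b})" "(\<lambda>t. norm (f t)) integrable_on {a..b}"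
proof -
  have f: "Lp_on 2 t0 T f" using tr by (simp add: trajectory_def)
  have sub: "{a..b} \<subseteq> {t0..T}" using ab by auto
  have m: "f \<in> borel_measurable (lebesgue_on {t0..T})" by (rule Lp_on_Icc(1)[OF f])
  show "f \<in> borel_measurable (lebesgue_on {a..b})" by (rule borel_measurable_lebesgue_on_mono[OF m sub])
  have "(\<lambda>t. norm (f t)) integrable_on {t0..T}"
    by (rule powr_integrable_imp_integrable[OF _ _ Lp_on_Icc(2)[OF f]]) (use m in \<open>auto intro: borel_measurable_norm\<close>)
  then show "(\<lambda>t. norm (f t)) integrable_on {a..b}" using sub by (rule integrable_on_subinterval)
qed

lemma trajectory_path: "trajectory T p q j A L t0 x0 x f \<Longrightarrow> x \<in> paths T"
  by (simp add: trajectory_def)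

text \<open>Monotonicity of \<open>A\<close> makes the distance of two trajectories grow no faster than their
  right-hand sides allow.\<close>

lemma energy_difference:
  assumes x: "trajectory T p q j A L t0 x0 x f" and y: "trajectory T p q j A L t0 y0 y g"
    and t0: "0 \<le> t0" and ab: "t0 \<le> a" "a \<le> b" "b \<le> T"
  shows "(\<lambda>s. (f s - g s) \<bullet> (x s - y s)) absolutely_integrable_on {a..b}" (is ?int)
    and "(norm (x b - y b))\<^sup>2 \<le> (norm (x a - y a))\<^sup>2 + 2 * integral {a..b} (\<lambda>s. (f s - g s) \<bullet> (x s - y s))"
proof -
  have sub: "{a..b} \<subseteq> {t0..T}" using ab by auto
  have p1: "p > 1" using p_ge by simp
  note xp = trajectory_path[OF x] and yp = trajectory_path[OF y]
  have wc: "continuous_on {a..b} (\<lambda>s. x s - y s)"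
    using t0 ab by (intro continuous_intros paths_continuous[OF xp] paths_continuous[OF yp]) auto
  note fm = trajectory_rhs[OF x ab(1,3)] and gm = trajectory_rhs[OF y ab(1,3)]
  have ni: "(\<lambda>t. norm (f t - g t)) integrable_on {a..b}"
  proof (rule measurable_bounded_by_integrable_imp_integrable)
    show "(\<lambda>t. norm (f t - g t)) \<in> borel_measurable (lebesgue_on {a..b})" using fm(1) gm(1) by measurable
    show "(\<lambda>t. norm (f t) + norm (g t)) integrable_on {a..b}" by (intro integrable_add fm gm)
    show "norm (norm (f t - g t)) \<le> norm (f t) + norm (g t)" for t by (simp add: norm_triangle_ineq4)
  qed simp
  show int: ?int
    by (rule inner_absolutely_integrable[OF _ ni wc]) (use fm(1) gm(1) in measurable)
  obtain bx bx' N1 where bx: "negligible N1" "Lp_on p t0 T bx" "Lp_on q t0 T bx'"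
    "\<And>t. t \<in> {t0..T} - N1 \<Longrightarrow> x t = j (bx t)"
    "\<And>t. t \<in> {t0..T} - N1 \<Longrightarrow> bx' t + A t (bx t) = to_dual j (f t)"
    "\<And>v s t. t0 \<le> s \<Longrightarrow> s \<le> t \<Longrightarrow> t \<le> T \<Longrightarrow> ((\<lambda>r. blinfun_apply (bx' r) v) has_integral ((x t - x s) \<bullet> j v)) {s..t}"
    by (rule trajectory_data[OF x t0]) blast
  obtain vy vy' N2 where yx: "negligible N2" "Lp_on p t0 T vy" "Lp_on q t0 T vy'"
    "\<And>t. t \<in> {t0..T} - N2 \<Longrightarrow> y t = j (vy t)"
    "\<And>t. t \<in> {t0..T} - N2 \<Longrightarrow> vy' t + A t (vy t) = to_dual j (g t)"
    "\<And>v s t. t0 \<le> s \<Longrightarrow> s \<le> t \<Longrightarrow> t \<le> T \<Longrightarrow> ((\<lambda>r. blinfun_apply (vy' r) v) has_integral ((y t - y s) \<bullet> j v)) {s..t}"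
    by (rule trajectory_data[OF y t0]) blast
  obtain c N3 where A: "negligible N3"
    "\<And>t x y. t \<in> {0..T} - N3 \<Longrightarrow> 0 \<le> blinfun_apply (A t x - A t y) (x - y)"
    by (rule operator_pointwise) blast
  define N where "N = N1 \<union> N2 \<union> N3"
  have N: "negligible N" using bx yx A by (simp add: N_def negligible_Un)
  define z where "z t = bx t - vy t" for t
  define z' where "z' t = bx' t - vy' t" for t
  define k where "k t = norm (bx' t) + norm (vy' t)" for t
  note mono_m = borel_measurable_lebesgue_on_mono[OF _ sub] and mono_i = integrable_on_subinterval[OF _ sub]
  have bm: "bx \<in> borel_measurable (lebesgue_on {a..b})" "vy \<in> borel_measurable (lebesgue_on {a..b})"
    using mono_m Lp_on_Icc(1) bx(2) yx(2) by blast+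
  have bm': "(\<lambda>t. norm (bx' t)) \<in> borel_measurable (lebesgue_on {a..b})" "(\<lambda>t. norm (vy' t)) \<in> borel_measurable (lebesgue_on {a..b})"
    by (rule mono_m[OF measurable_compose[OF Lp_on_Icc(1)[OF bx(3)] borel_measurable_norm]])
      (rule mono_m[OF measurable_compose[OF Lp_on_Icc(1)[OF yx(3)] borel_measurable_norm]])
  note bi = mono_i[OF Lp_on_Icc(2)[OF bx(2)]] mono_i[OF Lp_on_Icc(2)[OF yx(2)]]
  note bi' = mono_i[OF Lp_on_Icc(2)[OF bx(3)]] mono_i[OF Lp_on_Icc(2)[OF yx(3)]]
  have zm: "z \<in> borel_measurable (lebesgue_on {a..b})"
    unfolding z_def using bm by measurable
  have zi: "(\<lambda>t. norm (z t) powr p) integrable_on {a..b}"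
  proof (rule measurable_bounded_by_integrable_imp_integrable)
    show "(\<lambda>t. norm (z t) powr p) \<in> borel_measurable (lebesgue_on {a..b})" using zm by measurable
    show "(\<lambda>t. (norm (bx t) + norm (vy t)) powr p) integrable_on {a..b}"
      by (rule powr_integrable_add) (use bm bi p1 in \<open>auto intro: borel_measurable_norm\<close>)
    show "norm (norm (z t) powr p) \<le> (norm (bx t) + norm (vy t)) powr p" for t
      using p1 by (auto intro!: powr_mono2 simp: z_def norm_triangle_ineq4)
  qed simp
  have z'm: "(\<lambda>r. blinfun_apply (z' r) v) \<in> borel_measurable (lebesgue_on {a..b})" for v
  proof -
    have "(\<lambda>r. blinfun_apply (bx' r) v) \<in> borel_measurable (lebesgue_on {t0..T})"
         "(\<lambda>r. blinfun_apply (vy' r) v) \<in> borel_measurable (lebesgue_on {t0..T})"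
      using pairing_absolutely_integrable[OF bx(3), of v] pairing_absolutely_integrable[OF yx(3), of v] q_gt
      by (auto simp: absolutely_integrable_measurable)
    from this[THEN mono_m] show ?thesis by (simp add: z'_def blinfun.diff_left)
  qed
  have z'k: "norm (z' r) \<le> k r" for r by (simp add: z'_def k_def norm_triangle_ineq4)
  have kq: "(\<lambda>r. k r powr q) integrable_on {a..b}" unfolding k_def
    by (rule powr_integrable_add) (use bm' bi' q_gt in auto)
  have ki: "k integrable_on {a..b}"
    by (rule powr_integrable_imp_integrable[OF _ _ kq]) (use bm' q_gt in \<open>auto simp: k_def[abs_def]\<close>)
  have wz: "x t - y t = j (z t)" if "t \<in> {a..b} - N" for t
    using bx(4)[of t] yx(4)[of t] that sub by (auto simp: z_def N_def blinfun.diff_right)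
  have zd: "((\<lambda>r. blinfun_apply (z' r) v) has_integral ((x t - y t - (x s - y s)) \<bullet> j v)) {s..t}"
    if "a \<le> s" "s \<le> t" "t \<le> b" for v s t
  proof -
    have "((\<lambda>r. blinfun_apply (bx' r) v - blinfun_apply (vy' r) v) has_integral ((x t - x s) \<bullet> j v - (y t - y s) \<bullet> j v)) {s..t}"
      by (intro has_integral_diff bx yx) (use that ab in auto)
    moreover have "(x t - x s) \<bullet> j v - (y t - y s) \<bullet> j v = (x t - y t - (x s - y s)) \<bullet> j v"
      by (simp add: inner_diff_left)
    ultimately show ?thesis by (simp add: z'_def blinfun.diff_left)
  qed
  have "(norm (x b - y b))\<^sup>2 - (norm (x a - y a))\<^sup>2 = 2 * integral {a..b} (\<lambda>r. blinfun_apply (z' r) (z r))"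
    by (rule energy_identity[OF ab(2) p1 q_gt pq wc zm zi z'm z'k kq N wz zd ki])
  moreover have "integral {a..b} (\<lambda>r. blinfun_apply (z' r) (z r)) \<le> integral {a..b} (\<lambda>s. (f s - g s) \<bullet> (x s - y s))"
  proof (rule integral_le_off_negligible[OF _ _ N])
    show "(\<lambda>r. blinfun_apply (z' r) (z r)) integrable_on {a..b}"
      using pairing_integrable[OF p1 q_gt pq zm zi z'm z'k kq] by (rule set_lebesgue_integral_eq_integral)
    show "(\<lambda>s. (f s - g s) \<bullet> (x s - y s)) integrable_on {a..b}" using int by (rule set_lebesgue_integral_eq_integral)
    fix t assume t: "t \<in> {a..b} - N"
    have tt: "t \<in> {t0..T} - N1" "t \<in> {t0..T} - N2" "t \<in> {0..T} - N3" using t sub t0 by (auto simp: N_def)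
    have z't: "z' t = to_dual j (f t) - to_dual j (g t) - (A t (bx t) - A t (vy t))"
      unfolding z'_def bx(5)[OF tt(1), symmetric] yx(5)[OF tt(2), symmetric] by simp
    have "blinfun_apply (z' t) (z t) = (f t - g t) \<bullet> j (z t) - blinfun_apply (A t (bx t) - A t (vy t)) (bx t - vy t)"
      unfolding z't by (simp add: blinfun.diff_left inner_diff_left z_def)
    then show "blinfun_apply (z' t) (z t) \<le> (f t - g t) \<bullet> (x t - y t)"
      using A(2)[OF tt(3), of "bx t" "vy t"] wz[OF t] by simp
  qed
  ultimately show "(norm (x b - y b))\<^sup>2 \<le> (norm (x a - y a))\<^sup>2 + 2 * integral {a..b} (\<lambda>s. (f s - g s) \<bullet> (x s - y s))"
    by simp
qed

text \<open>\<open>bx\<close> is a \<open>V\<close>-valued version of \<open>x\<close> on \<open>[t0,T]\<close> for which the energy inequality with coercivity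
  constant \<open>c\<close> holds.\<close>

definition energy_version :: "real \<Rightarrow> real \<Rightarrow> (real \<Rightarrow> 'h) \<Rightarrow> (real \<Rightarrow> 'h) \<Rightarrow> (real \<Rightarrow> 'v) \<Rightarrow> bool" where
  "energy_version c t0 x f bx \<longleftrightarrow>
     (\<exists>N. negligible N \<and> (\<forall>t\<in>{t0..T} - N. x t = j (bx t))) \<and>
     bx \<in> borel_measurable (lebesgue_on {t0..T}) \<and> (\<lambda>t. norm (bx t) powr p) integrable_on {t0..T} \<and>
     (\<forall>b\<in>{t0..T}. (norm (x b))\<^sup>2 + 2 * c * integral {t0..b} (\<lambda>t. norm (bx t) powr p)
        \<le> (norm (x t0))\<^sup>2 + 2 * integral {t0..b} (\<lambda>s. f s \<bullet> x s))"

text \<open>Coercivity makes the energy control the \<open>L\<^sup>p\<close> norm of \<open>bx\<close>.\<close>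

lemma energy_single:
  obtains c where "c > 0"
    "\<And>L t0 x0 x f. trajectory T p q j A L t0 x0 x f \<Longrightarrow> 0 \<le> t0 \<Longrightarrow>
      \<exists>bx. energy_version c t0 x f bx"
proof -
  obtain c N3 where A: "c > 0" "negligible N3"
    "\<And>t x. t \<in> {0..T} - N3 \<Longrightarrow> c * norm x powr p \<le> blinfun_apply (A t x) x"
    by (rule operator_pointwise) blast
  have p1: "p > 1" using p_ge by simp
  show thesis
  proof (rule that[OF A(1)])
    fix L t0 x0 x f assume x: "trajectory T p q j A L t0 x0 x f" and t0: "0 \<le> t0"
    obtain bx bx' N1 where bx: "negligible N1" "Lp_on p t0 T bx" "Lp_on q t0 T bx'"
      "\<And>t. t \<in> {t0..T} - N1 \<Longrightarrow> x t = j (bx t)"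
      "\<And>t. t \<in> {t0..T} - N1 \<Longrightarrow> bx' t + A t (bx t) = to_dual j (f t)"
      "\<And>v s t. t0 \<le> s \<Longrightarrow> s \<le> t \<Longrightarrow> t \<le> T \<Longrightarrow> ((\<lambda>r. blinfun_apply (bx' r) v) has_integral ((x t - x s) \<bullet> j v)) {s..t}"
      by (rule trajectory_data[OF x t0]) blast
    note bxI = Lp_on_Icc[OF bx(2)] and bx'I = Lp_on_Icc[OF bx(3)]
    have "(norm (x b))\<^sup>2 + 2 * c * integral {t0..b} (\<lambda>t. norm (bx t) powr p)
          \<le> (norm (x t0))\<^sup>2 + 2 * integral {t0..b} (\<lambda>s. f s \<bullet> x s)" if b: "b \<in> {t0..T}" for b
    proof -
      have sub: "{t0..b} \<subseteq> {t0..T}" using b by auto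
      note mono_m = borel_measurable_lebesgue_on_mono[OF _ sub] and mono_i = integrable_on_subinterval[OF _ sub]
      have wc: "continuous_on {t0..b} x" using paths_continuous[OF trajectory_path[OF x]] t0 b by auto
      have bxw: "(\<lambda>r. blinfun_apply (bx' r) v) \<in> borel_measurable (lebesgue_on {t0..b})" for v
        using pairing_absolutely_integrable[OF bx(3), of v] q_gt
        by (intro mono_m) (auto simp: absolutely_integrable_measurable)
      have ki: "(\<lambda>r. norm (bx' r)) integrable_on {t0..b}"
        by (rule powr_integrable_imp_integrable[OF _ _ mono_i[OF bx'I(2)]])
          (use q_gt mono_m[OF measurable_compose[OF bx'I(1) borel_measurable_norm]] in auto)
      have N: "negligible (N1 \<union> N3)" using bx(1) A(2) by (rule negligible_Un)
      have dd: "((\<lambda>r. blinfun_apply (bx' r) v) has_integral ((x t - x s) \<bullet> j v)) {s..t}" if "t0 \<le> s" "s \<le> t" "t \<le> b" for v s t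
        by (rule bx(6)) (use that b in auto)
      have id: "(norm (x b))\<^sup>2 - (norm (x t0))\<^sup>2 = 2 * integral {t0..b} (\<lambda>r. blinfun_apply (bx' r) (bx r))"
        by (rule energy_identity[OF _ p1 q_gt pq wc mono_m[OF bxI(1)] mono_i[OF bxI(2)] bxw order_refl mono_i[OF bx'I(2)] N _ dd ki])
          (use b bx(4) in auto)
      have pi: "(\<lambda>r. blinfun_apply (bx' r) (bx r)) integrable_on {t0..b}"
        using pairing_integrable[OF p1 q_gt pq mono_m[OF bxI(1)] mono_i[OF bxI(2)] bxw order_refl mono_i[OF bx'I(2)]]
        by (rule set_lebesgue_integral_eq_integral)
      have fi: "(\<lambda>s. f s \<bullet> x s) integrable_on {t0..b}"
        using inner_absolutely_integrable[OF trajectory_rhs[OF x order_refl] wc] b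
        by (auto intro: set_lebesgue_integral_eq_integral)
      have ci: "(\<lambda>t. c * norm (bx t) powr p) integrable_on {t0..b}"
        by (intro integrable_on_mult_right mono_i bxI)
      have "integral {t0..b} (\<lambda>r. blinfun_apply (bx' r) (bx r)) \<le> integral {t0..b} (\<lambda>r. f r \<bullet> x r - c * norm (bx r) powr p)"
      proof (rule integral_le_off_negligible[OF pi integrable_diff[OF fi ci] N])
        fix t assume t: "t \<in> {t0..b} - (N1 \<union> N3)"
        then have tt: "t \<in> {t0..T} - N1" "t \<in> {0..T} - N3" using t0 b by auto
        have "bx' t = to_dual j (f t) - A t (bx t)" using bx(5)[OF tt(1)] by (simp add: algebra_simps)
        then have "blinfun_apply (bx' t) (bx t) = f t \<bullet> x t - blinfun_apply (A t (bx t)) (bx t)"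
          using bx(4)[OF tt(1)] by (simp add: blinfun.diff_left)
        then show "blinfun_apply (bx' t) (bx t) \<le> f t \<bullet> x t - c * norm (bx t) powr p"
          using A(3)[OF tt(2), of "bx t"] by simp
      qed
      also have "\<dots> = integral {t0..b} (\<lambda>r. f r \<bullet> x r) - c * integral {t0..b} (\<lambda>t. norm (bx t) powr p)"
        using integral_diff[OF fi ci] by simp
      finally show ?thesis using id by simp
    qed
    then show "\<exists>bx. energy_version c t0 x f bx"
      using bx(1,4) bxI unfolding energy_version_def by (intro exI[of _ bx]) auto
  qed
qed

section \<open>A priori bounds\<close>

text \<open>A Gronwall argument. With \<open>\<mu>\<close> the running maximum of \<open>1 + norm (x t)\<close>, the energy inequality
  bounds \<open>\<mu>\<^sup>2\<close> by an integral of \<open>\<mu>\<^sup>2\<close>; the supremum \<open>S\<close> of \<open>exp (- \<kappa> (t - t0)) \<mu> t\<close> therefore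
  satisfies \<open>S\<^sup>2 \<le> B + S\<^sup>2 / 2\<close> once the weight \<open>\<kappa>\<close> is large compared with \<open>L\<close>.\<close>

lemma trajectory_sup_bound:
  assumes L: "L \<ge> 0" and t0: "0 \<le> t0" "t0 < T" and x0: "x0 \<in> paths T"
  obtains R where "R \<ge> 0"
    "\<And>x f t. trajectory T p q j A L t0 x0 x f \<Longrightarrow> t \<in> {0..T} \<Longrightarrow> norm (x t) \<le> R"
proof -
  define M0 where "M0 = (SUP s\<in>{0..t0}. norm (x0 s))"
  have M0: "norm (x0 s) \<le> M0" if "s \<in> {0..t0}" for s
    unfolding M0_def by (rule norm_le_path_sup[OF x0 that]) (use t0 in simp)
  have M0_nonneg: "0 \<le> M0" using order_trans[OF norm_ge_zero M0[of 0]] t0 by simp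
  define \<kappa> where "\<kappa> = 4 * L + 1"
  have \<kappa>: "\<kappa> > 0" "2 * L / \<kappa> \<le> 1 / 2" using L by (auto simp: \<kappa>_def field_simps)
  define B where "B = 2 + 2 * M0\<^sup>2"
  have B: "B \<ge> 2" by (simp add: B_def)
  define R where "R = sqrt (2 * B) * exp (\<kappa> * T)"
  show thesis
  proof (rule that[of R])
    show "R \<ge> 0" using B by (simp add: R_def)
    fix x f t assume x: "trajectory T p q j A L t0 x0 x f" and t: "t \<in> {0..T}"
    note xp = trajectory_path[OF x]
    have x_init: "x s = x0 s" if "s \<in> {0..t0}" for s using x that by (simp add: trajectory_def)
    define \<mu> where "\<mu> t = 1 + (SUP s\<in>{0..t}. norm (x s))" for t
    have \<mu>_upper: "1 + norm (x s) \<le> \<mu> t" if "s \<in> {0..t}" "t \<le> T" for s t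
      using norm_le_path_sup[OF xp that] by (simp add: \<mu>_def)
    have \<mu>_least: "\<mu> t \<le> C" if "0 \<le> t" "\<And>s. s \<in> {0..t} \<Longrightarrow> 1 + norm (x s) \<le> C" for t C
    proof -
      have "(SUP s\<in>{0..t}. norm (x s)) \<le> C - 1"
        by (rule cSUP_least) (use that in \<open>auto simp: algebra_simps\<close>)
      then show ?thesis by (simp add: \<mu>_def)
    qed
    have \<mu>1: "1 \<le> \<mu> t" if "t \<in> {0..T}" for t
      using order_trans[of 1 "1 + norm (x 0)" "\<mu> t"] \<mu>_upper[of 0 t] that by simp
    define g where "g t = exp (- (\<kappa> * (t - t0))) * \<mu> t" for t
    have ee: "exp (- u) * exp u = 1" for u :: real by (simp flip: exp_add)
    define S where "S = (SUP t\<in>{t0..T}. g t)"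
    have "bdd_above (g ` {t0..T})"
    proof (rule bdd_aboveI2)
      fix t assume t: "t \<in> {t0..T}"
      have "\<mu> t \<le> \<mu> T" by (rule \<mu>_least) (use t t0 \<mu>_upper in auto)
      moreover have "exp (- (\<kappa> * (t - t0))) \<le> 1" using t \<kappa> by simp
      ultimately show "g t \<le> \<mu> T"
        unfolding g_def using mult_mono[of "exp (- (\<kappa> * (t - t0)))" 1 "\<mu> t" "\<mu> T"] \<mu>1[of t] t t0 by simp
    qed
    then have gS: "g t \<le> S" if "t \<in> {t0..T}" for t unfolding S_def by (intro cSUP_upper that)
    have \<mu>S: "\<mu> t \<le> S * exp (\<kappa> * (t - t0))" if "t \<in> {t0..T}" for t
    proof -
      have "\<mu> t = (exp (- (\<kappa> * (t - t0))) * exp (\<kappa> * (t - t0))) * \<mu> t" by (simp only: ee mult_1_left)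
      also have "\<dots> = g t * exp (\<kappa> * (t - t0))" by (simp only: g_def mult_ac)
      finally have "\<mu> t = g t * exp (\<kappa> * (t - t0))" .
      then show ?thesis using gS[OF that] by simp
    qed
    have S1: "1 \<le> S" using gS[of t0] \<mu>1[of t0] t0 by (simp add: g_def)
    obtain c where c: "c > 0" "\<And>L t0 x0 x f. trajectory T p q j A L t0 x0 x f \<Longrightarrow> 0 \<le> t0 \<Longrightarrow> \<exists>bx. energy_version c t0 x f bx"
      by (rule energy_single) blast
    obtain bx where bx: "energy_version c t0 x f bx" using c(2)[OF x t0(1)] by blast
    obtain N where N: "negligible N" "\<And>t. t \<in> {t0..T} - N \<Longrightarrow> norm (f t) \<le> L * (1 + (SUP s\<in>{0..t}. norm (x s)))"
      by (rule trajectory_data[OF x t0(1)]) blast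
    have grow: "(norm (x b))\<^sup>2 \<le> M0\<^sup>2 + (L / \<kappa>) * S\<^sup>2 * exp (2 * \<kappa> * (b - t0))" if b: "b \<in> {t0..T}" for b
    proof -
      have bx: "(\<lambda>t. norm (bx t) powr p) integrable_on {t0..T}"
        "(norm (x b))\<^sup>2 + 2 * c * integral {t0..b} (\<lambda>t. norm (bx t) powr p)
          \<le> (norm (x t0))\<^sup>2 + 2 * integral {t0..b} (\<lambda>s. f s \<bullet> x s)"
        using bx b unfolding energy_version_def by auto
      have "0 \<le> integral {t0..b} (\<lambda>t. norm (bx t) powr p)"
        by (rule integral_nonneg) (use b in \<open>auto intro!: integrable_on_subinterval[OF bx(1)]\<close>)
      then have "0 \<le> 2 * c * integral {t0..b} (\<lambda>t. norm (bx t) powr p)"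
        using c(1) by (intro mult_nonneg_nonneg) auto
      then have 1: "(norm (x b))\<^sup>2 \<le> (norm (x t0))\<^sup>2 + 2 * integral {t0..b} (\<lambda>s. f s \<bullet> x s)"
        using bx(2) by linarith
      have fi: "(\<lambda>s. f s \<bullet> x s) integrable_on {t0..b}"
        using inner_absolutely_integrable[OF trajectory_rhs[OF x order_refl] paths_continuous[OF xp t0(1)]] b
        by (auto intro: set_lebesgue_integral_eq_integral)
      have ei: "((\<lambda>s. L * S\<^sup>2 * exp (2 * \<kappa> * (s - t0))) has_integral
          (L * S\<^sup>2 / (2 * \<kappa>) * exp (2 * \<kappa> * (b - t0)) - L * S\<^sup>2 / (2 * \<kappa>) * exp (2 * \<kappa> * (t0 - t0)))) {t0..b}"
        by (rule fundamental_theorem_of_calculus)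
          (use b \<kappa> in \<open>auto intro!: derivative_eq_intros simp flip: has_real_derivative_iff_has_vector_derivative\<close>)
      have "integral {t0..b} (\<lambda>s. f s \<bullet> x s) \<le> integral {t0..b} (\<lambda>s. L * S\<^sup>2 * exp (2 * \<kappa> * (s - t0)))"
      proof (rule integral_le_off_negligible[OF fi has_integral_integrable[OF ei] N(1)])
        fix s assume "s \<in> {t0..b} - N"
        then have s: "s \<in> {t0..T} - N" "s \<in> {t0..T}" "s \<in> {0..T}" using b t0 by auto
        have "f s \<bullet> x s \<le> norm (f s) * norm (x s)" by (rule norm_cauchy_schwarz)
        also have "\<dots> \<le> (L * \<mu> s) * \<mu> s"
          using N(2)[OF s(1)] \<mu>_upper[of s s] \<mu>1[OF s(3)] s(3) L by (intro mult_mono) (auto simp: \<mu>_def)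
        also have "\<dots> = L * (\<mu> s)\<^sup>2" by (simp add: power2_eq_square)
        also have "\<dots> \<le> L * (S * exp (\<kappa> * (s - t0)))\<^sup>2"
          using \<mu>S[OF s(2)] \<mu>1[OF s(3)] L by (intro mult_left_mono power_mono) auto
        also have "\<dots> = L * S\<^sup>2 * exp (2 * \<kappa> * (s - t0))"
          by (simp add: power_mult_distrib exp_double[symmetric] mult.assoc)
        finally show "f s \<bullet> x s \<le> L * S\<^sup>2 * exp (2 * \<kappa> * (s - t0))" .
      qed
      also have "\<dots> \<le> L * S\<^sup>2 / (2 * \<kappa>) * exp (2 * \<kappa> * (b - t0))"
        using integral_unique[OF ei] L \<kappa> by simp
      finally have "2 * integral {t0..b} (\<lambda>s. f s \<bullet> x s) \<le> (L / \<kappa>) * S\<^sup>2 * exp (2 * \<kappa> * (b - t0))"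
        using \<kappa> by (simp add: field_simps)
      moreover have "(norm (x t0))\<^sup>2 \<le> M0\<^sup>2"
        using M0[of t0] x_init[of t0] t0 by (intro power_mono) auto
      ultimately show ?thesis using 1 by simp
    qed
    have pointwise: "1 + norm (x r) \<le> sqrt (B + S\<^sup>2 / 2) * exp (\<kappa> * (b - t0))"
      if b: "b \<in> {t0..T}" and r: "r \<in> {0..b}" for b r
    proof -
      have E1: "1 \<le> exp (2 * \<kappa> * (b - t0))" using b \<kappa> by simp
      have sq: "(norm (x r))\<^sup>2 \<le> M0\<^sup>2 + (L / \<kappa>) * S\<^sup>2 * exp (2 * \<kappa> * (b - t0))"
      proof (cases "r \<le> t0")
        case True
        then have "(norm (x r))\<^sup>2 \<le> M0\<^sup>2" using M0[of r] x_init[of r] r by (intro power_mono) auto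
        moreover have "0 \<le> (L / \<kappa>) * S\<^sup>2 * exp (2 * \<kappa> * (b - t0))" using L \<kappa> by simp
        ultimately show ?thesis by simp
      next
        case False
        have "(L / \<kappa>) * S\<^sup>2 * exp (2 * \<kappa> * (r - t0)) \<le> (L / \<kappa>) * S\<^sup>2 * exp (2 * \<kappa> * (b - t0))"
          using r L \<kappa> by (intro mult_left_mono) auto
        moreover have "r \<in> {t0..T}" using False r b by auto
        ultimately show ?thesis using grow[of r] by simp
      qed
      have "(1 + norm (x r))\<^sup>2 \<le> 2 + 2 * (norm (x r))\<^sup>2"
        using sum_squares_bound[of 1 "norm (x r)"] by (simp add: power2_sum)
      also have "\<dots> \<le> B + (2 * L / \<kappa>) * (S\<^sup>2 * exp (2 * \<kappa> * (b - t0)))" using sq by (simp add: B_def)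
      also have "\<dots> \<le> B * exp (2 * \<kappa> * (b - t0)) + (1 / 2) * (S\<^sup>2 * exp (2 * \<kappa> * (b - t0)))"
        using \<kappa>(2) mult_left_mono[OF E1, of B] B by (intro add_mono mult_right_mono) auto
      also have "\<dots> = (B + S\<^sup>2 / 2) * exp (2 * \<kappa> * (b - t0))" by (simp add: algebra_simps)
      also have "\<dots> = (sqrt (B + S\<^sup>2 / 2) * exp (\<kappa> * (b - t0)))\<^sup>2"
        using B by (simp add: power_mult_distrib exp_double[symmetric] mult.assoc)
      finally show ?thesis by (rule power2_le_imp_le) (use B in simp)
    qed
    have "g b \<le> sqrt (B + S\<^sup>2 / 2)" if b: "b \<in> {t0..T}" for b
    proof -
      have "\<mu> b \<le> sqrt (B + S\<^sup>2 / 2) * exp (\<kappa> * (b - t0))"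
        by (rule \<mu>_least) (use b t0 pointwise in auto)
      then have "exp (- (\<kappa> * (b - t0))) * \<mu> b \<le> exp (- (\<kappa> * (b - t0))) * (sqrt (B + S\<^sup>2 / 2) * exp (\<kappa> * (b - t0)))"
        by (intro mult_left_mono) auto
      also have "\<dots> = sqrt (B + S\<^sup>2 / 2) * (exp (- (\<kappa> * (b - t0))) * exp (\<kappa> * (b - t0)))" by (simp only: mult_ac)
      finally show ?thesis by (simp only: g_def ee mult_1_right)
    qed
    then have "(SUP t\<in>{t0..T}. g t) \<le> sqrt (B + S\<^sup>2 / 2)" by (intro cSUP_least) (use t0 in auto)
    then have "S \<le> sqrt (B + S\<^sup>2 / 2)" by (simp only: S_def[symmetric])
    then have "S\<^sup>2 \<le> (sqrt (B + S\<^sup>2 / 2))\<^sup>2" using S1 by (intro power_mono) auto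
    then have "S\<^sup>2 \<le> 2 * B" using B by simp
    then have S_le: "S \<le> sqrt (2 * B)" by (rule real_le_rsqrt)
    have "1 + norm (x t) \<le> \<mu> T" by (rule \<mu>_upper) (use t in auto)
    also have "\<dots> \<le> S * exp (\<kappa> * (T - t0))" by (rule \<mu>S) (use t0 in auto)
    also have "\<dots> \<le> sqrt (2 * B) * exp (\<kappa> * T)"
      using S_le S1 \<kappa> t0 B by (intro mult_mono) auto
    finally show "norm (x t) \<le> R" by (simp add: R_def)
  qed
qed

text \<open>The bounds shared by all trajectories from a given initial condition. The constant \<open>C\<close>
  limits the growth, though not the decay, of the squared distance of two of them.\<close>

lemma trajectory_bounds:
  assumes L: "L \<ge> 0" and t0: "0 \<le> t0" "t0 < T" and x0: "x0 \<in> paths T"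
  obtains R C K where "R \<ge> 0" "C \<ge> 0"
    "\<And>x f t. trajectory T p q j A L t0 x0 x f \<Longrightarrow> t \<in> {0..T} \<Longrightarrow> norm (x t) \<le> R"
    "\<And>x f. trajectory T p q j A L t0 x0 x f \<Longrightarrow>
       \<exists>N. negligible N \<and> (\<forall>t\<in>{t0..T} - N. norm (f t) \<le> L * (1 + R))"
    "\<And>x f. trajectory T p q j A L t0 x0 x f \<Longrightarrow>
       \<exists>bx N. negligible N \<and> (\<forall>t\<in>{t0..T} - N. x t = j (bx t)) \<and>
         bx \<in> borel_measurable (lebesgue_on {t0..T}) \<and> (\<lambda>t. norm (bx t) powr p) integrable_on {t0..T} \<and>
         integral {t0..T} (\<lambda>t. norm (bx t) powr p) \<le> K"
    "\<And>x f y g a b. trajectory T p q j A L t0 x0 x f \<Longrightarrow> trajectory T p q j A L t0 x0 y g \<Longrightarrow>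
       t0 \<le> a \<Longrightarrow> a \<le> b \<Longrightarrow> b \<le> T \<Longrightarrow>
       (norm (x b - y b))\<^sup>2 \<le> (norm (x a - y a))\<^sup>2 + C * (b - a)"
proof -
  obtain R where R: "R \<ge> 0" "\<And>x f t. trajectory T p q j A L t0 x0 x f \<Longrightarrow> t \<in> {0..T} \<Longrightarrow> norm (x t) \<le> R"
    by (rule trajectory_sup_bound[OF L t0 x0]) blast
  have LR: "0 \<le> L * (1 + R)" using L R(1) by simp
  have f_bound: "\<exists>N. negligible N \<and> (\<forall>t\<in>{t0..T} - N. norm (f t) \<le> L * (1 + R))"
    if x: "trajectory T p q j A L t0 x0 x f" for x f
  proof -
    obtain N where N: "negligible N" "\<And>t. t \<in> {t0..T} - N \<Longrightarrow> norm (f t) \<le> L * (1 + (SUP s\<in>{0..t}. norm (x s)))"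
      by (rule trajectory_data[OF x t0(1)]) blast
    have "norm (f t) \<le> L * (1 + R)" if t: "t \<in> {t0..T} - N" for t
    proof -
      have "(SUP s\<in>{0..t}. norm (x s)) \<le> R" by (rule cSUP_least) (use R(2)[OF x] t t0 in auto)
      then have "L * (1 + (SUP s\<in>{0..t}. norm (x s))) \<le> L * (1 + R)" using L by (intro mult_left_mono) auto
      then show ?thesis using N(2)[OF t] by simp
    qed
    then show ?thesis using N(1) by blast
  qed
  obtain c where c: "c > 0" "\<And>L t0 x0 x f. trajectory T p q j A L t0 x0 x f \<Longrightarrow> 0 \<le> t0 \<Longrightarrow> \<exists>bx. energy_version c t0 x f bx"
    by (rule energy_single) blast
  define K where "K = (R\<^sup>2 + 2 * ((T - t0) * (L * (1 + R) * R))) / (2 * c)"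
  define C where "C = 8 * (L * (1 + R) * R)"
  show thesis
  proof (rule that[of R C K])
    show "R \<ge> 0" by (rule R)
    show "C \<ge> 0" using LR R by (simp add: C_def)
    show "norm (x t) \<le> R" if "trajectory T p q j A L t0 x0 x f" "t \<in> {0..T}" for x f t by (rule R(2)[OF that])
    show "\<exists>N. negligible N \<and> (\<forall>t\<in>{t0..T} - N. norm (f t) \<le> L * (1 + R))"
      if "trajectory T p q j A L t0 x0 x f" for x f by (rule f_bound[OF that])
    show "\<exists>bx N. negligible N \<and> (\<forall>t\<in>{t0..T} - N. x t = j (bx t)) \<and>
         bx \<in> borel_measurable (lebesgue_on {t0..T}) \<and> (\<lambda>t. norm (bx t) powr p) integrable_on {t0..T} \<and>
         integral {t0..T} (\<lambda>t. norm (bx t) powr p) \<le> K"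
      if x: "trajectory T p q j A L t0 x0 x f" for x f
    proof -
      obtain bx N where bx: "negligible N" "\<forall>t\<in>{t0..T} - N. x t = j (bx t)"
        "bx \<in> borel_measurable (lebesgue_on {t0..T})" "(\<lambda>t. norm (bx t) powr p) integrable_on {t0..T}"
        "\<forall>b\<in>{t0..T}. (norm (x b))\<^sup>2 + 2 * c * integral {t0..b} (\<lambda>t. norm (bx t) powr p)
          \<le> (norm (x t0))\<^sup>2 + 2 * integral {t0..b} (\<lambda>s. f s \<bullet> x s)"
        using c(2)[OF x t0(1)] unfolding energy_version_def by blast
      obtain N' where N': "negligible N'" "\<forall>t\<in>{t0..T} - N'. norm (f t) \<le> L * (1 + R)" using f_bound[OF x] by blast
      have fi: "(\<lambda>s. f s \<bullet> x s) integrable_on {t0..T}"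
        using inner_absolutely_integrable[OF trajectory_rhs[OF x order_refl] paths_continuous[OF trajectory_path[OF x] t0(1)]]
        by (auto intro: set_lebesgue_integral_eq_integral)
      have "integral {t0..T} (\<lambda>s. f s \<bullet> x s) \<le> integral {t0..T} (\<lambda>s. L * (1 + R) * R)"
      proof (rule integral_le_off_negligible[OF fi _ N'(1)])
        fix s assume s: "s \<in> {t0..T} - N'"
        have "f s \<bullet> x s \<le> norm (f s) * norm (x s)" by (rule norm_cauchy_schwarz)
        also have "\<dots> \<le> (L * (1 + R)) * R" using s N'(2) R(2)[OF x] t0 LR by (intro mult_mono) auto
        finally show "f s \<bullet> x s \<le> L * (1 + R) * R" .
      qed auto
      moreover have "integral {t0..T} (\<lambda>s. k) = (T - t0) * k" for k :: real using t0 by simp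
      ultimately have "integral {t0..T} (\<lambda>s. f s \<bullet> x s) \<le> (T - t0) * (L * (1 + R) * R)" by (simp only:)
      moreover have "(norm (x t0))\<^sup>2 \<le> R\<^sup>2" using R(2)[OF x, of t0] t0 by (intro power_mono) auto
      moreover have "(norm (x T))\<^sup>2 + 2 * c * integral {t0..T} (\<lambda>t. norm (bx t) powr p)
          \<le> (norm (x t0))\<^sup>2 + 2 * integral {t0..T} (\<lambda>s. f s \<bullet> x s)" using bx(5) t0 by auto
      moreover have "0 \<le> (norm (x T))\<^sup>2" by simp
      ultimately have "integral {t0..T} (\<lambda>t. norm (bx t) powr p) * (2 * c) \<le> R\<^sup>2 + 2 * ((T - t0) * (L * (1 + R) * R))"
        by (simp only: mult.commute[of _ "2 * c"])
      then have "integral {t0..T} (\<lambda>t. norm (bx t) powr p) \<le> K" unfolding K_def using c(1) by (simp add: pos_le_divide_eq)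
      then show ?thesis using bx by blast
    qed
    show "(norm (x b - y b))\<^sup>2 \<le> (norm (x a - y a))\<^sup>2 + C * (b - a)"
      if x: "trajectory T p q j A L t0 x0 x f" and y: "trajectory T p q j A L t0 x0 y g"
        and ab: "t0 \<le> a" "a \<le> b" "b \<le> T" for x f y g a b
    proof -
      obtain N1 where N1: "negligible N1" "\<forall>t\<in>{t0..T} - N1. norm (f t) \<le> L * (1 + R)" using f_bound[OF x] by blast
      obtain N2 where N2: "negligible N2" "\<forall>t\<in>{t0..T} - N2. norm (g t) \<le> L * (1 + R)" using f_bound[OF y] by blast
      have "integral {a..b} (\<lambda>s. (f s - g s) \<bullet> (x s - y s)) \<le> integral {a..b} (\<lambda>s. 4 * (L * (1 + R) * R))"
      proof (rule integral_le_off_negligible[OF _ _ negligible_Un[OF N1(1) N2(1)]])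
        show "(\<lambda>s. (f s - g s) \<bullet> (x s - y s)) integrable_on {a..b}"
          using energy_difference(1)[OF x y t0(1) ab] by (rule set_lebesgue_integral_eq_integral)
        fix s assume s: "s \<in> {a..b} - (N1 \<union> N2)"
        have "norm (f s) \<le> L * (1 + R)" "norm (g s) \<le> L * (1 + R)" "norm (x s) \<le> R" "norm (y s) \<le> R"
          using N1(2) N2(2) R(2)[OF x] R(2)[OF y] s ab t0 by auto
        then have n: "norm (f s - g s) \<le> 2 * (L * (1 + R))" "norm (x s - y s) \<le> 2 * R"
          using norm_triangle_ineq4[of "f s" "g s"] norm_triangle_ineq4[of "x s" "y s"] by linarith+
        have "(f s - g s) \<bullet> (x s - y s) \<le> norm (f s - g s) * norm (x s - y s)" by (rule norm_cauchy_schwarz)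
        also have "\<dots> \<le> (2 * (L * (1 + R))) * (2 * R)" using n LR by (intro mult_mono) auto
        finally show "(f s - g s) \<bullet> (x s - y s) \<le> 4 * (L * (1 + R) * R)" by simp
      qed auto
      also have "\<dots> = (b - a) * (4 * (L * (1 + R) * R))" using ab by simp
      finally have "2 * integral {a..b} (\<lambda>s. (f s - g s) \<bullet> (x s - y s)) \<le> C * (b - a)"
        by (simp add: C_def algebra_simps)
      then show ?thesis using energy_difference(2)[OF x y t0(1) ab] by simp
    qed
  qed
qed

end

section \<open>Compactness of the trajectory sets\<close>

text \<open>Fatou's lemma provides a time at which infinitely many members of a sequence that is bounded
  in \<open>L\<^sup>1\<close> are bounded.\<close>

lemma frequently_bounded_time:
  fixes g :: "nat \<Rightarrow> real \<Rightarrow> real"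
  assumes ab: "a < b" and g: "\<And>n. g n \<in> borel_measurable (lebesgue_on {a..b})" "\<And>n t. 0 \<le> g n t"
    "\<And>n. g n integrable_on {a..b}" "\<And>n. integral {a..b} (g n) \<le> K" and N: "negligible N"
  obtains t R where "t \<in> {a..b} - N" "infinite {n. g n t \<le> R}"
proof -
  let ?M = "lebesgue_on {a..b}"
  have gi: "integrable ?M (g n)" for n
  proof -
    have "g n absolutely_integrable_on {a..b}"
      using g(2,3)[of n] by (simp add: absolutely_integrable_on_def)
    then show ?thesis by (simp add: absolutely_integrable_imp_integrable)
  qed
  have I: "(\<integral>\<^sup>+t. ennreal (g n t) \<partial>?M) \<le> ennreal K" for n
    using g(2,4) lebesgue_integral_eq_integral[OF gi[of n]] by (simp add: nn_integral_eq_integral[OF gi] ennreal_leI)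
  have "(\<integral>\<^sup>+t. liminf (\<lambda>n. ennreal (g n t)) \<partial>?M) \<le> liminf (\<lambda>n. \<integral>\<^sup>+t. ennreal (g n t) \<partial>?M)"
    by (rule nn_integral_liminf) (use g(1) in measurable)
  also have "\<dots> \<le> ennreal K" by (rule Liminf_le) (use I in auto)
  finally have "(\<integral>\<^sup>+t. liminf (\<lambda>n. ennreal (g n t)) \<partial>?M) \<noteq> \<infinity>"
    by (auto simp: top_unique)
  then have "AE t in ?M. liminf (\<lambda>n. ennreal (g n t)) \<noteq> \<infinity>"
    by (intro nn_integral_PInf_AE) (use g(1) in measurable)
  then have "AE t in lebesgue_on {a<..<b}. liminf (\<lambda>n. ennreal (g n t)) \<noteq> \<infinity>"
    by (auto simp: AE_restrict_space_iff elim!: eventually_mono)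
  then obtain N' where N': "negligible N'" "\<And>t. t \<in> {a..b} - N' \<Longrightarrow> liminf (\<lambda>n. ennreal (g n t)) \<noteq> \<infinity>"
    by (rule AE_lebesgue_on_imp_negligible) blast
  have "\<not> negligible {a..b}" using negligible_interval(1)[of a b, unfolded box_real] ab by simp
  then have "\<not> {a..b} \<subseteq> N \<union> N'" using negligible_subset[OF negligible_Un[OF N N'(1)]] by blast
  then obtain t where t: "t \<in> {a..b} - N" "t \<in> {a..b} - N'" by blast
  obtain r where r: "0 \<le> r" "liminf (\<lambda>n. ennreal (g n t)) = ennreal r"
    using N'(2)[OF t(2)] by (cases "liminf (\<lambda>n. ennreal (g n t))") auto
  have "infinite {n. g n t \<le> r + 1}"
  proof
    assume "finite {n. g n t \<le> r + 1}"
    then have "\<forall>\<^sub>F n in cofinite. \<not> g n t \<le> r + 1" by (simp add: eventually_cofinite)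
    then have "\<forall>\<^sub>F n in sequentially. \<not> g n t \<le> r + 1" by (simp add: cofinite_eq_sequentially)
    then have "\<forall>\<^sub>F n in sequentially. ennreal (r + 1) \<le> ennreal (g n t)"
      by (rule eventually_mono) (auto intro: ennreal_leI)
    then have "ennreal (r + 1) \<le> ennreal r" unfolding r(2)[symmetric] by (rule Liminf_bounded)
    then show False using r(1) by simp
  qed
  then show thesis using that t(1) by blast
qed

context evolution
begin

text \<open>At a time where infinitely many members of the sequence are bounded in \<open>V\<close>, the compact embedding
  yields a subsequence whose members are close to each other in \<open>H\<close>.\<close>

lemma common_clustering_time:
  assumes ab: "t0 \<le> a" "a < b" "b \<le> T" and e: "\<eta> > 0"
    and \<xi>: "\<And>n::nat. \<exists>bx N. negligible N \<and> (\<forall>t\<in>{t0..T} - N. \<xi> n t = j (bx t)) \<and>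
         bx \<in> borel_measurable (lebesgue_on {t0..T}) \<and> (\<lambda>t. norm (bx t) powr p) integrable_on {t0..T} \<and>
         integral {t0..T} (\<lambda>t. norm (bx t) powr p) \<le> K"
  obtains r :: "nat \<Rightarrow> nat" and t where "strict_mono r" "t \<in> {a..b}" "\<And>m n. norm (\<xi> (r m) t - \<xi> (r n) t) \<le> \<eta>"
proof -
  obtain bx N where bx: "\<And>n. negligible (N n)" "\<And>n t. t \<in> {t0..T} - N n \<Longrightarrow> \<xi> n t = j (bx n t)"
    "\<And>n. bx n \<in> borel_measurable (lebesgue_on {t0..T})" "\<And>n. (\<lambda>t. norm (bx n t) powr p) integrable_on {t0..T}"
    "\<And>n. integral {t0..T} (\<lambda>t. norm (bx n t) powr p) \<le> K"
    using \<xi> by metis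
  have sub: "{a..b} \<subseteq> {t0..T}" using ab by auto
  have N: "negligible (\<Union>n. N n)" by (rule negligible_countable_Union) (use bx(1) in auto)
  obtain t R where t: "t \<in> {a..b} - (\<Union>n. N n)" "infinite {n. norm (bx n t) powr p \<le> R}"
  proof (rule frequently_bounded_time[OF ab(2) _ _ _ _ N, of "\<lambda>n t. norm (bx n t) powr p" K])
    show "(\<lambda>t. norm (bx n t) powr p) \<in> borel_measurable (lebesgue_on {a..b})" for n
      using borel_measurable_lebesgue_on_mono[OF bx(3) sub] by measurable
    show i: "(\<lambda>t. norm (bx n t) powr p) integrable_on {a..b}" for n
      by (rule integrable_on_subinterval[OF bx(4) sub])
    show "integral {a..b} (\<lambda>t. norm (bx n t) powr p) \<le> K" for n
      using integral_subset_le[OF sub i bx(4)] bx(5)[of n] by (auto intro: order_trans)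
  qed auto
  define S where "S = {n. norm (bx n t) powr p \<le> R}"
  have "infinite S" using t(2) by (simp add: S_def)
  note r1 = strict_mono_enumerate[OF this] enumerate_in_set[OF this]
  define y where "y n = \<xi> (enumerate S n) t" for n
  have yC: "y n \<in> closure (blinfun_apply j ` cball 0 (1 + R))" for n
  proof -
    have "norm (bx (enumerate S n) t) \<le> 1 + R"
      using le_one_plus_powr[of "norm (bx (enumerate S n) t)" p] r1(2)[of n] p_ge by (simp add: S_def)
    moreover have "y n = j (bx (enumerate S n) t)" unfolding y_def using bx(2) t(1) sub by blast
    ultimately have "y n \<in> blinfun_apply j ` cball 0 (1 + R)" by simp
    then show ?thesis by (rule subsetD[OF closure_subset])
  qed
  have "compact (closure (blinfun_apply j ` cball 0 (1 + R)))"
    using embedding bounded_cball unfolding dense_compact_embedding_def by blast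
  then have "seq_compact (closure (blinfun_apply j ` cball 0 (1 + R)))" by (rule compact_imp_seq_compact)
  then obtain l and r2 :: "nat \<Rightarrow> nat" where l: "strict_mono r2" "(y \<circ> r2) \<longlonglongrightarrow> l"
    by (rule seq_compactE[where f=y]) (use yC in auto)
  obtain M where M: "\<And>n. n \<ge> M \<Longrightarrow> norm ((y \<circ> r2) n - l) < \<eta> / 2"
    using LIMSEQ_D[OF l(2), of "\<eta> / 2"] e by auto
  define r where "r n = enumerate S (r2 (M + n))" for n
  show thesis
  proof (rule that[of r t])
    show "strict_mono r" using r1(1) l(1) by (auto simp: r_def strict_mono_def)
    show "t \<in> {a..b}" using t by simp
    fix m n
    have "norm (\<xi> (r k) t - l) < \<eta> / 2" for k using M[of "M + k"] by (simp add: r_def y_def)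
    from this[of m] this[of n] show "norm (\<xi> (r m) t - \<xi> (r n) t) \<le> \<eta>"
      using norm_triangle_ineq4[of "\<xi> (r m) t - l" "\<xi> (r n) t - l"] by simp
  qed
qed

text \<open>Closeness at one time persists for a short while, since the squared distance grows at rate at most
  \<open>C\<close>. Every cell of a fine grid contains a clustering time, and closeness is passed on from cell to
  cell.\<close>

lemma trajectories_clustering:
  assumes L: "L \<ge> 0" and t0: "0 \<le> t0" "t0 < T" and x0: "x0 \<in> paths T" and e: "\<epsilon> > 0"
    and \<xi>: "\<And>n::nat. \<xi> n \<in> trajectories T p q j A L t0 x0"
  obtains r :: "nat \<Rightarrow> nat" where "strict_mono r" "\<And>m n t. t \<in> {0..T} \<Longrightarrow> norm (\<xi> (r m) t - \<xi> (r n) t) \<le> \<epsilon>"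
proof -
  obtain R C K where bounds: "C \<ge> 0"
    "\<And>x f. trajectory T p q j A L t0 x0 x f \<Longrightarrow>
       \<exists>bx N. negligible N \<and> (\<forall>t\<in>{t0..T} - N. x t = j (bx t)) \<and>
         bx \<in> borel_measurable (lebesgue_on {t0..T}) \<and> (\<lambda>t. norm (bx t) powr p) integrable_on {t0..T} \<and>
         integral {t0..T} (\<lambda>t. norm (bx t) powr p) \<le> K"
    "\<And>x f y g a b. trajectory T p q j A L t0 x0 x f \<Longrightarrow> trajectory T p q j A L t0 x0 y g \<Longrightarrow>
       t0 \<le> a \<Longrightarrow> a \<le> b \<Longrightarrow> b \<le> T \<Longrightarrow>
       (norm (x b - y b))\<^sup>2 \<le> (norm (x a - y a))\<^sup>2 + C * (b - a)"
    by (rule trajectory_bounds[OF L t0 x0]) blast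
  obtain f where f: "\<And>n. trajectory T p q j A L t0 x0 (\<xi> n) (f n)"
    using \<xi> unfolding trajectories_def by simp metis
  define D where "D m n t = (norm (\<xi> m t - \<xi> n t))\<^sup>2" for m n t
  have init: "D m n t = 0" if "t \<in> {0..t0}" for m n t
    using f[of m] f[of n] that by (simp add: trajectory_def D_def)
  have growth: "D m n b \<le> D m n a + C * (b - a)" if "t0 \<le> a" "a \<le> b" "b \<le> T" for m n a b
    unfolding D_def by (rule bounds(3)[OF f f that])
  obtain M :: nat where M: "real M > 4 * C * (T - t0) / \<epsilon>\<^sup>2" using reals_Archimedean2 by blast
  moreover have "0 \<le> 4 * C * (T - t0) / \<epsilon>\<^sup>2" using bounds(1) t0 by simp
  ultimately have "0 < real M" by linarith
  define \<delta> where "\<delta> = (T - t0) / real M"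
  have \<delta>: "\<delta> > 0" "real M * \<delta> = T - t0" using \<open>0 < real M\<close> t0 by (auto simp: \<delta>_def)
  have C\<delta>: "C * (2 * \<delta>) \<le> \<epsilon>\<^sup>2 / 2"
  proof -
    have "4 * C * (T - t0) < real M * \<epsilon>\<^sup>2" using M e by (simp add: divide_less_eq)
    then show ?thesis using \<open>0 < real M\<close> by (simp add: \<delta>_def field_simps)
  qed
  have "k \<le> M \<Longrightarrow> \<exists>r :: nat \<Rightarrow> nat. strict_mono r \<and> (\<forall>m n. \<forall>t\<in>{t0..t0 + real k * \<delta>}. D (r m) (r n) t \<le> \<epsilon>\<^sup>2)" for k
  proof (induction k)
    case 0
    show ?case by (rule exI[of _ id]) (use init[of t0] t0 in \<open>auto simp: strict_mono_def\<close>)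
  next
    case (Suc k)
    then obtain r :: "nat \<Rightarrow> nat" where r: "strict_mono r" "\<And>m n t. t \<in> {t0..t0 + real k * \<delta>} \<Longrightarrow> D (r m) (r n) t \<le> \<epsilon>\<^sup>2"
      by auto
    have kT: "t0 + real (Suc k) * \<delta> \<le> T"
      using mult_right_mono[of "real (Suc k)" "real M" \<delta>] Suc.prems \<delta> by simp
    show ?case
    proof (cases "k = 0")
      \<comment> \<open>In the first cell, the common initial value takes the role of a clustering time.\<close>
      case True
      have "D (r m) (r n) t \<le> \<epsilon>\<^sup>2" if t: "t \<in> {t0..t0 + real (Suc k) * \<delta>}" for m n t
      proof -
        have "D (r m) (r n) t \<le> D (r m) (r n) t0 + C * (t - t0)" by (rule growth) (use t kT in auto)
        also have "\<dots> \<le> 0 + C * (2 * \<delta>)"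
          using init[of t0] t0 t True \<delta> bounds(1) by (intro add_mono mult_left_mono) auto
        finally show ?thesis using C\<delta> zero_le_power2[of \<epsilon>] by linarith
      qed
      then show ?thesis using r(1) by blast
    next
      case False
      define a where "a = t0 + (real k - 1) * \<delta>"
      define b where "b = t0 + real k * \<delta>"
      have "b - a = \<delta>" by (simp add: a_def b_def left_diff_distrib)
      moreover have "0 \<le> (real k - 1) * \<delta>" using False \<delta> by (intro mult_nonneg_nonneg) auto
      moreover have "b \<le> T" using kT \<delta>(1) by (simp add: b_def distrib_right)
      ultimately have ab: "t0 \<le> a" "a < b" "b \<le> T" "b - a = \<delta>"
        using \<delta>(1) by (auto simp: a_def)
      obtain r' :: "nat \<Rightarrow> nat" and s where r': "strict_mono r'" "s \<in> {a..b}" "\<And>m n. norm (\<xi> (r (r' m)) s - \<xi> (r (r' n)) s) \<le> \<epsilon> / 2"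
        by (rule common_clustering_time[OF ab(1-3) half_gt_zero[OF e] bounds(2)[OF f], of "\<lambda>n. r n"]) blast
      have "D (r (r' m)) (r (r' n)) t \<le> \<epsilon>\<^sup>2" if t: "t \<in> {t0..t0 + real (Suc k) * \<delta>}" for m n t
      proof (cases "t \<le> b")
        case True
        then show ?thesis using r(2)[of t "r' m" "r' n"] t by (simp add: b_def)
      next
        case False
        have "D (r (r' m)) (r (r' n)) t \<le> D (r (r' m)) (r (r' n)) s + C * (t - s)"
          by (rule growth) (use False r'(2) ab t kT in auto)
        also have "D (r (r' m)) (r (r' n)) s \<le> (\<epsilon> / 2)\<^sup>2"
          unfolding D_def by (rule power_mono[OF r'(3)]) simp
        also have "C * (t - s) \<le> C * (2 * \<delta>)"
          using t r'(2) ab(4) bounds(1) by (intro mult_left_mono) (auto simp: b_def algebra_simps)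
        finally have "D (r (r' m)) (r (r' n)) t \<le> (\<epsilon> / 2)\<^sup>2 + C * (2 * \<delta>)" by simp
        moreover have "(\<epsilon> / 2)\<^sup>2 = \<epsilon>\<^sup>2 / 4" by (simp add: power_divide)
        ultimately show ?thesis using C\<delta> zero_le_power2[of \<epsilon>] by linarith
      qed
      moreover have "strict_mono (r \<circ> r')" using r(1) r'(1) by (rule strict_mono_o)
      ultimately show ?thesis by (intro exI[of _ "r \<circ> r'"]) (auto simp: o_def)
    qed
  qed
  then obtain r :: "nat \<Rightarrow> nat" where r: "strict_mono r" "\<And>m n t. t \<in> {t0..t0 + real M * \<delta>} \<Longrightarrow> D (r m) (r n) t \<le> \<epsilon>\<^sup>2" by blast
  have "norm (\<xi> (r m) t - \<xi> (r n) t) \<le> \<epsilon>" if t: "t \<in> {0..T}" for m n t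
  proof -
    have "D (r m) (r n) t \<le> \<epsilon>\<^sup>2"
      using init[of t "r m" "r n"] r(2)[of t m n] t \<delta>(2) by (cases "t \<le> t0") auto
    then show ?thesis unfolding D_def by (rule power2_le_imp_le) (use e in simp)
  qed
  then show thesis using that r(1) by blast
qed

text \<open>Relative sequential compactness, by a diagonal argument. The limit is not claimed to be a
  trajectory.\<close>

lemma trajectories_seq_compact:
  assumes L: "L \<ge> 0" and t0: "0 \<le> t0" "t0 < T" and x0: "x0 \<in> paths T"
    and \<xi>: "\<And>n::nat. \<xi> n \<in> trajectories T p q j A L t0 x0"
  obtains r :: "nat \<Rightarrow> nat" and x where "strict_mono r" "x \<in> paths T" "uniform_limit {0..T} (\<lambda>n. \<xi> (r n)) x sequentially"
proof -
  interpret subseqs "\<lambda>n s. \<forall>m m'. \<forall>t\<in>{0..T}. norm (\<xi> (s m) t - \<xi> (s m') t) \<le> inverse (real (Suc n))"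
  proof
    fix n and s :: "nat \<Rightarrow> nat" assume "strict_mono s"
    obtain r' :: "nat \<Rightarrow> nat" where "strict_mono r'" "\<And>m m' t. t \<in> {0..T} \<Longrightarrow> norm (\<xi> (s (r' m)) t - \<xi> (s (r' m')) t) \<le> inverse (real (Suc n))"
      by (rule trajectories_clustering[OF L t0 x0, of "inverse (real (Suc n))" "\<lambda>n. \<xi> (s n)"]) (use \<xi> in auto)
    then show "\<exists>r' :: nat \<Rightarrow> nat. strict_mono r' \<and> (\<forall>m m'. \<forall>t\<in>{0..T}. norm (\<xi> ((s \<circ> r') m) t - \<xi> ((s \<circ> r') m') t) \<le> inverse (real (Suc n)))"
      by (intro exI[of _ r']) simp
  qed
  have d: "norm (\<xi> (diagseq (Suc k + m)) t - \<xi> (diagseq (Suc k + m')) t) \<le> inverse (real (Suc k))"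
    if "t \<in> {0..T}" for k m m' t
    using diagseq_holds[of k] that by auto
  have "uniformly_Cauchy_on {0..T} (\<lambda>n. \<xi> (diagseq n))"
    unfolding uniformly_Cauchy_on_def
  proof (intro allI impI)
    fix e :: real assume "e > 0"
    then obtain k where k: "inverse (real (Suc k)) < e" using reals_Archimedean by blast
    show "\<exists>M. \<forall>t\<in>{0..T}. \<forall>m\<ge>M. \<forall>n\<ge>M. dist (\<xi> (diagseq m) t) (\<xi> (diagseq n) t) < e"
    proof (intro exI[of _ "Suc k"] ballI allI impI)
      fix t m n assume "t \<in> {0..T}" "Suc k \<le> m" "Suc k \<le> n"
      then show "dist (\<xi> (diagseq m) t) (\<xi> (diagseq n) t) < e"
        using d[of t k "m - Suc k" "n - Suc k"] k by (simp add: dist_norm)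
    qed
  qed
  then obtain l where l: "uniform_limit {0..T} (\<lambda>n. \<xi> (diagseq n)) l sequentially"
    using uniformly_convergent_eq_Cauchy unfolding uniformly_convergent_on_def by blast
  have \<xi>p: "\<xi> n \<in> paths T" for n using \<xi>[of n] by (auto simp: trajectories_def trajectory_def)
  have lc: "continuous_on {0..T} l"
    by (rule uniform_limit_theorem[OF _ l]) (use \<xi>p in \<open>auto simp: paths_iff\<close>)
  show thesis
  proof (rule that[of diagseq "restrict l {0..T}"])
    show "strict_mono diagseq" by (rule subseq_diagseq)
    show "restrict l {0..T} \<in> paths T" using continuous_on_eq[OF lc, of "restrict l {0..T}"] by (simp add: paths_iff)
    show "uniform_limit {0..T} (\<lambda>n. \<xi> (diagseq n)) (restrict l {0..T}) sequentially"
      using l by (simp add: uniform_limit_iff cong: ball_cong_simp)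
  qed
qed

end

section \<open>Concatenation of trajectories\<close>

lemma Lp_on_subinterval:
  assumes g: "Lp_on r a b g" and "a \<le> c" "d \<le> b"
  shows "Lp_on r c d g"
proof -
  have "g \<in> borel_measurable (lebesgue_on {c<..<d})"
    by (rule borel_measurable_lebesgue_on_mono[of g "{a<..<b}"]) (use g assms in \<open>auto simp: Lp_on_def\<close>)
  moreover have "(\<lambda>t. norm (g t) powr r) absolutely_integrable_on {c..d}"
    using integrable_on_subinterval[OF Lp_on_Icc(2)[OF g], of c d] assms by (auto simp: absolutely_integrable_on_def)
  ultimately show ?thesis
    unfolding Lp_on_def by (simp add: absolutely_integrable_imp_integrable absolutely_integrable_on_Icc_iff_Ioo)
qed

lemma Lp_on_concat:
  fixes g1 g2 :: "real \<Rightarrow> 'a::real_normed_vector"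
  assumes g1: "Lp_on r a b g1" and g2: "Lp_on r b c g2" and abc: "a \<le> b" "b \<le> c"
  shows "Lp_on r a c (\<lambda>t. if t < b then g1 t else g2 t)"
proof -
  let ?g = "\<lambda>t. if t < b then g1 t else g2 t"
  have "?g \<in> borel_measurable (lebesgue_on {a<..<c})"
  proof (rule borel_measurableI)
    fix S :: "'a set" assume S: "open S"
    have "g1 -` S \<inter> {a<..<b} \<in> sets lebesgue"
      using measurable_sets[of g1 "lebesgue_on {a<..<b}" borel S] g1 S by (simp add: Lp_on_def sets_restrict_space_iff)
    moreover have "g2 -` S \<inter> {b<..<c} \<in> sets lebesgue"
      using measurable_sets[of g2 "lebesgue_on {b<..<c}" borel S] g2 S by (simp add: Lp_on_def sets_restrict_space_iff)
    moreover have "?g -` S \<inter> {b} \<inter> {a<..<c} \<in> sets lebesgue"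
      by (rule negligible_imp_sets, rule negligible_subset[of "{b}"]) auto
    ultimately have "(g1 -` S \<inter> {a<..<b} \<union> g2 -` S \<inter> {b<..<c}) \<union> ?g -` S \<inter> {b} \<inter> {a<..<c} \<in> sets lebesgue"
      by (intro sets.Un)
    also have "(g1 -` S \<inter> {a<..<b} \<union> g2 -` S \<inter> {b<..<c}) \<union> ?g -` S \<inter> {b} \<inter> {a<..<c} = ?g -` S \<inter> {a<..<c}"
    proof (rule set_eqI)
      show "t \<in> (g1 -` S \<inter> {a<..<b} \<union> g2 -` S \<inter> {b<..<c}) \<union> ?g -` S \<inter> {b} \<inter> {a<..<c} \<longleftrightarrow> t \<in> ?g -` S \<inter> {a<..<c}" for t
        using abc by (cases t b rule: linorder_cases) simp_all
    qed
    finally show "?g -` S \<inter> space (lebesgue_on {a<..<c}) \<in> sets (lebesgue_on {a<..<c})"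
      by (simp add: sets_restrict_space_iff)
  qed
  moreover have "(\<lambda>t. norm (?g t) powr r) absolutely_integrable_on {a..c}"
  proof -
    have "(\<lambda>t. norm (?g t) powr r) integrable_on {a..b}"
      by (rule integrable_spike[OF Lp_on_Icc(2)[OF g1] negligible_sing[of b]]) auto
    moreover have "(\<lambda>t. norm (?g t) powr r) integrable_on {b..c}"
      by (rule integrable_eq[OF Lp_on_Icc(2)[OF g2]]) auto
    ultimately have "(\<lambda>t. norm (?g t) powr r) integrable_on {a..c}"
      by (rule Henstock_Kurzweil_Integration.integrable_combine[OF abc])
    then show ?thesis by (simp add: absolutely_integrable_on_def)
  qed
  ultimately show ?thesis
    unfolding Lp_on_def by (simp add: absolutely_integrable_imp_integrable absolutely_integrable_on_Icc_iff_Ioo)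
qed

context evolution
begin

text \<open>The characterization of generalized derivatives by increments shows that the pieces match at
  \<open>t1\<close>, where the paths agree.\<close>

lemma trajectory_concat:
  assumes x: "trajectory T p q j A L t0 x0 x f" and y: "trajectory T p q j A L t1 x y g"
    and t01: "0 \<le> t0" "t0 \<le> t1" "t1 < T"
  shows "trajectory T p q j A L t0 x0 y (\<lambda>t. if t < t1 then f t else g t)"
proof -
  obtain bx bx' N1 where bx: "negligible N1" "Lp_on p t0 T bx" "Lp_on q t0 T bx'"
    "\<And>t. t \<in> {t0..T} - N1 \<Longrightarrow> x t = j (bx t)"
    "\<And>t. t \<in> {t0..T} - N1 \<Longrightarrow> bx' t + A t (bx t) = to_dual j (f t)"
    "\<And>t. t \<in> {t0..T} - N1 \<Longrightarrow> norm (f t) \<le> L * (1 + (SUP s\<in>{0..t}. norm (x s)))"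
    "\<And>v s t. t0 \<le> s \<Longrightarrow> s \<le> t \<Longrightarrow> t \<le> T \<Longrightarrow> ((\<lambda>r. blinfun_apply (bx' r) v) has_integral ((x t - x s) \<bullet> j v)) {s..t}"
    by (rule trajectory_data[OF x t01(1)]) blast
  have t1: "0 \<le> t1" using t01 by simp
  obtain vy vy' N2 where yx: "negligible N2" "Lp_on p t1 T vy" "Lp_on q t1 T vy'"
    "\<And>t. t \<in> {t1..T} - N2 \<Longrightarrow> y t = j (vy t)"
    "\<And>t. t \<in> {t1..T} - N2 \<Longrightarrow> vy' t + A t (vy t) = to_dual j (g t)"
    "\<And>t. t \<in> {t1..T} - N2 \<Longrightarrow> norm (g t) \<le> L * (1 + (SUP s\<in>{0..t}. norm (y s)))"
    "\<And>v s t. t1 \<le> s \<Longrightarrow> s \<le> t \<Longrightarrow> t \<le> T \<Longrightarrow> ((\<lambda>r. blinfun_apply (vy' r) v) has_integral ((y t - y s) \<bullet> j v)) {s..t}"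
    by (rule trajectory_data[OF y t1]) blast
  have yp: "y \<in> paths T" by (rule trajectory_path[OF y])
  have y_x: "y t = x t" if "t \<in> {0..t1}" for t using y that by (simp add: trajectory_def)
  have x_x0: "x t = x0 t" if "t \<in> {0..t0}" for t using x that by (simp add: trajectory_def)
  let ?z = "\<lambda>t. if t < t1 then bx t else vy t" and ?z' = "\<lambda>t. if t < t1 then bx' t else vy' t"
    and ?h = "\<lambda>t. if t < t1 then f t else g t"
  define N where "N = N1 \<union> N2"
  have N: "negligible N" unfolding N_def using bx(1) yx(1) by (rule negligible_Un)
  have Lp: "Lp_on p t0 T ?z" "Lp_on q t0 T ?z'" "Lp_on 2 t0 T ?h"
  proof -
    have f: "Lp_on 2 t0 T f" and g: "Lp_on 2 t1 T g" using x y by (simp_all add: trajectory_def)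
    have le: "t1 \<le> T" using t01 by simp
    note sub = Lp_on_subinterval[OF _ order_refl le]
    show "Lp_on p t0 T ?z" by (rule Lp_on_concat[OF sub[OF bx(2)] yx(2) t01(2) le])
    show "Lp_on q t0 T ?z'" by (rule Lp_on_concat[OF sub[OF bx(3)] yx(3) t01(2) le])
    show "Lp_on 2 t0 T ?h" by (rule Lp_on_concat[OF sub[OF f] g t01(2) le])
  qed
  have yz: "y t = j (?z t)" if "t \<in> {t0..T} - N" for t
    using that bx(4)[of t] yx(4)[of t] y_x[of t] t01 by (auto simp: N_def)
  have d: "((\<lambda>r. blinfun_apply (?z' r) v) has_integral ((y t - y s) \<bullet> j v)) {s..t}"
    if st: "t0 \<le> s" "s \<le> t" "t \<le> T" for v s t
  proof -
    have left: "((\<lambda>r. blinfun_apply (?z' r) v) has_integral ((y t - y s) \<bullet> j v)) {s..t}"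
      if "t0 \<le> s" "s \<le> t" "t \<le> t1" for s t
    proof -
      have "((\<lambda>r. blinfun_apply (bx' r) v) has_integral ((x t - x s) \<bullet> j v)) {s..t}"
        by (rule bx(7)) (use that t01 in auto)
      then have "((\<lambda>r. blinfun_apply (?z' r) v) has_integral ((x t - x s) \<bullet> j v)) {s..t}"
        by (rule has_integral_spike[OF negligible_sing[of t1], rotated]) (use that in auto)
      then show ?thesis using y_x[of s] y_x[of t] that t01 by simp
    qed
    have right: "((\<lambda>r. blinfun_apply (?z' r) v) has_integral ((y t - y s) \<bullet> j v)) {s..t}"
      if "t1 \<le> s" "s \<le> t" "t \<le> T" for s t
      by (rule has_integral_eq[OF _ yx(7)[OF that, of v]]) (use that in auto)
    consider "t \<le> t1" | "t1 \<le> s" | "s \<le> t1" "t1 \<le> t" using st by linarith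
    then show ?thesis
    proof cases
      case 1
      show ?thesis by (rule left) (use 1 st in auto)
    next
      case 2
      show ?thesis by (rule right) (use 2 st in auto)
    next
      case 3
      have "((\<lambda>r. blinfun_apply (?z' r) v) has_integral ((y t1 - y s) \<bullet> j v + (y t - y t1) \<bullet> j v)) {s..t}"
        by (rule has_integral_combine[OF 3 left right]) (use 3 st in auto)
      then show ?thesis by (simp add: inner_diff_left)
    qed
  qed
  have gd: "generalized_derivative j t0 T ?z ?z'"
    by (rule integral_imp_generalized_derivative[OF _ _ Lp(2) _ N yz d])
      (use t01 q_gt paths_continuous[OF yp t01(1)] in auto)
  have eqn: "?z' t + A t (?z t) = to_dual j (?h t)" if "t \<in> {t0..T} - N" for t
    using that bx(5)[of t] yx(5)[of t] by (auto simp: N_def)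
  have bound: "norm (?h t) \<le> L * (1 + (SUP s\<in>{0..t}. norm (y s)))" if t: "t \<in> {t0..T} - N" for t
  proof (cases "t < t1")
    case True
    then have "(SUP s\<in>{0..t}. norm (y s)) = (SUP s\<in>{0..t}. norm (x s))" by (intro SUP_cong) (auto simp: y_x)
    then show ?thesis using bx(6)[of t] t True by (simp add: N_def)
  qed (use yx(6)[of t] t in \<open>auto simp: N_def\<close>)
  have AE: "AE t in lebesgue_on {t0<..<T}. P t" if "\<And>t. t \<in> {t0..T} - N \<Longrightarrow> P t" for P
  proof (rule negligible_imp_AE_lebesgue_on[OF N])
    fix t assume "t \<in> {t0<..<T} - N"
    then show "P t" by (intro that) auto
  qed simp
  show ?thesis
    unfolding trajectory_def
  proof (intro conjI exI[of _ ?z] exI[of _ ?z'])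
    show "\<forall>t\<in>{0..t0}. y t = x0 t" using y_x x_x0 t01 by auto
    show "W_pq j p q t0 T ?z ?z'" using Lp gd by (simp add: W_pq_def)
    show "AE t in lebesgue_on {t0<..<T}. y t = j (?z t)" by (rule AE, rule yz)
    show "AE t in lebesgue_on {t0<..<T}. ?z' t + A t (?z t) = to_dual j (?h t)" by (rule AE, rule eqn)
    show "AE t in lebesgue_on {t0<..<T}. norm (?h t) \<le> L * (1 + (SUP s\<in>{0..t}. norm (y s)))"
      by (rule AE, rule bound)
  qed (fact yp Lp)+
qed

end

section \<open>The data along trajectories\<close>

lemma path_uniformly_continuous:
  assumes "x \<in> paths T" "e > 0"
  obtains d where "d > 0" "\<And>s t. s \<in> {0..T} \<Longrightarrow> t \<in> {0..T} \<Longrightarrow> \<bar>s - t\<bar> < d \<Longrightarrow> norm (x s - x t) < e"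
proof -
  have "uniformly_continuous_on {0..T} x"
    using assms(1) by (intro compact_uniformly_continuous) (auto simp: paths_iff)
  then obtain d where "d > 0" "\<forall>s\<in>{0..T}. \<forall>t\<in>{0..T}. dist t s < d \<longrightarrow> dist (x t) (x s) < e"
    using assms(2) unfolding uniformly_continuous_on_def by blast
  then show thesis using that[of d] by (auto simp: dist_norm dist_real_def)
qed

lemma d_inf_le:
  assumes "0 \<le> T" "\<And>r. r \<in> {0..T} \<Longrightarrow> norm (x (min r t) - y (min r s)) \<le> e"
  shows "d_inf T t x s y \<le> \<bar>t - s\<bar> + e"
proof -
  have "(SUP r\<in>{0..T}. norm (x (min r t) - y (min r s))) \<le> e"
    by (rule cSUP_least) (use assms in auto)
  then show ?thesis by (simp add: d_inf_def)
qed

lemma d_inf_eq_path: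
  assumes "t \<in> {0..T}" "\<And>s. s \<in> {0..t} \<Longrightarrow> x s = y s"
  shows "d_inf T t x t y \<le> 0"
  using d_inf_le[of T x t y t 0] assms by (auto simp: min_def)

text \<open>Convergence of times and uniform convergence of paths imply convergence in the pseudo-metric.\<close>

lemma d_inf_tendsto:
  fixes xs :: "nat \<Rightarrow> real \<Rightarrow> 'h::real_normed_vector"
  assumes T: "0 \<le> T" and t: "t \<in> {0..T}" "\<And>n. ts n \<in> {0..T}" "ts \<longlonglongrightarrow> t"
    and x: "x \<in> paths T" "uniform_limit {0..T} xs x sequentially" and d: "d > 0"
  shows "\<forall>\<^sub>F n in sequentially. d_inf T t x (ts n) (xs n) < d"
proof -
  obtain c where c: "c > 0" "\<And>s t. s \<in> {0..T} \<Longrightarrow> t \<in> {0..T} \<Longrightarrow> \<bar>s - t\<bar> < c \<Longrightarrow> norm (x s - x t) < d / 4"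
    by (rule path_uniformly_continuous[OF x(1), of "d / 4"]) (use d in auto)
  have "\<forall>\<^sub>F n in sequentially. \<bar>ts n - t\<bar> < min c (d / 4)"
    using tendstoD[OF t(3), of "min c (d / 4)"] c d by (simp add: dist_real_def)
  moreover have "\<forall>\<^sub>F n in sequentially. \<forall>s\<in>{0..T}. dist (xs n s) (x s) < d / 4"
    using x(2) d unfolding uniform_limit_iff by (meson divide_pos_pos zero_less_numeral)
  ultimately show ?thesis
  proof eventually_elim
    case (elim n)
    have "norm (x (min r t) - xs n (min r (ts n))) \<le> d / 4 + d / 4" if r: "r \<in> {0..T}" for r
    proof -
      have m: "min r t \<in> {0..T}" "min r (ts n) \<in> {0..T}" using r t(1) t(2)[of n] by auto
      have "\<bar>min r t - min r (ts n)\<bar> < c" 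
      proof -
        have "\<bar>min r t - min r (ts n)\<bar> \<le> \<bar>ts n - t\<bar>" unfolding min_def by (auto simp: abs_minus_commute)
        moreover have "\<bar>ts n - t\<bar> < c" using elim(1) by simp
        ultimately show ?thesis by simp
      qed
      then have "norm (x (min r t) - x (min r (ts n))) < d / 4" by (rule c(2)[OF m])
      moreover have "norm (x (min r (ts n)) - xs n (min r (ts n))) < d / 4"
        using elim(2) m(2) by (simp add: dist_norm norm_minus_commute)
      ultimately show ?thesis
        using norm_triangle_ineq[of "x (min r t) - x (min r (ts n))" "x (min r (ts n)) - xs n (min r (ts n))"] by simp
    qed
    then have "d_inf T t x (ts n) (xs n) \<le> \<bar>t - ts n\<bar> + (d / 4 + d / 4)" by (rule d_inf_le[OF T])
    then show ?case using elim(1) by linarith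
  qed
qed

text \<open>Semicontinuity with respect to the pseudo-metric includes dependence on the past only.\<close>

lemma usc_on_nonanticipating:
  assumes "usc_on T \<Omega> u" "t \<in> {0..T}" "x \<in> \<Omega>" "y \<in> \<Omega>" "\<And>s. s \<in> {0..t} \<Longrightarrow> x s = y s"
  shows "u t x = u t y"
proof -
  have le: "u t y \<le> u t x" if xy: "x \<in> \<Omega>" "y \<in> \<Omega>" "\<And>s. s \<in> {0..t} \<Longrightarrow> x s = y s" for x y
  proof (rule field_le_epsilon)
    fix e :: real assume "e > 0"
    obtain d where "d > 0" "\<And>s y. s \<in> {0..T} \<Longrightarrow> y \<in> \<Omega> \<Longrightarrow> d_inf T t x s y < d \<Longrightarrow> u s y < u t x + e"
      using assms(1)[unfolded usc_on_def, rule_format, OF assms(2) xy(1) \<open>e > 0\<close>] by blast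
    moreover have "d_inf T t x t y \<le> 0" by (rule d_inf_eq_path[OF assms(2)]) (rule xy(3))
    ultimately have "u t y < u t x + e" using assms(2) xy(2) by simp
    then show "u t y \<le> u t x + e" by simp
  qed
  show ?thesis
  proof (rule antisym)
    show "u t x \<le> u t y" by (rule le[OF assms(4,3)]) (rule assms(5)[symmetric])
    show "u t y \<le> u t x" by (rule le[OF assms(3,4)]) (rule assms(5))
  qed
qed

lemma lsc_on_nonanticipating:
  assumes "lsc_on T \<Omega> u" "t \<in> {0..T}" "x \<in> \<Omega>" "y \<in> \<Omega>" "\<And>s. s \<in> {0..t} \<Longrightarrow> x s = y s"
  shows "u t x = u t y"
proof -
  have "usc_on T \<Omega> (\<lambda>t x. - u t x)"
  proof -
    have "- b < - a + e \<longleftrightarrow> b > a - e" for a b e :: real by auto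
    then show ?thesis using assms(1) unfolding usc_on_def lsc_on_def by (simp only:)
  qed
  from usc_on_nonanticipating[OF this assms(2-5)] show ?thesis by simp
qed

text \<open>The data of the terminal-value problem.\<close>

locale hamiltonian = evolution T p q j A
  for T p q :: real
    and j :: "'v::{banach, second_countable_topology} \<Rightarrow>\<^sub>L
              'h::{real_inner, complete_space, second_countable_topology}"
    and A :: "real \<Rightarrow> 'v \<Rightarrow> ('v \<Rightarrow>\<^sub>L real)" +
  fixes F :: "real \<Rightarrow> (real \<Rightarrow> 'h) \<Rightarrow> 'h \<Rightarrow> real" and h :: "(real \<Rightarrow> 'h) \<Rightarrow> real" and L :: real
  assumes F: "admissible_hamiltonian T p q j A F"
    and h: "continuous_map (mtopology_of (path_metric T)) euclideanreal h"
    and L: "L \<ge> 0"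
begin

lemma F_tendsto:
  assumes t: "t \<in> {0..T}" "\<And>n. ts n \<in> {0..T}" "ts \<longlonglongrightarrow> t"
    and x: "x \<in> paths T" "\<And>n. xs n \<in> paths T" "uniform_limit {0..T} xs x sequentially"
  shows "(\<lambda>n. F (ts n) (xs n) z) \<longlonglongrightarrow> F t x z"
proof (rule tendstoI)
  fix e :: real assume "e > 0"
  have "\<forall>t\<in>{0..T}. \<forall>x\<in>paths T. \<forall>z. \<forall>e>0. \<exists>d>0. \<forall>s\<in>{0..T}. \<forall>y\<in>paths T. \<forall>w.
        d_inf T t x s y < d \<and> norm (z - w) < d \<longrightarrow> \<bar>F t x z - F s y w\<bar> < e"
    using F unfolding admissible_hamiltonian_def by (rule conjunct1)
  from bspec[OF bspec[OF this t(1)] x(1), rule_format, OF \<open>e > 0\<close>, of z]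
  obtain d where d: "d > 0" "\<And>s y w. s \<in> {0..T} \<Longrightarrow> y \<in> paths T \<Longrightarrow> d_inf T t x s y < d \<Longrightarrow> norm (z - w) < d \<Longrightarrow> \<bar>F t x z - F s y w\<bar> < e"
    by blast
  have "\<forall>\<^sub>F n in sequentially. d_inf T t x (ts n) (xs n) < d"
    by (rule d_inf_tendsto[OF less_imp_le[OF T_pos] t x(1,3) d(1)])
  then show "\<forall>\<^sub>F n in sequentially. dist (F (ts n) (xs n) z) (F t x z) < e"
    by (rule eventually_mono) (use d(2)[OF t(2) x(2), of _ _ z] d(1) in \<open>auto simp: dist_real_def abs_minus_commute\<close>)
qed

lemma F_continuous:
  assumes x: "x \<in> paths T"
  shows "continuous_on {0..T} (\<lambda>s. F s x z)"
proof (rule continuous_on_sequentiallyI)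
  fix ts t assume "\<forall>n. ts n \<in> {0..T}" "t \<in> {0..T}" "ts \<longlonglongrightarrow> t"
  then show "(\<lambda>n. F (ts n) x z) \<longlonglongrightarrow> F t x z"
    by (intro F_tendsto x) (auto intro: uniform_limit_const)
qed

lemma F_Lipschitz:
  obtains L0 where "L0 \<ge> 0"
    "\<And>t x z w R. t \<in> {0..T} \<Longrightarrow> x \<in> paths T \<Longrightarrow> (\<And>s. s \<in> {0..t} \<Longrightarrow> norm (x s) \<le> R) \<Longrightarrow>
      \<bar>F t x z - F t x w\<bar> \<le> L0 * (1 + R) * norm (z - w)"
proof -
  obtain L0 where L0: "L0 \<ge> 0" "\<forall>t\<in>{0..T}. \<forall>x\<in>paths T. \<forall>z w.
        \<bar>F t x z - F t x w\<bar> \<le> L0 * (1 + (SUP s\<in>{0..t}. norm (x s))) * norm (z - w)"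
    using F unfolding admissible_hamiltonian_def by blast
  show thesis
  proof (rule that[OF L0(1)])
    fix t R and x :: "real \<Rightarrow> 'h" and z w :: 'h assume a: "t \<in> {0..T}" "x \<in> paths T" "\<And>s. s \<in> {0..t} \<Longrightarrow> norm (x s) \<le> R"
    have "(SUP s\<in>{0..t}. norm (x s)) \<le> R" by (rule cSUP_least) (use a in auto)
    then have "L0 * (1 + (SUP s\<in>{0..t}. norm (x s))) * norm (z - w) \<le> L0 * (1 + R) * norm (z - w)"
      using L0(1) by (intro mult_right_mono mult_left_mono) auto
    then show "\<bar>F t x z - F t x w\<bar> \<le> L0 * (1 + R) * norm (z - w)"
      using L0(2) a(1,2) by (meson order_trans)
  qed
qed

lemma h_tendsto:
  assumes x: "x \<in> paths T" "\<And>n. xs n \<in> paths T" "uniform_limit {0..T} xs x sequentially"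
  shows "(\<lambda>n. h (xs n)) \<longlonglongrightarrow> h x"
proof -
  interpret P: Metric_space "mspace (path_metric T :: (real \<Rightarrow> 'h) metric)" "mdist (path_metric T)"
    by (rule Metric_space_mspace_mdist)
  have "limitin (mtopology_of (path_metric T)) xs x sequentially"
    unfolding mtopology_of_def P.limit_metric_sequentially
  proof (intro conjI allI impI)
    show "x \<in> mspace (path_metric T)" using x(1) by (simp add: paths_def)
    fix e :: real assume e: "e > 0"
    then have "\<forall>\<^sub>F n in sequentially. \<forall>s\<in>{0..T}. dist (xs n s) (x s) < e / 2"
      using x(3) unfolding uniform_limit_iff by (meson half_gt_zero)
    then obtain N where N: "\<And>n s. n \<ge> N \<Longrightarrow> s \<in> {0..T} \<Longrightarrow> dist (xs n s) (x s) < e / 2"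
      unfolding eventually_sequentially by blast
    show "\<exists>N. \<forall>n\<ge>N. xs n \<in> mspace (path_metric T) \<and> mdist (path_metric T) (xs n) x < e"
    proof (intro exI[of _ N] allI impI conjI)
      fix n assume n: "N \<le> n"
      show "xs n \<in> mspace (path_metric T)" using x(2) by (simp add: paths_def)
      have "(SUP r\<in>{0..T}. norm (xs n r - x r)) \<le> e / 2"
        by (rule cSUP_least) (use N[OF n] T_pos in \<open>auto simp: dist_norm intro: less_imp_le\<close>)
      then show "mdist (path_metric T) (xs n) x < e"
        using mdist_path_metric[OF less_imp_le[OF T_pos] x(2) x(1), of n] e by simp
    qed
  qed
  from continuous_map_limit[OF h this] show ?thesis by (simp add: o_def)
qed

lemma trajectories_paths: "x \<in> trajectories T p q j A L t0 x0 \<Longrightarrow> x \<in> paths T"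
  by (auto simp: trajectories_def trajectory_def)

text \<open>This and the next three lemmas hold uniformly on the set of trajectories because it is relatively
  compact.\<close>

lemma h_bounded:
  assumes t0: "0 \<le> t0" "t0 < T" and x0: "x0 \<in> paths T"
  obtains B where "\<And>x. x \<in> trajectories T p q j A L t0 x0 \<Longrightarrow> \<bar>h x\<bar> \<le> B"
proof (rule ccontr)
  assume "\<not> thesis"
  then have "\<exists>x. x \<in> trajectories T p q j A L t0 x0 \<and> \<bar>h x\<bar> > real n" for n
    using that[of "real n"] by (meson not_le)
  then obtain \<xi> where \<xi>: "\<And>n. \<xi> n \<in> trajectories T p q j A L t0 x0" "\<And>n. \<bar>h (\<xi> n)\<bar> > real n" by metis
  obtain r :: "nat \<Rightarrow> nat" and x where r: "strict_mono r" "x \<in> paths T" "uniform_limit {0..T} (\<lambda>n. \<xi> (r n)) x sequentially"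
    by (rule trajectories_seq_compact[where \<xi>=\<xi>, OF L t0 x0 \<xi>(1)]) blast
  have "(\<lambda>n. h (\<xi> (r n))) \<longlonglongrightarrow> h x" by (rule h_tendsto[OF r(2) trajectories_paths[OF \<xi>(1)] r(3)])
  then have "Bseq (\<lambda>n. h (\<xi> (r n)))" by (intro convergent_imp_Bseq convergentI)
  then obtain K where K: "\<And>n. \<bar>h (\<xi> (r n))\<bar> \<le> K" unfolding Bseq_def by auto
  obtain n :: nat where "K < real n" using reals_Archimedean2 by blast
  then show False using K[of n] \<xi>(2)[of "r n"] seq_suble[OF r(1), of n] by simp
qed

lemma F_bounded:
  assumes t0: "0 \<le> t0" "t0 < T" and x0: "x0 \<in> paths T"
  obtains B where "\<And>x t. x \<in> trajectories T p q j A L t0 x0 \<Longrightarrow> t \<in> {0..T} \<Longrightarrow> \<bar>F t x z\<bar> \<le> B"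
proof (rule ccontr)
  assume "\<not> thesis"
  then have "\<exists>x t. x \<in> trajectories T p q j A L t0 x0 \<and> t \<in> {0..T} \<and> \<bar>F t x z\<bar> > real n" for n
    using that[of "real n"] by (meson not_le)
  then obtain \<xi> ts where \<xi>: "\<And>n. \<xi> n \<in> trajectories T p q j A L t0 x0" "\<And>n. ts n \<in> {0..T}" "\<And>n. \<bar>F (ts n) (\<xi> n) z\<bar> > real n" by metis
  obtain r :: "nat \<Rightarrow> nat" and x where r: "strict_mono r" "x \<in> paths T" "uniform_limit {0..T} (\<lambda>n. \<xi> (r n)) x sequentially"
    by (rule trajectories_seq_compact[where \<xi>=\<xi>, OF L t0 x0 \<xi>(1)]) blast
  obtain t and r' :: "nat \<Rightarrow> nat" where t: "t \<in> {0..T}" "strict_mono r'" "((\<lambda>n. ts (r n)) \<circ> r') \<longlonglongrightarrow> t"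
    by (rule seq_compactE[OF compact_imp_seq_compact[OF compact_Icc[of 0 T]], of "\<lambda>n. ts (r n)"]) (use \<xi>(2) in blast)+
  have "uniform_limit {0..T} (\<lambda>n. \<xi> (r (r' n))) x sequentially"
    using filterlim_compose[OF r(3) filterlim_subseq[OF t(2)]] .
  then have "(\<lambda>n. F (ts (r (r' n))) (\<xi> (r (r' n))) z) \<longlonglongrightarrow> F t x z"
    using t(3) by (intro F_tendsto t(1) \<xi>(2) r(2) trajectories_paths[OF \<xi>(1)]) (auto simp: o_def)
  then have "Bseq (\<lambda>n. F (ts (r (r' n))) (\<xi> (r (r' n))) z)" by (intro convergent_imp_Bseq convergentI)
  then obtain K where K: "\<And>n. \<bar>F (ts (r (r' n))) (\<xi> (r (r' n))) z\<bar> \<le> K" unfolding Bseq_def by auto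
  obtain n :: nat where "K < real n" using reals_Archimedean2 by blast
  moreover have "n \<le> r (r' n)" using seq_suble[OF t(2), of n] seq_suble[OF r(1), of "r' n"] by simp
  ultimately show False using K[of n] \<xi>(3)[of "r (r' n)"] by simp
qed

lemma trajectories_equicontinuous:
  assumes t0: "0 \<le> t0" "t0 < T" and x0: "x0 \<in> paths T" and e: "e > 0"
  obtains d where "d > 0"
    "\<And>x s t. x \<in> trajectories T p q j A L t0 x0 \<Longrightarrow> s \<in> {0..T} \<Longrightarrow> t \<in> {0..T} \<Longrightarrow> \<bar>s - t\<bar> \<le> d \<Longrightarrow> norm (x s - x t) \<le> e"
proof (rule ccontr)
  assume "\<not> thesis"
  then have "\<exists>x s t. x \<in> trajectories T p q j A L t0 x0 \<and> s \<in> {0..T} \<and> t \<in> {0..T} \<and> \<bar>s - t\<bar> \<le> inverse (real (Suc n)) \<and> norm (x s - x t) > e" for n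
    using that[of "inverse (real (Suc n))"] by (meson not_le inverse_positive_iff_positive of_nat_0_less_iff zero_less_Suc)
  then obtain \<xi> ss ts where \<xi>: "\<And>n. \<xi> n \<in> trajectories T p q j A L t0 x0" "\<And>n. ss n \<in> {0..T}" "\<And>n. ts n \<in> {0..T}"
    "\<And>n. \<bar>ss n - ts n\<bar> \<le> inverse (real (Suc n))" "\<And>n. norm (\<xi> n (ss n) - \<xi> n (ts n)) > e" by metis
  obtain r :: "nat \<Rightarrow> nat" and x where r: "strict_mono r" "x \<in> paths T" "uniform_limit {0..T} (\<lambda>n. \<xi> (r n)) x sequentially"
    by (rule trajectories_seq_compact[where \<xi>=\<xi>, OF L t0 x0 \<xi>(1)]) blast
  obtain d where d: "d > 0" "\<And>s t. s \<in> {0..T} \<Longrightarrow> t \<in> {0..T} \<Longrightarrow> \<bar>s - t\<bar> < d \<Longrightarrow> norm (x s - x t) < e / 3"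
    by (rule path_uniformly_continuous[OF r(2), of "e / 3"]) (use e in auto)
  have "\<forall>\<^sub>F n in sequentially. \<forall>s\<in>{0..T}. dist (\<xi> (r n) s) (x s) < e / 3"
    using r(3) e unfolding uniform_limit_iff by (meson divide_pos_pos zero_less_numeral)
  moreover have "\<forall>\<^sub>F n in sequentially. inverse (real (Suc n)) < d"
    using order_tendstoD(2)[OF LIMSEQ_inverse_real_of_nat d(1)] .
  ultimately have "\<forall>\<^sub>F n in sequentially. False"
  proof eventually_elim
    case (elim n)
    let ?s = "ss (r n)" and ?t = "ts (r n)"
    have "\<bar>?s - ?t\<bar> \<le> inverse (real (Suc (r n)))" by (rule \<xi>(4))
    also have "\<dots> \<le> inverse (real (Suc n))" using seq_suble[OF r(1), of n] by (simp add: le_imp_inverse_le)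
    finally have "norm (x ?s - x ?t) < e / 3" using elim(2) by (intro d(2) \<xi>(2,3)) auto
    moreover have "norm (\<xi> (r n) ?s - x ?s) < e / 3" "norm (\<xi> (r n) ?t - x ?t) < e / 3"
      using elim(1) \<xi>(2,3) by (auto simp: dist_norm)
    moreover have "norm (\<xi> (r n) ?s - \<xi> (r n) ?t) \<le> norm (\<xi> (r n) ?s - x ?s) + norm (x ?s - x ?t) + norm (\<xi> (r n) ?t - x ?t)"
      using norm_triangle_ineq[of "\<xi> (r n) ?s - x ?s" "x ?s - x ?t"]
        norm_triangle_ineq4[of "\<xi> (r n) ?s - x ?t" "\<xi> (r n) ?t - x ?t"] by simp
    ultimately show ?case using \<xi>(5)[of "r n"] by linarith
  qed
  then show False by simp
qed

lemma h_uniformly_continuous: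
  assumes t0: "0 \<le> t0" "t0 < T" and x0: "x0 \<in> paths T" and e: "e > 0"
  obtains d where "d > 0"
    "\<And>x y. x \<in> trajectories T p q j A L t0 x0 \<Longrightarrow> y \<in> trajectories T p q j A L t0 x0 \<Longrightarrow>
      (\<And>t. t \<in> {0..T} \<Longrightarrow> norm (x t - y t) \<le> d) \<Longrightarrow> h x - h y \<le> e"
proof (rule ccontr)
  assume "\<not> thesis"
  then have "\<exists>x y. x \<in> trajectories T p q j A L t0 x0 \<and> y \<in> trajectories T p q j A L t0 x0 \<and>
      (\<forall>t\<in>{0..T}. norm (x t - y t) \<le> inverse (real (Suc n))) \<and> h x - h y > e" for n
    using that[of "inverse (real (Suc n))"] by (meson not_le inverse_positive_iff_positive of_nat_0_less_iff zero_less_Suc)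
  then obtain \<xi> \<zeta> where \<xi>: "\<And>n. \<xi> n \<in> trajectories T p q j A L t0 x0" "\<And>n. \<zeta> n \<in> trajectories T p q j A L t0 x0"
    "\<And>n. \<forall>t\<in>{0..T}. norm (\<xi> n t - \<zeta> n t) \<le> inverse (real (Suc n))" "\<And>n. h (\<xi> n) - h (\<zeta> n) > e" by metis
  obtain r :: "nat \<Rightarrow> nat" and x where r: "strict_mono r" "x \<in> paths T" "uniform_limit {0..T} (\<lambda>n. \<xi> (r n)) x sequentially"
    by (rule trajectories_seq_compact[where \<xi>=\<xi>, OF L t0 x0 \<xi>(1)]) blast
  have "uniform_limit {0..T} (\<lambda>n. \<zeta> (r n)) x sequentially"
    unfolding uniform_limit_iff
  proof (intro allI impI)
    fix c :: real assume c: "c > 0"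
    have "\<forall>\<^sub>F n in sequentially. \<forall>s\<in>{0..T}. dist (\<xi> (r n) s) (x s) < c / 2"
      using r(3) c unfolding uniform_limit_iff by (meson half_gt_zero)
    moreover have "\<forall>\<^sub>F n in sequentially. inverse (real (Suc n)) < c / 2"
      using order_tendstoD(2)[OF LIMSEQ_inverse_real_of_nat half_gt_zero[OF c]] .
    ultimately show "\<forall>\<^sub>F n in sequentially. \<forall>s\<in>{0..T}. dist (\<zeta> (r n) s) (x s) < c"
    proof eventually_elim
      case (elim n)
      show ?case
      proof
        fix s assume s: "s \<in> {0..T}"
        have "norm (\<xi> (r n) s - \<zeta> (r n) s) \<le> inverse (real (Suc (r n)))" using \<xi>(3) s by blast
        also have "\<dots> \<le> inverse (real (Suc n))" using seq_suble[OF r(1), of n] by (simp add: le_imp_inverse_le)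
        finally have "dist (\<xi> (r n) s) (\<zeta> (r n) s) < c / 2" using elim(2) by (simp add: dist_norm)
        moreover have "dist (\<xi> (r n) s) (x s) < c / 2" using elim(1) s by blast
        ultimately show "dist (\<zeta> (r n) s) (x s) < c"
          using dist_triangle[of "\<zeta> (r n) s" "x s" "\<xi> (r n) s"] by (simp add: dist_commute)
      qed
    qed
  qed
  then have "(\<lambda>n. h (\<zeta> (r n))) \<longlonglongrightarrow> h x" by (intro h_tendsto r trajectories_paths[OF \<xi>(2)])
  moreover have "(\<lambda>n. h (\<xi> (r n))) \<longlonglongrightarrow> h x" by (intro h_tendsto r trajectories_paths[OF \<xi>(1)])
  ultimately have "(\<lambda>n. h (\<xi> (r n)) - h (\<zeta> (r n))) \<longlonglongrightarrow> h x - h x" by (intro tendsto_diff)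
  then have "e \<le> h x - h x" by (rule LIMSEQ_le_const) (use \<xi>(4) less_imp_le in blast)
  then show False using e by simp
qed

end

section \<open>Comparison\<close>

text \<open>The penalization lemma, for suprema that need not be attained. The suprema \<open>M c\<close> of \<open>a - c b\<close> decrease
  in \<open>c\<close> and are bounded below, so some doubling of \<open>c\<close> changes them by at most \<open>\<eta>\<close>; the penalty \<open>\<alpha> b\<close> is then
  small at near-maximizers.\<close>

lemma penalized_near_maximizer:
  fixes a b :: "'a \<Rightarrow> real"
  assumes s0: "s0 \<in> S" "b s0 = 0" and a: "\<And>s. s \<in> S \<Longrightarrow> a s \<le> B" and b: "\<And>s. s \<in> S \<Longrightarrow> 0 \<le> b s"
    and \<eta>: "\<eta> > 0"
  shows "\<exists>\<alpha>\<ge>1. \<forall>\<eta>'>0. \<exists>s\<in>S.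
    (\<forall>s'\<in>S. a s' - \<alpha> * b s' \<le> a s - \<alpha> * b s + \<eta>') \<and> \<alpha> * b s \<le> 2 * (\<eta> + \<eta>')"
proof -
  define M where "M c = (SUP s\<in>S. a s - c * b s)" for c
  have bdd: "bdd_above ((\<lambda>s. a s - c * b s) ` S)" if "c \<ge> 0" for c
  proof (rule bdd_aboveI2)
    fix s assume s: "s \<in> S"
    have "0 \<le> c * b s" using that b[OF s] by simp
    then show "a s - c * b s \<le> B" using a[OF s] by linarith
  qed
  have upper: "a s - c * b s \<le> M c" if "s \<in> S" "c \<ge> 0" for s c
    unfolding M_def by (rule cSUP_upper[OF that(1) bdd[OF that(2)]])
  have M_ge: "a s0 \<le> M c" if "c \<ge> 0" for c using upper[OF s0(1) that] s0(2) by simp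
  have "\<exists>n. M (2 ^ n) - M (2 ^ Suc n) \<le> \<eta>"
  proof (rule ccontr)
    assume "\<not> ?thesis"
    then have step: "M (2 ^ Suc n) < M (2 ^ n) - \<eta>" for n by (smt (verit))
    have "M (2 ^ n) \<le> M 1 - real n * \<eta>" for n
    proof (induction n)
      case (Suc n)
      have "real (Suc n) * \<eta> = real n * \<eta> + \<eta>" by (simp add: distrib_right)
      then show ?case using step[of n] Suc by linarith
    qed simp
    moreover obtain n :: nat where "real n > (M 1 - a s0) / \<eta>" using reals_Archimedean2 by blast
    then have "real n * \<eta> > M 1 - a s0" using \<eta> by (simp add: divide_less_eq)
    moreover have "a s0 \<le> M (2 ^ n)" by (rule M_ge) simp
    ultimately show False by (smt (verit))
  qed
  then obtain n where n: "M (2 ^ n) - M (2 ^ Suc n) \<le> \<eta>" by blast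
  define \<alpha> :: real where "\<alpha> = 2 ^ Suc n"
  have \<alpha>1: "\<alpha> \<ge> 1" unfolding \<alpha>_def by (rule one_le_power) simp
  have half: "2 ^ n = \<alpha> / 2" by (simp add: \<alpha>_def)
  show ?thesis
  proof (intro exI[of _ \<alpha>] conjI allI impI \<alpha>1)
    fix \<eta>' :: real assume \<eta>': "\<eta>' > 0"
    have "\<exists>s\<in>S. M \<alpha> - \<eta>' < a s - \<alpha> * b s"
      using less_cSUP_iff[OF _ bdd, of \<alpha> "M \<alpha> - \<eta>'"] s0(1) \<alpha>1 \<eta>' by (auto simp: M_def)
    then obtain s where s: "s \<in> S" "M \<alpha> - \<eta>' < a s - \<alpha> * b s" by blast
    have "a s' - \<alpha> * b s' \<le> a s - \<alpha> * b s + \<eta>'" if "s' \<in> S" for s'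
      using upper[OF that, of \<alpha>] s(2) \<alpha>1 by simp
    moreover have "\<alpha> * b s \<le> 2 * (\<eta> + \<eta>')"
    proof -
      have "a s - \<alpha> / 2 * b s \<le> M (\<alpha> / 2)" by (rule upper[OF s(1)]) (use \<alpha>1 in simp)
      moreover have "M (\<alpha> / 2) - M \<alpha> \<le> \<eta>" using n unfolding half by (simp add: \<alpha>_def)
      ultimately show ?thesis using s(2) by simp
    qed
    ultimately show "\<exists>s\<in>S. (\<forall>s'\<in>S. a s' - \<alpha> * b s' \<le> a s - \<alpha> * b s + \<eta>') \<and> \<alpha> * b s \<le> 2 * (\<eta> + \<eta>')"
      using s(1) by blast
  qed
qed

text \<open>A sub- and a supersolution, and an initial condition \<open>(t0,x0)\<close> at which they are to be compared.\<close>

locale comparison = hamiltonian T p q j A F h L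
  for T p q :: real
    and j :: "'v::{banach, second_countable_topology} \<Rightarrow>\<^sub>L
              'h::{real_inner, complete_space, second_countable_topology}"
    and A :: "real \<Rightarrow> 'v \<Rightarrow> ('v \<Rightarrow>\<^sub>L real)"
    and F :: "real \<Rightarrow> (real \<Rightarrow> 'h) \<Rightarrow> 'h \<Rightarrow> real" and h :: "(real \<Rightarrow> 'h) \<Rightarrow> real" and L :: real +
  fixes \<Omega> :: "(real \<Rightarrow> 'h) set" and u v :: "real \<Rightarrow> (real \<Rightarrow> 'h) \<Rightarrow> real" and t0 :: real and x0 :: "real \<Rightarrow> 'h"
  assumes \<Omega>: "\<Omega> \<subseteq> paths T"
    and sub: "minimax_subsolution T p q j A F h L \<Omega> u"
    and super: "minimax_supersolution T p q j A F h L \<Omega> v"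
    and t0: "0 \<le> t0" "t0 < T" and x0: "x0 \<in> \<Omega>"
begin

text \<open>The trajectories issuing from \<open>(t0,x0)\<close> along which \<open>u\<close> and \<open>v\<close> are defined.\<close>

definition X :: "(real \<Rightarrow> 'h) set" where "X = trajectories T p q j A L t0 x0 \<inter> \<Omega>"

lemma x0_path: "x0 \<in> paths T" using x0 \<Omega> by blast

lemma X_trajectory: "x \<in> X \<Longrightarrow> x \<in> trajectories T p q j A L t0 x0" by (simp add: X_def)

lemma X_path: "x \<in> X \<Longrightarrow> x \<in> paths T" using \<Omega> by (auto simp: X_def)

lemma X_init: "x \<in> X \<Longrightarrow> t \<in> {0..t0} \<Longrightarrow> x t = x0 t"
  by (auto simp: X_def trajectories_def trajectory_def)

text \<open>Paths obtained from the semisolution properties along the way stay in \<open>X\<close>, by concatenation.\<close>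

lemma X_extend:
  assumes "x \<in> X" "t \<in> {t0..<T}" "trajectory T p q j A L t x y f" "y \<in> \<Omega>"
  shows "y \<in> X"
proof -
  obtain g where "trajectory T p q j A L t0 x0 x g" using assms(1) by (auto simp: X_def trajectories_def)
  from trajectory_concat[OF this assms(3) t0(1)] assms(2,4) show ?thesis
    by (auto simp: X_def trajectories_def)
qed

lemma integrand_integrable:
  assumes y: "trajectory T p q j A L t x y f" and ab: "0 \<le> t" "t \<le> a" "b \<le> T"
  shows "(\<lambda>r. - f r \<bullet> z + F r y z) absolutely_integrable_on {a..b}"
proof -
  have "(\<lambda>r. f r \<bullet> - z) absolutely_integrable_on {a..b}"
    by (rule inner_absolutely_integrable[OF trajectory_rhs[OF y ab(2,3)]]) simp
  moreover have "(\<lambda>r. F r y z) absolutely_integrable_on {a..b}"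
    by (rule absolutely_integrable_continuous_real, rule continuous_on_subset[OF F_continuous[OF trajectory_path[OF y]]])
      (use ab in auto)
  ultimately have "(\<lambda>r. f r \<bullet> - z + F r y z) absolutely_integrable_on {a..b}" by (rule set_integral_add)
  then show ?thesis by simp
qed

lemma sub_step:
  assumes t: "t \<in> {t0..<T}" and x: "x \<in> X"
  obtains y f where "y \<in> X" "trajectory T p q j A L t x y f"
    "\<And>s. s \<in> {t..T} \<Longrightarrow> u t x \<le> integral {t..s} (\<lambda>r. - f r \<bullet> z + F r y z) + u s y"
proof -
  have t': "t \<in> {0..<T}" using t t0 by auto
  have "x \<in> \<Omega>" using x by (simp add: X_def)
  then obtain y f where y: "y \<in> \<Omega>" "trajectory T p q j A L t x y f"
    "\<forall>s\<in>{t..T}. u t x \<le> (LINT r|lebesgue_on {t..s}. - f r \<bullet> z + F r y z) + u s y"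
    using sub t' unfolding minimax_subsolution_def by blast
  show thesis
  proof (rule that[OF X_extend[OF x t y(2,1)] y(2)])
    fix s assume s: "s \<in> {t..T}"
    then have "(\<lambda>r. - f r \<bullet> z + F r y z) absolutely_integrable_on {t..s}"
      using t' by (intro integrand_integrable[OF y(2)]) auto
    from LINT_Icc_eq_integral[OF this] show "u t x \<le> integral {t..s} (\<lambda>r. - f r \<bullet> z + F r y z) + u s y"
      using bspec[OF y(3) s] by (simp only:)
  qed
qed

lemma super_step:
  assumes t: "t \<in> {t0..<T}" and x: "x \<in> X"
  obtains y f where "y \<in> X" "trajectory T p q j A L t x y f"
    "\<And>s. s \<in> {t..T} \<Longrightarrow> integral {t..s} (\<lambda>r. - f r \<bullet> z + F r y z) + v s y \<le> v t x"
proof -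
  have t': "t \<in> {0..<T}" using t t0 by auto
  have "x \<in> \<Omega>" using x by (simp add: X_def)
  then obtain y f where y: "y \<in> \<Omega>" "trajectory T p q j A L t x y f"
    "\<forall>s\<in>{t..T}. v t x \<ge> (LINT r|lebesgue_on {t..s}. - f r \<bullet> z + F r y z) + v s y"
    using super t' unfolding minimax_supersolution_def by blast
  show thesis
  proof (rule that[OF X_extend[OF x t y(2,1)] y(2)])
    fix s assume s: "s \<in> {t..T}"
    then have "(\<lambda>r. - f r \<bullet> z + F r y z) absolutely_integrable_on {t..s}"
      using t' by (intro integrand_integrable[OF y(2)]) auto
    from LINT_Icc_eq_integral[OF this] show "integral {t..s} (\<lambda>r. - f r \<bullet> z + F r y z) + v s y \<le> v t x"
      using bspec[OF y(3) s] by (simp only:)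
  qed
qed

lemma terminal: "x \<in> X \<Longrightarrow> u T x \<le> h x" "x \<in> X \<Longrightarrow> h x \<le> v T x"
  using sub super by (auto simp: X_def minimax_subsolution_def minimax_supersolution_def)

lemma X_start:
  obtains x where "x \<in> X" "u t0 x = u t0 x0" "v t0 x = v t0 x0"
proof -
  obtain x f where x: "x \<in> \<Omega>" "trajectory T p q j A L t0 x0 x f"
    using sub t0 x0 unfolding minimax_subsolution_def by (metis atLeastLessThan_iff)
  have eq: "x s = x0 s" if "s \<in> {0..t0}" for s using x(2) that by (simp add: trajectory_def)
  have t0': "t0 \<in> {0..T}" using t0 by simp
  have us: "usc_on T \<Omega> u" and ls: "lsc_on T \<Omega> v"
    using sub super by (auto simp: minimax_subsolution_def minimax_supersolution_def)
  show thesis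
    by (rule that[of x])
      (use x usc_on_nonanticipating[OF us t0' x(1) x0 eq] lsc_on_nonanticipating[OF ls t0' x(1) x0 eq]
        in \<open>auto simp: X_def trajectories_def\<close>)
qed

text \<open>One-sided bounds: an upper one for \<open>u\<close> and a lower one for \<open>v\<close>, from the vector \<open>z = 0\<close> in the definition of semisolutions.\<close>

lemma u_v_bounded:
  obtains B where "\<And>t x. t \<in> {t0..T} \<Longrightarrow> x \<in> X \<Longrightarrow> u t x \<le> B" "\<And>t x. t \<in> {t0..T} \<Longrightarrow> x \<in> X \<Longrightarrow> - B \<le> v t x"
proof -
  obtain Bh where Bh: "\<And>x. x \<in> trajectories T p q j A L t0 x0 \<Longrightarrow> \<bar>h x\<bar> \<le> Bh"
    by (rule h_bounded[OF t0 x0_path]) blast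
  obtain BF where BF: "\<And>x t. x \<in> trajectories T p q j A L t0 x0 \<Longrightarrow> t \<in> {0..T} \<Longrightarrow> \<bar>F t x 0\<bar> \<le> BF"
    by (rule F_bounded[OF t0 x0_path, of 0]) blast
  define B where "B = Bh + T * BF"
  have BF0: "0 \<le> BF"
  proof -
    obtain x where "x \<in> X" by (rule X_start)
    then have "\<bar>F 0 x 0\<bar> \<le> BF" by (intro BF X_trajectory) (use T_pos in auto)
    then show ?thesis by linarith
  qed
  have int: "\<bar>integral {t..T} (\<lambda>r. - f r \<bullet> 0 + F r y 0)\<bar> \<le> T * BF"
    if t: "t \<in> {t0..<T}" and y: "y \<in> X" for t y and f :: "real \<Rightarrow> 'h"
  proof -
    have Fi: "(\<lambda>r. F r y 0) integrable_on {t..T}"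
      by (rule integrable_continuous_real, rule continuous_on_subset[OF F_continuous[OF X_path[OF y]]])
        (use t t0 in auto)
    have "norm (integral {t..T} (\<lambda>r. F r y 0)) \<le> integral {t..T} (\<lambda>r. BF)"
      by (rule integral_norm_bound_integral[OF Fi]) (use BF[OF X_trajectory[OF y]] t t0 in auto)
    also have "\<dots> = (T - t) * BF" using t by simp
    also have "\<dots> \<le> T * BF" using BF0 t t0 by (intro mult_right_mono) auto
    finally show ?thesis by simp
  qed
  have TBF: "0 \<le> T * BF" using T_pos BF0 by simp
  show thesis
  proof (rule that[of B])
    fix t x assume t: "t \<in> {t0..T}" and x: "x \<in> X"
    show "u t x \<le> B"
    proof (cases "t = T")
      case True
      then show ?thesis using terminal(1)[OF x] Bh[OF X_trajectory[OF x]] TBF by (simp add: B_def)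
    next
      case False
      then have t': "t \<in> {t0..<T}" using t by auto
      obtain y f where y: "y \<in> X" "trajectory T p q j A L t x y f" "\<And>s. s \<in> {t..T} \<Longrightarrow> u t x \<le> integral {t..s} (\<lambda>r. - f r \<bullet> 0 + F r y 0) + u s y"
        by (rule sub_step[OF t' x, of 0]) blast
      have "u t x \<le> integral {t..T} (\<lambda>r. - f r \<bullet> 0 + F r y 0) + u T y" by (rule y(3)) (use t in simp)
      then show ?thesis
        using int[OF t' y(1), of f] terminal(1)[OF y(1)] Bh[OF X_trajectory[OF y(1)]] unfolding B_def by linarith
    qed
    show "- B \<le> v t x"
    proof (cases "t = T")
      case True
      then show ?thesis using terminal(2)[OF x] Bh[OF X_trajectory[OF x]] TBF by (simp add: B_def)
    next
      case False
      then have t': "t \<in> {t0..<T}" using t by auto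
      obtain y f where y: "y \<in> X" "trajectory T p q j A L t x y f" "\<And>s. s \<in> {t..T} \<Longrightarrow> integral {t..s} (\<lambda>r. - f r \<bullet> 0 + F r y 0) + v s y \<le> v t x"
        by (rule super_step[OF t' x, of 0]) blast
      have "integral {t..T} (\<lambda>r. - f r \<bullet> 0 + F r y 0) + v T y \<le> v t x" by (rule y(3)) (use t in simp)
      then show ?thesis
        using int[OF t' y(1), of f] terminal(2)[OF y(1)] Bh[OF X_trajectory[OF y(1)]] unfolding B_def by linarith
    qed
  qed
qed

text \<open>The squared distance \<open>D\<close> of two paths, its integral \<open>P\<close> since \<open>t0\<close>, and the doubled functional \<open>\<Phi>\<close>,
  with penalty parameter \<open>\<alpha>\<close> and with a drift \<open>\<kappa>\<close> that makes it increase at a definite rate along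
  suitable trajectories.\<close>

definition D :: "(real \<Rightarrow> 'h) \<Rightarrow> (real \<Rightarrow> 'h) \<Rightarrow> real \<Rightarrow> real" where
  "D x y t = (norm (x t - y t))\<^sup>2"

definition P :: "(real \<Rightarrow> 'h) \<Rightarrow> (real \<Rightarrow> 'h) \<Rightarrow> real \<Rightarrow> real" where
  "P x y t = integral {t0..t} (D x y)"

definition \<Phi> :: "real \<Rightarrow> real \<Rightarrow> real \<Rightarrow> (real \<Rightarrow> 'h) \<Rightarrow> (real \<Rightarrow> 'h) \<Rightarrow> real" where
  "\<Phi> \<kappa> \<alpha> t x y = u t x - v t y - \<kappa> * (T - t) - \<alpha> * ((D x y t + P x y t) / 2)"

lemma D_nonneg: "0 \<le> D x y t" by (simp add: D_def)

lemma D_has_integral: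
  assumes "x \<in> X" "y \<in> X" "t0 \<le> a" "a \<le> b" "b \<le> T"
  shows "(D x y has_integral (P x y b - P x y a)) {a..b}"
proof -
  have "continuous_on {t0..b} (D x y)"
    unfolding D_def using assms t0 by (intro continuous_intros paths_continuous[OF X_path]) auto
  then have i: "D x y integrable_on {t0..b}" by (rule integrable_continuous_real)
  have "integral {t0..a} (D x y) + integral {a..b} (D x y) = integral {t0..b} (D x y)"
    by (rule Henstock_Kurzweil_Integration.integral_combine[OF assms(3,4) i])
  moreover have "D x y integrable_on {a..b}" using assms by (intro integrable_on_subinterval[OF i]) auto
  ultimately show ?thesis by (simp add: P_def has_integral_iff)
qed

lemma P_mono:
  assumes "x \<in> X" "y \<in> X" "t0 \<le> a" "a \<le> b" "b \<le> T"
  shows "P x y a \<le> P x y b"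
  using has_integral_nonneg[OF D_has_integral[OF assms]] by (simp add: D_nonneg)

lemma P_start [simp]: "P x y t0 = 0" by (simp add: P_def)

text \<open>The integral penalty \<open>P\<close> controls the uniform distance of the histories, because the squared
  distance \<open>D\<close> cannot grow fast.\<close>

lemma X_bounds:
  obtains R C where "R \<ge> 0" "C > 0" "\<And>x t. x \<in> X \<Longrightarrow> t \<in> {0..T} \<Longrightarrow> norm (x t) \<le> R"
    "\<And>x y a b. x \<in> X \<Longrightarrow> y \<in> X \<Longrightarrow> t0 \<le> a \<Longrightarrow> a \<le> b \<Longrightarrow> b \<le> T \<Longrightarrow> D x y b \<le> D x y a + C * (b - a)"
    "\<And>x y t. x \<in> X \<Longrightarrow> y \<in> X \<Longrightarrow> t \<in> {t0..T} \<Longrightarrow> (D x y t)\<^sup>2 \<le> 4 * C * P x y t"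
proof -
  obtain R C where RC: "R \<ge> 0" "C \<ge> 0"
    "\<And>x f t. trajectory T p q j A L t0 x0 x f \<Longrightarrow> t \<in> {0..T} \<Longrightarrow> norm (x t) \<le> R"
    "\<And>x f y g a b. trajectory T p q j A L t0 x0 x f \<Longrightarrow> trajectory T p q j A L t0 x0 y g \<Longrightarrow>
       t0 \<le> a \<Longrightarrow> a \<le> b \<Longrightarrow> b \<le> T \<Longrightarrow> (norm (x b - y b))\<^sup>2 \<le> (norm (x a - y a))\<^sup>2 + C * (b - a)"
    by (rule trajectory_bounds[OF L t0 x0_path]) blast
  define C' where "C' = C + 1"
  have C': "C' > 0" using RC(2) by (simp add: C'_def)
  have R: "norm (x t) \<le> R" if "x \<in> X" "t \<in> {0..T}" for x t
    using that RC(3) by (auto simp: X_def trajectories_def)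
  have growth: "D x y b \<le> D x y a + C' * (b - a)" if xy: "x \<in> X" "y \<in> X" and ab: "t0 \<le> a" "a \<le> b" "b \<le> T" for x y a b
  proof -
    obtain f g where "trajectory T p q j A L t0 x0 x f" "trajectory T p q j A L t0 x0 y g"
      using xy by (auto simp: X_def trajectories_def)
    from RC(4)[OF this ab] have "D x y b \<le> D x y a + C * (b - a)" by (simp add: D_def)
    also have "C * (b - a) \<le> C' * (b - a)" using ab by (intro mult_right_mono) (auto simp: C'_def)
    finally show ?thesis by simp
  qed
  have sq: "(D x y t)\<^sup>2 \<le> 4 * C' * P x y t" if x: "x \<in> X" and y: "y \<in> X" and t: "t \<in> {t0..T}" for x y t
  proof -
    define d where "d = D x y t"
    have d0: "0 \<le> d" by (simp add: d_def D_nonneg)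
    have "D x y t0 = 0" using X_init[OF x, of t0] X_init[OF y, of t0] t0 by (simp add: D_def)
    then have "d \<le> C' * (t - t0)" using growth[OF x y, of t0 t] t by (simp add: d_def)
    then have "d / C' \<le> t - t0" using C' by (simp add: divide_le_eq mult.commute)
    moreover have "0 \<le> d / C'" using d0 C' by simp
    moreover define c where "c = t - d / C' / 2"
    ultimately have c: "t0 \<le> c" "c \<le> t" "t - c = d / C' / 2" by auto
    have ge: "d / 2 \<le> D x y s" if s: "s \<in> {c..t}" for s
    proof -
      have "d \<le> D x y s + C' * (t - s)" unfolding d_def by (rule growth[OF x y]) (use s c t in auto)
      also have "C' * (t - s) \<le> C' * (t - c)" using s C' by (intro mult_left_mono) auto
      also have "\<dots> = d / 2" unfolding c(3) using C' by simp
      finally show ?thesis by simp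
    qed
    have "((\<lambda>_. d / 2) has_integral (t - c) * (d / 2)) {c..t}"
      using has_integral_const_real[of "d / 2" c t] c by simp
    moreover have "(D x y has_integral (P x y t - P x y c)) {c..t}"
      by (rule D_has_integral[OF x y]) (use c t in auto)
    ultimately have "(t - c) * (d / 2) \<le> P x y t - P x y c" by (rule has_integral_le) (use ge in auto)
    moreover have "0 \<le> P x y c" using P_mono[OF x y order_refl c(1)] c t by simp
    ultimately have "d / C' / 2 * (d / 2) \<le> P x y t" by (simp add: c(3))
    then show ?thesis using C' by (simp add: d_def[symmetric] power2_eq_square field_simps)
  qed
  show thesis by (rule that[of R C']) (fact RC(1) C' R growth sq)+
qed

text \<open>Following the two semisolutions for a fixed vector \<open>z\<close> along suitable trajectories: the
  penalized difference \<open>\<Phi>\<close> can fail to increase at rate \<open>\<kappa>\<close> only by the integral on the right.\<close>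

lemma doubling_step:
  assumes t: "t \<in> {t0..<T}" and x: "x \<in> X" and y: "y \<in> X" and \<alpha>: "\<alpha> \<ge> 0"
  obtains x' f y' g where "x' \<in> X" "y' \<in> X" "trajectory T p q j A L t x x' f" "trajectory T p q j A L t y y' g"
    "\<And>s. s \<in> {t..T} \<Longrightarrow>
      (\<lambda>r. (f r - g r) \<bullet> (\<alpha> *\<^sub>R (x' r - y' r) - z) + \<alpha> / 2 * D x' y' r + (F r x' z - F r y' z)) integrable_on {t..s} \<and>
      \<Phi> \<kappa> \<alpha> t x y + \<kappa> * (s - t) \<le> \<Phi> \<kappa> \<alpha> s x' y' +
        integral {t..s} (\<lambda>r. (f r - g r) \<bullet> (\<alpha> *\<^sub>R (x' r - y' r) - z) + \<alpha> / 2 * D x' y' r + (F r x' z - F r y' z))"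
proof -
  obtain x' f where x': "x' \<in> X" "trajectory T p q j A L t x x' f"
    "\<And>s. s \<in> {t..T} \<Longrightarrow> u t x \<le> integral {t..s} (\<lambda>r. - f r \<bullet> z + F r x' z) + u s x'"
    by (rule sub_step[OF t x]) blast
  obtain y' g where y': "y' \<in> X" "trajectory T p q j A L t y y' g"
    "\<And>s. s \<in> {t..T} \<Longrightarrow> integral {t..s} (\<lambda>r. - g r \<bullet> z + F r y' z) + v s y' \<le> v t y"
    by (rule super_step[OF t y]) blast
  have t': "0 \<le> t" "t0 \<le> t" using t t0 by auto
  have agree: "x' r = x r" "y' r = y r" if "r \<in> {0..t}" for r
    using x'(2) y'(2) that by (auto simp: trajectory_def)
  have Dt: "D x' y' t = D x y t" using agree[of t] t' by (simp add: D_def)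
  have Pt: "P x' y' t = P x y t" unfolding P_def
    by (rule integral_cong) (use agree t0 in \<open>auto simp: D_def\<close>)
  show thesis
  proof (rule that[OF x'(1) y'(1) x'(2) y'(2)])
    fix s assume s: "s \<in> {t..T}"
    let ?G = "\<lambda>r. (f r - g r) \<bullet> (\<alpha> *\<^sub>R (x' r - y' r) - z) + \<alpha> / 2 * D x' y' r + (F r x' z - F r y' z)"
    define If where "If = integral {t..s} (\<lambda>r. - f r \<bullet> z + F r x' z)"
    define Ig where "Ig = integral {t..s} (\<lambda>r. - g r \<bullet> z + F r y' z)"
    define E where "E = integral {t..s} (\<lambda>r. (f r - g r) \<bullet> (x' r - y' r))"
    have st: "t \<le> s" "s \<le> T" using s by auto
    have hf: "((\<lambda>r. - f r \<bullet> z + F r x' z) has_integral If) {t..s}" unfolding If_def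
      using integrand_integrable[OF x'(2) t'(1) order_refl st(2)] by (intro integrable_integral set_lebesgue_integral_eq_integral)
    have hg: "((\<lambda>r. - g r \<bullet> z + F r y' z) has_integral Ig) {t..s}" unfolding Ig_def
      using integrand_integrable[OF y'(2) t'(1) order_refl st(2)] by (intro integrable_integral set_lebesgue_integral_eq_integral)
    have hE: "((\<lambda>r. (f r - g r) \<bullet> (x' r - y' r)) has_integral E) {t..s}" unfolding E_def
      using energy_difference(1)[OF x'(2) y'(2) t'(1) order_refl st] by (intro integrable_integral set_lebesgue_integral_eq_integral)
    have hD: "(D x' y' has_integral (P x' y' s - P x' y' t)) {t..s}"
      by (rule D_has_integral[OF x'(1) y'(1) t'(2) st])
    have "((\<lambda>r. (- f r \<bullet> z + F r x' z) - (- g r \<bullet> z + F r y' z) + \<alpha> * ((f r - g r) \<bullet> (x' r - y' r)) + \<alpha> / 2 * D x' y' r)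
       has_integral (If - Ig + \<alpha> * E + \<alpha> / 2 * (P x' y' s - P x' y' t))) {t..s}"
      by (intro has_integral_add has_integral_diff has_integral_mult_right hf hg hE hD)
    moreover have "(\<lambda>r. (- f r \<bullet> z + F r x' z) - (- g r \<bullet> z + F r y' z) + \<alpha> * ((f r - g r) \<bullet> (x' r - y' r)) + \<alpha> / 2 * D x' y' r) = ?G"
      by (simp add: fun_eq_iff inner_diff_left inner_diff_right)
    ultimately have hG: "(?G has_integral (If - Ig + \<alpha> * E + \<alpha> / 2 * (P x' y' s - P x' y' t))) {t..s}" by simp
    have "D x' y' s \<le> D x' y' t + 2 * E"
      using energy_difference(2)[OF x'(2) y'(2) t'(1) order_refl st] by (simp add: D_def E_def)
    then have "\<alpha> * D x' y' s \<le> \<alpha> * (D x' y' t + 2 * E)" using \<alpha> by (rule mult_left_mono)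
    then have "\<alpha> / 2 * D x' y' s \<le> \<alpha> / 2 * D x y t + \<alpha> * E" by (simp add: Dt algebra_simps)
    moreover have "u t x \<le> If + u s x'" "Ig + v s y' \<le> v t y"
      using x'(3)[OF s] y'(3)[OF s] by (simp_all add: If_def Ig_def)
    moreover have "\<kappa> * (T - t) = \<kappa> * (T - s) + \<kappa> * (s - t)" by (simp add: algebra_simps)
    moreover have "\<alpha> / 2 * (P x' y' s - P x' y' t) = \<alpha> / 2 * P x' y' s - \<alpha> / 2 * P x y t"
      by (simp add: Pt right_diff_distrib)
    moreover have "\<alpha> * ((D x y t + P x y t) / 2) = \<alpha> / 2 * D x y t + \<alpha> / 2 * P x y t"
      "\<alpha> * ((D x' y' s + P x' y' s) / 2) = \<alpha> / 2 * D x' y' s + \<alpha> / 2 * P x' y' s"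
      by (simp_all add: algebra_simps add_divide_distrib)
    ultimately have "\<Phi> \<kappa> \<alpha> t x y + \<kappa> * (s - t) \<le> \<Phi> \<kappa> \<alpha> s x' y' + (If - Ig + \<alpha> * E + \<alpha> / 2 * (P x' y' s - P x' y' t))"
      unfolding \<Phi>_def by linarith
    then show "?G integrable_on {t..s} \<and> \<Phi> \<kappa> \<alpha> t x y + \<kappa> * (s - t) \<le> \<Phi> \<kappa> \<alpha> s x' y' + integral {t..s} ?G"
      using hG by (auto simp: has_integral_iff)
  qed
qed


lemma D_eq_0_init:
  assumes "x \<in> X" "y \<in> X" "t \<in> {0..t0}"
  shows "norm (x t - y t) = 0"
  using X_init[OF assms(1,3)] X_init[OF assms(2,3)] by simp

lemma history_distance_le:
  assumes C: "C > 0" "\<And>x y t. x \<in> X \<Longrightarrow> y \<in> X \<Longrightarrow> t \<in> {t0..T} \<Longrightarrow> (D x y t)\<^sup>2 \<le> 4 * C * P x y t"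
    and x: "x \<in> X" and y: "y \<in> X" and t: "t \<in> {t0..T}" and \<sigma>: "\<sigma> \<ge> 0" "4 * C * P x y t \<le> \<sigma> ^ 4"
    and r: "r \<in> {0..t}"
  shows "norm (x r - y r) \<le> \<sigma>"
proof (cases "r \<le> t0")
  case True
  then show ?thesis using D_eq_0_init[OF x y, of r] r \<sigma> by simp
next
  case False
  have "(D x y r)\<^sup>2 \<le> 4 * C * P x y r" by (rule C(2)[OF x y]) (use False r t in auto)
  also have "\<dots> \<le> 4 * C * P x y t"
    by (rule mult_left_mono[OF P_mono[OF x y]]) (use False r t C(1) in auto)
  also have "\<dots> \<le> \<sigma> ^ 4" by (rule \<sigma>(2))
  also have "\<sigma> ^ 4 = (\<sigma>\<^sup>2)\<^sup>2" by simp
  finally have "D x y r \<le> \<sigma>\<^sup>2" by (rule power2_le_imp_le) simp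
  then show ?thesis unfolding D_def by (rule power2_le_imp_le[OF _ \<sigma>(1)])
qed

text \<open>On a short time interval after a point where the penalty is small, the integrand in
  \<open>doubling_step\<close> with \<open>z = \<alpha> (x t - y t)\<close> stays below \<open>\<kappa>/2\<close>.\<close>

lemma integrand_bound:
  assumes x': "x' \<in> X" and y': "y' \<in> X" and \<alpha>: "\<alpha> > 0" and R: "R \<ge> 0"
    and R_bound: "\<And>x t. x \<in> X \<Longrightarrow> t \<in> {0..T} \<Longrightarrow> norm (x t) \<le> R"
    and L0: "L0 \<ge> 0" "\<And>t x z w R. t \<in> {0..T} \<Longrightarrow> x \<in> paths T \<Longrightarrow> (\<And>s. s \<in> {0..t} \<Longrightarrow> norm (x s) \<le> R) \<Longrightarrow>
      \<bar>F t x z - F t x w\<bar> \<le> L0 * (1 + R) * norm (z - w)"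
    and m: "\<And>e t x y. e > 0 \<Longrightarrow> t \<in> {t0..T} \<Longrightarrow> x \<in> X \<Longrightarrow> y \<in> X \<Longrightarrow>
       F t x ((1 / e) *\<^sub>R (x t - y t)) - F t y ((1 / e) *\<^sub>R (x t - y t))
       \<le> m ((1 / e) * (norm (x t - y t))\<^sup>2 + (SUP s\<in>{0..t}. norm (x s - y s)))"
    and \<rho>: "\<And>r. 0 \<le> r \<Longrightarrow> r < \<rho> \<Longrightarrow> m r \<le> \<kappa> / 8"
    and \<omega>: "4 * \<alpha> * \<omega> * (L * (1 + R)) \<le> \<kappa> / 8" "4 * \<alpha> * \<omega> * (L0 * (1 + R)) \<le> \<kappa> / 8"
    and t: "t \<in> {t0..T}" and s: "s \<in> {t0..T}"
    and near: "norm (x' s - x' t) \<le> \<omega>" "norm (y' s - y' t) \<le> \<omega>"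
    and fg: "norm f \<le> L * (1 + R)" "norm g \<le> L * (1 + R)"
    and small: "\<alpha> * D x' y' s \<le> \<kappa> / 4" "\<alpha> * D x' y' s + \<sigma> < \<rho>" "\<And>r. r \<in> {0..s} \<Longrightarrow> norm (x' r - y' r) \<le> \<sigma>"
    and z: "z = \<alpha> *\<^sub>R (x' t - y' t)"
  shows "(f - g) \<bullet> (\<alpha> *\<^sub>R (x' s - y' s) - z) + \<alpha> / 2 * D x' y' s + (F s x' z - F s y' z) \<le> \<kappa> / 2"
proof -
  have s': "s \<in> {0..T}" using s t0 by auto
  define zs where "zs = \<alpha> *\<^sub>R (x' s - y' s)"
  have "zs - z = \<alpha> *\<^sub>R ((x' s - x' t) - (y' s - y' t))" by (simp add: zs_def z algebra_simps)
  then have "norm (zs - z) = \<alpha> * norm ((x' s - x' t) - (y' s - y' t))" using \<alpha> by simp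
  also have "\<dots> \<le> \<alpha> * (2 * \<omega>)"
    using near norm_triangle_ineq4[of "x' s - x' t" "y' s - y' t"] \<alpha> by (intro mult_left_mono) auto
  finally have zz: "norm (zs - z) \<le> 2 * \<alpha> * \<omega>" by simp
  have LR: "0 \<le> L * (1 + R)" "0 \<le> L0 * (1 + R)" using L L0(1) R by auto
  have "(f - g) \<bullet> (zs - z) \<le> norm (f - g) * norm (zs - z)" by (rule norm_cauchy_schwarz)
  also have "\<dots> \<le> (2 * (L * (1 + R))) * (2 * \<alpha> * \<omega>)"
    using fg norm_triangle_ineq4[of f g] zz LR by (intro mult_mono) auto
  also have "\<dots> = 4 * \<alpha> * \<omega> * (L * (1 + R))" by (simp add: mult_ac)
  finally have 1: "(f - g) \<bullet> (zs - z) \<le> \<kappa> / 8" using \<omega>(1) by linarith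
  have lip: "\<bar>F s w z - F s w zs\<bar> \<le> \<kappa> / 16" if w: "w \<in> X" for w
  proof -
    have "\<bar>F s w z - F s w zs\<bar> \<le> L0 * (1 + R) * norm (z - zs)"
      by (rule L0(2)[OF s' X_path[OF w]]) (use R_bound[OF w] s' in auto)
    also have "\<dots> \<le> L0 * (1 + R) * (2 * \<alpha> * \<omega>)"
      using zz LR(2) by (intro mult_left_mono) (auto simp: norm_minus_commute)
    also have "\<dots> = (4 * \<alpha> * \<omega> * (L0 * (1 + R))) / 2" by (simp add: mult_ac)
    finally show ?thesis using \<omega>(2) by linarith
  qed
  define S where "S = (SUP r\<in>{0..s}. norm (x' r - y' r))"
  have "S \<le> \<sigma>" unfolding S_def by (rule cSUP_least) (use small(3) s' in auto)
  moreover have "0 \<le> S"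
  proof -
    have "bdd_above ((\<lambda>r. norm (x' r - y' r)) ` {0..s})" by (rule bdd_aboveI2[OF small(3)])
    then have "norm (x' 0 - y' 0) \<le> S" unfolding S_def by (rule cSUP_upper[rotated]) (use s' in simp)
    then show ?thesis using norm_ge_zero order_trans by blast
  qed
  moreover have "0 \<le> \<alpha> * D x' y' s" using \<alpha> D_nonneg[of x' y' s] by simp
  ultimately have "m (\<alpha> * D x' y' s + S) \<le> \<kappa> / 8" using small(2) by (intro \<rho>) auto
  moreover have "F s x' zs - F s y' zs \<le> m (\<alpha> * D x' y' s + S)"
    using m[of "1 / \<alpha>" s x' y', OF _ s x' y'] \<alpha> by (simp add: zs_def D_def S_def)
  ultimately have "F s x' z - F s y' z \<le> \<kappa> / 4"
    using lip[OF x'] lip[OF y'] by linarith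
  moreover have "\<alpha> / 2 * D x' y' s \<le> \<kappa> / 8" using small(1) by simp
  ultimately show ?thesis using 1 by (simp add: zs_def)
qed

text \<open>The contradiction. The parameters are fixed in the order \<open>\<kappa>\<close>, \<open>\<rho>\<close> (from the modulus of \<open>F\<close>), \<open>\<sigma>\<close> (a bound for the
  distance of histories), \<open>\<theta>\<close> (a bound for the penalty), \<open>\<alpha>\<close>, the time step \<open>\<delta>\<close>, and last the precision
  \<open>\<eta>\<close> of the near-maximizer. The step \<open>\<delta>\<close> depends on \<open>\<alpha>\<close> but not on the near-maximizer, which is why
  equicontinuity of the trajectories is needed. From the near-maximizer, one step of length \<open>\<delta>\<close> would
  increase \<open>\<Phi>\<close> by more than \<open>\<eta>\<close>; if the terminal time is reached before, the terminal conditions and the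
  uniform continuity of \<open>h\<close> make \<open>\<Phi>\<close> too small there.\<close>

lemma u_le_v_at_start: "u t0 x0 \<le> v t0 x0"
proof (rule ccontr)
  assume gt: "\<not> u t0 x0 \<le> v t0 x0"
  define M0 where "M0 = u t0 x0 - v t0 x0"
  define \<kappa> where "\<kappa> = M0 / (2 * (T - t0))"
  have M0: "M0 > 0" using gt by (simp add: M0_def)
  have \<kappa>: "\<kappa> > 0" "\<kappa> * (T - t0) = M0 / 2" using M0 t0 by (auto simp: \<kappa>_def field_simps)
  obtain x1 where x1: "x1 \<in> X" "u t0 x1 = u t0 x0" "v t0 x1 = v t0 x0" by (rule X_start)
  obtain B where B: "\<And>t x. t \<in> {t0..T} \<Longrightarrow> x \<in> X \<Longrightarrow> u t x \<le> B" "\<And>t x. t \<in> {t0..T} \<Longrightarrow> x \<in> X \<Longrightarrow> - B \<le> v t x"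
    by (rule u_v_bounded) blast
  obtain R C where R: "R \<ge> 0" and C: "C > 0"
    and R_bound: "\<And>x t. x \<in> X \<Longrightarrow> t \<in> {0..T} \<Longrightarrow> norm (x t) \<le> R"
    and growth: "\<And>x y a b. x \<in> X \<Longrightarrow> y \<in> X \<Longrightarrow> t0 \<le> a \<Longrightarrow> a \<le> b \<Longrightarrow> b \<le> T \<Longrightarrow> D x y b \<le> D x y a + C * (b - a)"
    and D_sq: "\<And>x y t. x \<in> X \<Longrightarrow> y \<in> X \<Longrightarrow> t \<in> {t0..T} \<Longrightarrow> (D x y t)\<^sup>2 \<le> 4 * C * P x y t"
    by (rule X_bounds) blast
  obtain L0 where L0: "L0 \<ge> 0" "\<And>t x z w R. t \<in> {0..T} \<Longrightarrow> x \<in> paths T \<Longrightarrow> (\<And>s. s \<in> {0..t} \<Longrightarrow> norm (x s) \<le> R) \<Longrightarrow>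
      \<bar>F t x z - F t x w\<bar> \<le> L0 * (1 + R) * norm (z - w)"
    by (rule F_Lipschitz) blast
  have t0': "t0 \<in> {0..<T}" using t0 by simp
  obtain m where m: "modulus_of_continuity m" "\<forall>e>0. \<forall>t\<in>{t0..T}. \<forall>x\<in>trajectories T p q j A L t0 x0. \<forall>y\<in>trajectories T p q j A L t0 x0.
       F t x ((1 / e) *\<^sub>R (x t - y t)) - F t y ((1 / e) *\<^sub>R (x t - y t))
       \<le> m ((1 / e) * (norm (x t - y t))\<^sup>2 + (SUP s\<in>{0..t}. norm (x s - y s)))"
    using F L t0' x0_path unfolding admissible_hamiltonian_def by blast
  have mX: "F t x ((1 / e) *\<^sub>R (x t - y t)) - F t y ((1 / e) *\<^sub>R (x t - y t))
       \<le> m ((1 / e) * (norm (x t - y t))\<^sup>2 + (SUP s\<in>{0..t}. norm (x s - y s)))"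
    if "e > 0" "t \<in> {t0..T}" "x \<in> X" "y \<in> X" for e t x y
    using m(2) that X_trajectory by blast
  have "\<forall>\<^sub>F r in at_right 0. m r < \<kappa> / 8"
    using m(1) \<kappa>(1) by (intro order_tendstoD(2)[of m 0]) (auto simp: modulus_of_continuity_def)
  then obtain \<rho> where \<rho>: "\<rho> > 0" "\<And>r. 0 < r \<Longrightarrow> r < \<rho> \<Longrightarrow> m r < \<kappa> / 8"
    by (auto simp: eventually_at_right_field)
  have \<rho>': "m r \<le> \<kappa> / 8" if "0 \<le> r" "r < \<rho>" for r
    using \<rho>(2)[of r] that m(1) \<kappa>(1) by (cases "r = 0") (auto simp: modulus_of_continuity_def)
  have "M0 / 8 > 0" using M0 by simp
  then obtain d where d: "d > 0" "\<And>x y. x \<in> trajectories T p q j A L t0 x0 \<Longrightarrow> y \<in> trajectories T p q j A L t0 x0 \<Longrightarrow>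
      (\<And>t. t \<in> {0..T} \<Longrightarrow> norm (x t - y t) \<le> d) \<Longrightarrow> h x - h y \<le> M0 / 8"
    by (rule h_uniformly_continuous[OF t0 x0_path]) blast
  define \<sigma> where "\<sigma> = min (\<rho> / 2) d"
  have \<sigma>: "\<sigma> > 0" "\<sigma> \<le> \<rho> / 2" "\<sigma> \<le> d" using \<rho>(1) d(1) by (auto simp: \<sigma>_def)
  define \<theta> where "\<theta> = min (\<rho> / 8) (min (\<kappa> / 8) (\<sigma> ^ 4 / (8 * C)))"
  have \<theta>: "\<theta> > 0" "2 * \<theta> < \<rho> / 2" "2 * \<theta> \<le> \<kappa> / 4" using \<rho>(1) \<kappa>(1) \<sigma>(1) C by (auto simp: \<theta>_def min_def)
  have \<theta>4: "4 * C * (2 * \<theta>) \<le> \<sigma> ^ 4"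
  proof -
    have "\<theta> \<le> \<sigma> ^ 4 / (8 * C)" by (simp add: \<theta>_def)
    then show ?thesis using C by (simp add: field_simps)
  qed
  have close: "norm (x r - y r) \<le> \<sigma>"
    if x: "x \<in> X" and y: "y \<in> X" and t: "t \<in> {t0..T}" and P: "P x y t \<le> 2 * \<theta>" and r: "r \<in> {0..t}" for x y t r
  proof (rule history_distance_le[OF C D_sq x y t _ _ r])
    have "4 * C * P x y t \<le> 4 * C * (2 * \<theta>)" using P C by (intro mult_left_mono) auto
    then show "4 * C * P x y t \<le> \<sigma> ^ 4" using \<theta>4 by linarith
  qed (use \<sigma> in auto)
  have at_end: "\<Phi> \<kappa> \<alpha> T x y \<le> M0 / 8" if x: "x \<in> X" and y: "y \<in> X" and P: "P x y T \<le> 2 * \<theta>" and \<alpha>: "\<alpha> \<ge> 0" for x y \<alpha>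
  proof -
    have "h x - h y \<le> M0 / 8"
    proof (rule d(2)[OF X_trajectory[OF x] X_trajectory[OF y]])
      fix t assume "t \<in> {0..T}"
      then have "norm (x t - y t) \<le> \<sigma>" using close[OF x y _ P] t0 by simp
      then show "norm (x t - y t) \<le> d" using \<sigma>(3) by linarith
    qed
    moreover have "0 \<le> P x y T" using P_mono[OF x y order_refl, of T] t0 by simp
    then have "0 \<le> \<alpha> * ((D x y T + P x y T) / 2)" using \<alpha> D_nonneg[of x y T] by simp
    ultimately show ?thesis using terminal(1)[OF x] terminal(2)[OF y] by (simp add: \<Phi>_def)
  qed
  define S where "S = {t0..T} \<times> X \<times> X"
  define a where "a = (\<lambda>(t, x, y). u t x - v t y - \<kappa> * (T - t))"
  define b where "b = (\<lambda>(t, x, y). (D x y t + P x y t) / 2)"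
  have \<Phi>_ab: "\<Phi> \<kappa> \<alpha> t x y = a (t, x, y) - \<alpha> * b (t, x, y)" for \<alpha> t x y by (simp add: \<Phi>_def a_def b_def)
  have P_nonneg: "0 \<le> P x y t" if "x \<in> X" "y \<in> X" "t \<in> {t0..T}" for x y t
    using P_mono[OF that(1,2) order_refl, of t] that(3) by simp
  have s0: "(t0, x1, x1) \<in> S" using x1 t0 by (simp add: S_def)
  have b0: "b (t0, x1, x1) = 0" by (simp add: b_def D_def)
  have a_le: "a s \<le> 2 * B" if "s \<in> S" for s
  proof -
    obtain t x y where s: "s = (t, x, y)" "t \<in> {t0..T}" "x \<in> X" "y \<in> X" using \<open>s \<in> S\<close> by (auto simp: S_def)
    have "0 \<le> \<kappa> * (T - t)" using s(2) \<kappa>(1) by simp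
    then show ?thesis using B(1)[OF s(2,3)] B(2)[OF s(2,4)] by (simp add: s(1) a_def)
  qed
  have b_ge: "0 \<le> b s" if "s \<in> S" for s
    using \<open>s \<in> S\<close> P_nonneg D_nonneg by (auto simp: S_def b_def)
  have \<theta>8: "\<theta> / 8 > 0" using \<theta>(1) by simp
  obtain \<alpha> where \<alpha>: "\<alpha> \<ge> 1"
    "\<And>\<eta>'. \<eta>' > 0 \<Longrightarrow> \<exists>s\<in>S. (\<forall>s'\<in>S. a s' - \<alpha> * b s' \<le> a s - \<alpha> * b s + \<eta>') \<and> \<alpha> * b s \<le> 2 * (\<theta> / 8 + \<eta>')"
    using penalized_near_maximizer[where a=a and b=b and B="2 * B", OF s0 b0 a_le b_ge \<theta>8] by blast
  define \<omega> where "\<omega> = \<kappa> / (32 * \<alpha> * (L * (1 + R) + L0 * (1 + R) + 1))"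
  have LR: "0 \<le> L * (1 + R)" "0 \<le> L0 * (1 + R)" using L L0(1) R by auto
  have \<omega>0: "\<omega> > 0" unfolding \<omega>_def using \<kappa>(1) \<alpha>(1) LR by (intro divide_pos_pos mult_pos_pos) auto
  have \<omega>: "4 * \<alpha> * \<omega> * k \<le> \<kappa> / 8" if "0 \<le> k" "k \<le> L * (1 + R) + L0 * (1 + R) + 1" for k
  proof -
    have "4 * \<alpha> * \<omega> * k \<le> 4 * \<alpha> * \<omega> * (L * (1 + R) + L0 * (1 + R) + 1)"
      using \<alpha>(1) \<omega>0 that by (intro mult_left_mono) auto
    also have "\<dots> = \<kappa> / 8"
    proof -
      have "L * (1 + R) + L0 * (1 + R) + 1 \<noteq> 0" using LR by linarith
      then show ?thesis using \<alpha>(1) unfolding \<omega>_def by (simp add: divide_simps)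
    qed
    finally show ?thesis .
  qed
  obtain \<delta>1 where \<delta>1: "\<delta>1 > 0"
    "\<And>x s t. x \<in> trajectories T p q j A L t0 x0 \<Longrightarrow> s \<in> {0..T} \<Longrightarrow> t \<in> {0..T} \<Longrightarrow> \<bar>s - t\<bar> \<le> \<delta>1 \<Longrightarrow> norm (x s - x t) \<le> \<omega>"
    by (rule trajectories_equicontinuous[OF t0 x0_path \<omega>0]) blast
  define \<delta> where "\<delta> = min \<delta>1 (min (\<theta> / (\<alpha> * C)) (\<theta> / (4 * R\<^sup>2 + 1)))"
  have R4: "0 < 4 * R\<^sup>2 + 1" by (simp add: add_nonneg_pos)
  have \<delta>: "\<delta> > 0" "\<delta> \<le> \<delta>1" "\<alpha> * (C * \<delta>) \<le> \<theta>" "4 * R\<^sup>2 * \<delta> \<le> \<theta>"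
  proof -
    show "\<delta> > 0" using \<delta>1(1) \<theta>(1) \<alpha>(1) C R4 by (simp add: \<delta>_def)
    show "\<delta> \<le> \<delta>1" by (simp add: \<delta>_def)
    have "\<delta> \<le> \<theta> / (\<alpha> * C)" by (simp add: \<delta>_def)
    then show "\<alpha> * (C * \<delta>) \<le> \<theta>" using \<alpha>(1) C by (simp add: pos_le_divide_eq mult_ac)
    have "\<delta> \<le> \<theta> / (4 * R\<^sup>2 + 1)" by (simp add: \<delta>_def)
    then have "\<delta> * (4 * R\<^sup>2 + 1) \<le> \<theta>" using R4 by (simp add: pos_le_divide_eq)
    then show "4 * R\<^sup>2 * \<delta> \<le> \<theta>" using \<open>\<delta> > 0\<close> by (simp add: algebra_simps)
  qed
  define \<eta> where "\<eta> = min (\<theta> / 8) (min (\<kappa> * \<delta> / 4) (M0 / 8))"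
  have \<eta>: "\<eta> > 0" "\<eta> \<le> \<theta> / 8" "\<eta> \<le> \<kappa> * \<delta> / 4" "\<eta> \<le> M0 / 8" using \<theta>(1) \<kappa>(1) \<delta>(1) M0 by (auto simp: \<eta>_def)
  obtain s where s: "s \<in> S" "\<forall>s'\<in>S. a s' - \<alpha> * b s' \<le> a s - \<alpha> * b s + \<eta>" "\<alpha> * b s \<le> 2 * (\<theta> / 8 + \<eta>)"
    using \<alpha>(2)[OF \<eta>(1)] by blast
  obtain t x y where sxy: "s = (t, x, y)" "t \<in> {t0..T}" "x \<in> X" "y \<in> X" using s(1) by (auto simp: S_def)
  have max: "\<Phi> \<kappa> \<alpha> t' x' y' \<le> \<Phi> \<kappa> \<alpha> t x y + \<eta>" if "t' \<in> {t0..T}" "x' \<in> X" "y' \<in> X" for t' x' y'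
    using s(2) that unfolding \<Phi>_ab sxy(1) by (simp add: S_def)
  have "\<alpha> * (D x y t + P x y t) = 2 * (\<alpha> * b s)" by (simp add: b_def sxy(1))
  then have pen: "\<alpha> * (D x y t + P x y t) \<le> \<theta>"
  proof -
    have "2 * (\<theta> / 8 + \<eta>) \<le> \<theta> / 2" using \<eta>(2) by simp
    then have "\<alpha> * b s \<le> \<theta> / 2" using s(3) by (rule order_trans[rotated])
    then show ?thesis unfolding \<open>\<alpha> * (D x y t + P x y t) = 2 * (\<alpha> * b s)\<close> by simp
  qed
  have penD: "\<alpha> * D x y t \<le> \<theta>" and penP: "P x y t \<le> \<theta>"
  proof -
    have nn: "0 \<le> \<alpha> * D x y t" "0 \<le> \<alpha> * P x y t" using \<alpha>(1) D_nonneg[of x y t] P_nonneg[OF sxy(3,4,2)] by auto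
    then show "\<alpha> * D x y t \<le> \<theta>" using pen by (simp add: distrib_left)
    have "1 * P x y t \<le> \<alpha> * P x y t" using \<alpha>(1) P_nonneg[OF sxy(3,4,2)] by (rule mult_right_mono)
    then show "P x y t \<le> \<theta>" using pen nn by (simp add: distrib_left)
  qed
  have "\<Phi> \<kappa> \<alpha> t0 x1 x1 = M0 / 2" using b0 \<kappa>(2) x1(2,3) by (simp add: \<Phi>_ab a_def M0_def)
  then have large: "M0 / 2 \<le> \<Phi> \<kappa> \<alpha> t x y + M0 / 8" using max[OF _ x1(1) x1(1), of t0] \<eta>(4) t0 by simp
  show False
  proof (cases "t = T")
    case True
    then have "\<Phi> \<kappa> \<alpha> t x y \<le> M0 / 8" using at_end[OF sxy(3,4), of \<alpha>] penP \<theta>(1) \<alpha>(1) by simp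
    then show False using large M0 by linarith
  next
    case False
    then have t: "t \<in> {t0..<T}" using sxy(2) by auto
    define z where "z = \<alpha> *\<^sub>R (x t - y t)"
    have \<alpha>0: "0 \<le> \<alpha>" using \<alpha>(1) by simp
    obtain x' f y' g where step: "x' \<in> X" "y' \<in> X" "trajectory T p q j A L t x x' f" "trajectory T p q j A L t y y' g"
      "\<And>s. s \<in> {t..T} \<Longrightarrow>
        (\<lambda>r. (f r - g r) \<bullet> (\<alpha> *\<^sub>R (x' r - y' r) - z) + \<alpha> / 2 * D x' y' r + (F r x' z - F r y' z)) integrable_on {t..s} \<and>
        \<Phi> \<kappa> \<alpha> t x y + \<kappa> * (s - t) \<le> \<Phi> \<kappa> \<alpha> s x' y' +
          integral {t..s} (\<lambda>r. (f r - g r) \<bullet> (\<alpha> *\<^sub>R (x' r - y' r) - z) + \<alpha> / 2 * D x' y' r + (F r x' z - F r y' z))"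
      by (rule doubling_step[OF t sxy(3,4) \<alpha>0, of z \<kappa>]) blast
    have agree: "x' r = x r" "y' r = y r" if "r \<in> {0..t}" for r
      using step(3,4) that by (auto simp: trajectory_def)
    have tt: "0 \<le> t" "t0 \<le> t" "t < T" "t \<in> {0..T}" using t t0 by auto
    have Dt: "D x' y' t = D x y t" using agree[of t] tt by (simp add: D_def)
    have Pt: "P x' y' t = P x y t" unfolding P_def
      by (rule integral_cong) (use agree t0 in \<open>auto simp: D_def\<close>)
    define e where "e = min (t + \<delta>) T"
    have e: "t < e" "e \<le> T" "e - t \<le> \<delta>" using \<delta>(1) tt by (auto simp: e_def)
    \<comment> \<open>The smallness of the penalty at \<open>t\<close> persists up to \<open>e\<close>.\<close>
    have D_small: "\<alpha> * D x' y' r \<le> 2 * \<theta>" if r: "r \<in> {t..e}" for r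
    proof -
      have "D x' y' r \<le> D x' y' t + C * (r - t)" by (rule growth[OF step(1,2)]) (use r e tt in auto)
      also have "C * (r - t) \<le> C * \<delta>" using r e C by (intro mult_left_mono) auto
      finally have "\<alpha> * D x' y' r \<le> \<alpha> * (D x y t + C * \<delta>)" using \<alpha>0 Dt by (intro mult_left_mono) auto
      also have "\<dots> = \<alpha> * D x y t + \<alpha> * (C * \<delta>)" by (rule distrib_left)
      finally show ?thesis using penD \<delta>(3) by linarith
    qed
    have P_small: "P x' y' r \<le> 2 * \<theta>" if r: "r \<in> {t..e}" for r
    proof -
      have "(D x' y' has_integral (P x' y' r - P x' y' t)) {t..r}"
        by (rule D_has_integral[OF step(1,2)]) (use r e tt in auto)
      moreover have "((\<lambda>_. 4 * R\<^sup>2) has_integral (r - t) * (4 * R\<^sup>2)) {t..r}"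
        using has_integral_const_real[of "4 * R\<^sup>2" t r] r by simp
      moreover have "D x' y' q \<le> 4 * R\<^sup>2" if "q \<in> {t..r}" for q
      proof -
        have q: "q \<in> {0..T}" using that r e tt by auto
        have "norm (x' q - y' q) \<le> 2 * R"
          using norm_triangle_ineq4[of "x' q" "y' q"] R_bound[OF step(1) q] R_bound[OF step(2) q] by linarith
        then have "(norm (x' q - y' q))\<^sup>2 \<le> (2 * R)\<^sup>2" by (rule power_mono) simp
        then show ?thesis by (simp add: D_def power_mult_distrib)
      qed
      ultimately have "P x' y' r - P x' y' t \<le> (r - t) * (4 * R\<^sup>2)" by (rule has_integral_le)
      also have "\<dots> \<le> \<delta> * (4 * R\<^sup>2)" using r e by (intro mult_right_mono) auto
      finally show ?thesis using penP \<delta>(4) Pt by (simp add: mult_ac)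
    qed
    let ?G = "\<lambda>r. (f r - g r) \<bullet> (\<alpha> *\<^sub>R (x' r - y' r) - z) + \<alpha> / 2 * D x' y' r + (F r x' z - F r y' z)"
    have rhs: "\<exists>N. negligible N \<and> (\<forall>r\<in>{t..T} - N. norm (k r) \<le> L * (1 + R))"
      if w: "w \<in> X" and k: "trajectory T p q j A L t w0 w k" for w w0 k
    proof -
      obtain N where N: "negligible N" "\<And>r. r \<in> {t..T} - N \<Longrightarrow> norm (k r) \<le> L * (1 + (SUP s\<in>{0..r}. norm (w s)))"
        by (rule trajectory_data[OF k tt(1)]) blast
      have "norm (k r) \<le> L * (1 + R)" if r: "r \<in> {t..T} - N" for r
      proof -
        have "(SUP s\<in>{0..r}. norm (w s)) \<le> R" by (rule cSUP_least) (use R_bound[OF w] r tt in auto)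
        then have "L * (1 + (SUP s\<in>{0..r}. norm (w s))) \<le> L * (1 + R)" using L by (intro mult_left_mono) auto
        then show ?thesis using N(2)[OF r] by linarith
      qed
      then show ?thesis using N(1) by blast
    qed
    obtain N1 where N1: "negligible N1" "\<forall>r\<in>{t..T} - N1. norm (f r) \<le> L * (1 + R)" using rhs[OF step(1,3)] by blast
    obtain N2 where N2: "negligible N2" "\<forall>r\<in>{t..T} - N2. norm (g r) \<le> L * (1 + R)" using rhs[OF step(2,4)] by blast
    have e': "e \<in> {t..T}" using e by auto
    have "integral {t..e} ?G \<le> integral {t..e} (\<lambda>_. \<kappa> / 2)"
    proof (rule integral_le_off_negligible[OF conjunct1[OF step(5)[OF e']] _ negligible_Un[OF N1(1) N2(1)]])
      fix r assume r: "r \<in> {t..e} - (N1 \<union> N2)"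
      then have r': "r \<in> {t..e}" "r \<in> {t0..T}" "r \<in> {0..T}" "\<bar>r - t\<bar> \<le> \<delta>1" using e tt \<delta>(2) by auto
      show "?G r \<le> \<kappa> / 2"
      proof (rule integrand_bound[where m=m and R=R and \<rho>=\<rho> and t=t and \<omega>=\<omega> and \<sigma>=\<sigma> and ?L0.0=L0])
        show "norm (w q) \<le> R" if "w \<in> X" "q \<in> {0..T}" for w q by (rule R_bound[OF that])
        show "\<bar>F t x z - F t x w\<bar> \<le> L0 * (1 + R) * norm (z - w)"
          if "t \<in> {0..T}" "x \<in> paths T" "\<And>s. s \<in> {0..t} \<Longrightarrow> norm (x s) \<le> R" for t x z w R
          by (rule L0(2)) (fact that)+
        show "F t x ((1 / e) *\<^sub>R (x t - y t)) - F t y ((1 / e) *\<^sub>R (x t - y t))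
            \<le> m ((1 / e) * (norm (x t - y t))\<^sup>2 + (SUP s\<in>{0..t}. norm (x s - y s)))"
          if "e > 0" "t \<in> {t0..T}" "x \<in> X" "y \<in> X" for e t x y by (rule mX[OF that])
        show "m q \<le> \<kappa> / 8" if "0 \<le> q" "q < \<rho>" for q by (rule \<rho>'[OF that])
        show "4 * \<alpha> * \<omega> * (L * (1 + R)) \<le> \<kappa> / 8" "4 * \<alpha> * \<omega> * (L0 * (1 + R)) \<le> \<kappa> / 8"
          using LR by (intro \<omega>; linarith)+
        show "norm (x' r - x' t) \<le> \<omega>" "norm (y' r - y' t) \<le> \<omega>"
          by (rule \<delta>1(2)[OF X_trajectory[OF step(1)] r'(3) tt(4) r'(4)],
              rule \<delta>1(2)[OF X_trajectory[OF step(2)] r'(3) tt(4) r'(4)])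
        show "norm (f r) \<le> L * (1 + R)" "norm (g r) \<le> L * (1 + R)" using N1(2) N2(2) r e by auto
        show "\<alpha> * D x' y' r \<le> \<kappa> / 4" using D_small[OF r'(1)] \<theta>(3) by linarith
        show "\<alpha> * D x' y' r + \<sigma> < \<rho>" using D_small[OF r'(1)] \<theta>(2) \<sigma>(2) by linarith
        show "norm (x' q - y' q) \<le> \<sigma>" if "q \<in> {0..r}" for q
          by (rule close[OF step(1,2) r'(2) P_small[OF r'(1)] that])
        show "z = \<alpha> *\<^sub>R (x' t - y' t)" using agree[of t] tt by (simp add: z_def)
        show "0 < \<alpha>" "t \<in> {t0..T}" using \<alpha>(1) sxy(2) by auto
      qed (fact step(1) step(2) R L0(1) r'(2))+
    qed auto
    then have "integral {t..e} ?G \<le> (e - t) * (\<kappa> / 2)" using e by simp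
    moreover have "\<Phi> \<kappa> \<alpha> t x y + \<kappa> * (e - t) \<le> \<Phi> \<kappa> \<alpha> e x' y' + integral {t..e} ?G"
      using step(5)[OF e'] by (rule conjunct2)
    moreover have "\<kappa> * (e - t) = (e - t) * (\<kappa> / 2) + \<kappa> * (e - t) / 2" by simp
    ultimately have gain: "\<Phi> \<kappa> \<alpha> t x y + \<kappa> * (e - t) / 2 \<le> \<Phi> \<kappa> \<alpha> e x' y'" by linarith
    show False
    proof (cases "e = T")
      \<comment> \<open>The drift only has to be nonnegative if the step ends at the terminal time.\<close>
      case True
      have "P x' y' T \<le> 2 * \<theta>" using P_small[of T] True e by simp
      then have "\<Phi> \<kappa> \<alpha> T x' y' \<le> M0 / 8" by (rule at_end[OF step(1,2) _ \<alpha>0])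
      moreover have "0 \<le> \<kappa> * (e - t) / 2" using \<kappa>(1) e by simp
      ultimately show False using gain True large M0 by simp
    next
      case False
      then have "e - t = \<delta>" by (auto simp: e_def min_def split: if_splits)
      moreover have "\<Phi> \<kappa> \<alpha> e x' y' \<le> \<Phi> \<kappa> \<alpha> t x y + \<eta>" by (rule max) (use e tt step in auto)
      moreover have "0 < \<kappa> * \<delta>" using \<kappa>(1) \<delta>(1) by simp
      ultimately show False using gain \<eta>(3) by simp
    qed
  qed
qed

end

text \<open>Every point of \<open>\<Omega>\<close> at a time before \<open>T\<close> serves as the initial condition of the comparison.\<close>

theorem theorem4p4:
  fixes T p q L :: real
    and j :: "'v::{banach, second_countable_topology} \<Rightarrow>\<^sub>L
              'h::{real_inner, complete_space, second_countable_topology}"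
    and A :: "real \<Rightarrow> 'v \<Rightarrow> ('v \<Rightarrow>\<^sub>L real)"
    and F :: "real \<Rightarrow> (real \<Rightarrow> 'h) \<Rightarrow> 'h \<Rightarrow> real"
    and h :: "(real \<Rightarrow> 'h) \<Rightarrow> real"
    and xstar :: 'h
    and \<Omega> :: "(real \<Rightarrow> 'h) set"
    and u v :: "real \<Rightarrow> (real \<Rightarrow> 'h) \<Rightarrow> real"
  assumes "T > 0"
    and "p \<ge> 2" and "q > 1" and "1 / p + 1 / q = 1"
    and "reflexive_space TYPE('v)"
    and "dense_compact_embedding j"
    and "admissible_operator T p q A"
    and "continuous_map (mtopology_of (path_metric T)) euclideanreal h"
    and "admissible_hamiltonian T p q j A F"
    and "L \<ge> 0"
    and "Omega T p q j A xstar L \<subseteq> \<Omega>" and "\<Omega> \<subseteq> paths T"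
    and "minimax_subsolution T p q j A F h L \<Omega> u"
    and "minimax_supersolution T p q j A F h L \<Omega> v"
  shows "\<forall>t\<in>{0..T}. \<forall>x\<in>\<Omega>. u t x \<le> v t x"
proof (intro ballI)
  fix t x assume t: "t \<in> {0..T}" and x: "x \<in> \<Omega>"
  show "u t x \<le> v t x"
  proof (cases "t = T")
    case True
    have "u T x \<le> h x" "h x \<le> v T x"
      using assms(13,14) x by (auto simp: minimax_subsolution_def minimax_supersolution_def)
    then show ?thesis using True by simp
  next
    case False
    interpret comparison T p q j A F h L \<Omega> u v t x
      by unfold_locales (use assms t x False in auto)
    show ?thesis by (rule u_le_v_at_start)
  qed
qed

end
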